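(* Let $z_1,z_2$ be distinct points on $\mathbb P$ (different from the base-point $P$) and $v_1,v_2\in\mathbf g$. The current operators $j^{v_1}(z_1)$ and $j^{v_2}(z_2)$ can be composed and commute. As $z_2\to z_1$ one has $$\begin{aligned} j^{v_2}(z_2)j^{v_1}(z_1)&+\frac{(v_1,v_2)\,du_{z_1}du_{z_2}}{(u(z_1)-u(z_2))^2}-\frac{1}{u(z_2)-u(z_1)}\,du_{z_2}\,j^{[v_2,v_1]}(z_1)\\ &\longrightarrow\ \iota^{v_2}(z_1)\iota^{v_1}(z_1)+\epsilon^{v_2}(z_1)\epsilon^{v_1}(z_1)+\epsilon^{v_2}(z_1)\iota^{v_1}(z_1)+\epsilon^{v_1}(z_1)\iota^{v_2}(z_1)+\frac{d\hat\iota^{[v_2,v_1]}}{dz}(z_1)\,du_{z_1}^2 .\end{aligned}$$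
   Context: $\mathbb P$ is a complex projective line with canonical bundle $K$ (fibre $K_z$ at $z$); $P\in\mathbb P$ is a fixed base-point and $u$ is a coordinate (meromorphic function with exactly one pole, which is simple) with its pole at $P$. $\mathbf g$ is a complex Lie algebra with a nondegenerate invariant symmetric bilinear form $(\cdot,\cdot)$. $\mathfrak g_-$ is the Lie algebra of meromorphic maps $\alpha:\mathbb P\to\mathbf g$ regular and vanishing at $P$; $\mathfrak g_-^{z}$ and $\mathfrak g_-^{z_1,z_2}$ are the subalgebras of those that are moreover regular at $z$, respectively at $z_1$ and $z_2$. $U$ denotes the universal enveloping algebra, and $\mathbf 1=1\in\mathbb C\subset U\mathfrak g_-$. For $v\in\mathbf g$ and $z\ne P$: $\epsilon^v(z):U\mathfrak g_-\to U\mathfrak g_-\otimes K_z$ is left multiplication by $\epsilon^v_z=\frac{v}{u-u(z)}\otimes du_z$; and $\iota^v(z):U\mathfrak g_-^z\to U\mathfrak g_-^z\otimes K_z$ is defined inductively (simultaneously for all $v$) by $\iota^v(z)\mathbf 1=0$ and, for $\alpha\in\mathfrak g_-^z$ acting by left multiplication, $$\iota^v(z)\circ\alpha-\alpha\circ\iota^v(z)=-[\epsilon^v(z),\alpha]-(v,d\alpha(z))+\iota^{[v,\alpha(z)]}(z)+\epsilon^{[v,\alpha(z)]}(z).$$ The current is $j^v(z)=\epsilon^v(z)+\iota^v(z):U\mathfrak g_-^z\to U\mathfrak g_-\otimes K_z$. One writes $\iota^v(z)=\hat\iota^v(z)\,du_z$, and $d\hat\iota^v/dz$ is the derivative with respect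 to the coordinate $u(z)$. The factors $du_{z_1},du_{z_2}$ commute with each other and with everything else without signs. Products of currents at $z_1\ne z_2$ are composed on $U\mathfrak g_-^{z_1,z_2}$; the limit is taken after applying the operators to a fixed vector of $U\mathfrak g_-^{z_1}$, for which the products are defined when $z_2\neq z_1$ is near $z_1$.
   Formalization: The double-pole term (v_1,v_2)du du/(u(z_1)-u(z_2))^2 is subtracted rather than added: with the given rule for iota (central term -(v,d alpha(z))), the printed plus sign makes the left side diverge on the vector 1 whenever (v_1,v_2) is nonzero. *)

theory Defs
  imports "HOL-Complex_Analysis.Complex_Analysis" "HOL-Library.Poly_Mapping"
begin

class scaleC =
  fixes scaleC :: "complex \<Rightarrow> 'a \<Rightarrow> 'a"  (infixr \<open>*\<^sub>C\<close> 75)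

class complex_vector = scaleC + ab_group_add +
  assumes scaleC_add_right: "a *\<^sub>C (x + y) = a *\<^sub>C x + a *\<^sub>C y"
    and scaleC_add_left: "(a + b) *\<^sub>C x = a *\<^sub>C x + b *\<^sub>C x"
    and scaleC_scaleC: "a *\<^sub>C b *\<^sub>C x = (a * b) *\<^sub>C x"
    and scaleC_one: "1 *\<^sub>C x = x"

class complex_algebra_1 = complex_vector + ring_1 +
  assumes mult_scaleC_left: "a *\<^sub>C x * y = a *\<^sub>C (x * y)"
    and mult_scaleC_right: "x * a *\<^sub>C y = a *\<^sub>C (x * y)"

class complex_lie_algebra = complex_vector +
  fixes lie :: "'a \<Rightarrow> 'a \<Rightarrow> 'a"
  assumes lie_add_left: "lie (x + y) z = lie x z + lie y z"
    and lie_add_right: "lie x (y + z) = lie x y + lie x z"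
    and lie_scaleC_left: "lie (a *\<^sub>C x) y = a *\<^sub>C lie x y"
    and lie_scaleC_right: "lie x (a *\<^sub>C y) = a *\<^sub>C lie x y"
    and lie_self: "lie x x = 0"
    and jacobi: "lie x (lie y z) + lie y (lie z x) + lie z (lie x y) = 0"

definition nondegenerate_invariant_form :: "('g::complex_lie_algebra \<Rightarrow> 'g \<Rightarrow> complex) \<Rightarrow> bool" where
  "nondegenerate_invariant_form B \<longleftrightarrow>
     (\<forall>x y z. B (x + y) z = B x z + B y z) \<and>
     (\<forall>a x y. B (a *\<^sub>C x) y = a * B x y) \<and>
     (\<forall>x y. B x y = B y x) \<and>
     (\<forall>x y z. B (lie x y) z = B x (lie y z)) \<and>
     (\<forall>x. (\<forall>y. B x y = 0) \<longrightarrow> x = 0)"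


section \<open>The projective line\<close>

datatype proj_line = Aff complex | Infty

text \<open>A holomorphic parametrisation of a neighbourhood of \<open>p\<close>, sending \<open>0\<close> to \<open>p\<close>.\<close>

fun chart :: "proj_line \<Rightarrow> complex \<Rightarrow> proj_line" where
  "chart (Aff a) t = Aff (a + t)"
| "chart Infty t = (if t = 0 then Infty else Aff (1 / t))"

definition at_point :: "proj_line \<Rightarrow> proj_line filter" where
  "at_point p = filtermap (chart p) (at 0)"

definition meromorphic_fun :: "(proj_line \<Rightarrow> complex) \<Rightarrow> bool" where
  "meromorphic_fun f \<longleftrightarrow> (\<forall>p. (\<lambda>t. f (chart p t)) meromorphic_on {0})"

definition regular_fun :: "(proj_line \<Rightarrow> complex) \<Rightarrow> proj_line \<Rightarrow> bool" where
  "regular_fun f p \<longleftrightarrow> (\<lambda>t. f (chart p t)) analytic_on {0}"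

text \<open>The value of \<open>u\<close> at its pole \<open>P\<close> is irrelevant and left unspecified.\<close>

definition coordinate_with_pole :: "(proj_line \<Rightarrow> complex) \<Rightarrow> proj_line \<Rightarrow> bool" where
  "coordinate_with_pole u P \<longleftrightarrow>
     meromorphic_fun u \<and>
     (\<forall>p. p \<noteq> P \<longrightarrow> regular_fun u p) \<and>
     is_pole (\<lambda>t. u (chart P t)) 0 \<and> zorder (\<lambda>t. u (chart P t)) 0 = -1"


section \<open>Meromorphic maps to a Lie algebra\<close>

text \<open>
  A meromorphic map takes its values in a finite-dimensional subspace; no condition is imposed
  on the dimension of the Lie algebra itself. As for \<open>meromorphic_on\<close>, the values at poles
  are irrelevant, so a meromorphic map is represented by many functions, any two of which agree
  off a finite set. These are identified in the enveloping algebra below. Regularity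
  at \<open>p\<close>, on the other hand, includes that the function has the correct value at \<open>p\<close>.
\<close>

definition meromorphic_map :: "(proj_line \<Rightarrow> 'g::complex_vector) \<Rightarrow> bool" where
  "meromorphic_map \<alpha> \<longleftrightarrow>
     (\<exists>(n::nat) f e. (\<forall>k<n. meromorphic_fun (f k)) \<and> (\<forall>p. \<alpha> p = (\<Sum>k<n. f k p *\<^sub>C e k)))"

definition analytic_expansion ::
  "(proj_line \<Rightarrow> 'g::complex_vector) \<Rightarrow> proj_line \<Rightarrow> nat \<Rightarrow>
   (nat \<Rightarrow> complex \<Rightarrow> complex) \<Rightarrow> (nat \<Rightarrow> 'g) \<Rightarrow> bool" where
  "analytic_expansion \<alpha> p n f e \<longleftrightarrow>
     (\<forall>k<n. f k analytic_on {0}) \<and>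
     (\<forall>\<^sub>F t in nhds 0. \<alpha> (chart p t) = (\<Sum>k<n. f k t *\<^sub>C e k))"

definition regular_map :: "(proj_line \<Rightarrow> 'g::complex_vector) \<Rightarrow> proj_line \<Rightarrow> bool" where
  "regular_map \<alpha> p \<longleftrightarrow> (\<exists>n f e. analytic_expansion \<alpha> p n f e)"

text \<open>
  The coefficient \<open>d\<alpha>/du\<close> of \<open>du\<^sub>z\<close> in \<open>d\<alpha>(z)\<close>. Here and below all
  cotangent lines \<open>K\<^sub>z\<close>, \<open>z \<noteq> P\<close>, are trivialised by \<open>du\<^sub>z\<close>.
\<close>

definition deriv_wrt ::
  "(proj_line \<Rightarrow> complex) \<Rightarrow> (proj_line \<Rightarrow> 'g::complex_vector) \<Rightarrow> proj_line \<Rightarrow> 'g" where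
  "deriv_wrt u \<alpha> z = (THE a. \<exists>n f e. analytic_expansion \<alpha> z n f e \<and>
     a = (\<Sum>k<n. (deriv (f k) 0 / deriv (\<lambda>t. u (chart z t)) 0) *\<^sub>C e k))"

text \<open>\<open>gminus P {}\<close>, \<open>gminus P {z}\<close>, \<open>gminus P {z1, z2}\<close> are \<open>g\<^sub>-\<close> and its subalgebras
  of maps that are regular at the listed points.\<close>

definition gminus :: "proj_line \<Rightarrow> proj_line set \<Rightarrow> (proj_line \<Rightarrow> 'g::complex_vector) set" where
  "gminus P S = {\<alpha>. meromorphic_map \<alpha> \<and> regular_map \<alpha> P \<and> \<alpha> P = 0 \<and> (\<forall>z\<in>S. regular_map \<alpha> z)}"


section \<open>Universal enveloping algebras\<close>

text \<open>
  Finitely supported functions on words are the elements of the free algebra. The ideal of a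
  Lie algebra \<open>L\<close> of meromorphic maps imposes the linear relations and the
  relation \<open>\<alpha>\<beta> - \<beta>\<alpha> = [\<alpha>, \<beta>]\<close>; the operations
  of \<open>L\<close> are pointwise off a finite set. The case \<open>a = 1\<close>, \<open>b = 0\<close> of the linear relation
  identifies functions representing the same map.
\<close>

inductive_set enveloping_ideal ::
  "(proj_line \<Rightarrow> 'g::complex_lie_algebra) set \<Rightarrow> ((proj_line \<Rightarrow> 'g) list \<Rightarrow>\<^sub>0 complex) set"
  for L where
  zero: "0 \<in> enveloping_ideal L"
| add: "\<lbrakk>x \<in> enveloping_ideal L; y \<in> enveloping_ideal L\<rbrakk> \<Longrightarrow> x + y \<in> enveloping_ideal L"
| linear: "\<lbrakk>w \<in> lists L; w' \<in> lists L; \<alpha> \<in> L; \<beta> \<in> L; \<gamma> \<in> L;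
     finite {p. \<gamma> p \<noteq> a *\<^sub>C \<alpha> p + b *\<^sub>C \<beta> p}\<rbrakk> \<Longrightarrow>
     Poly_Mapping.single (w @ \<gamma> # w') c
     - Poly_Mapping.single (w @ \<alpha> # w') (c * a) - Poly_Mapping.single (w @ \<beta> # w') (c * b)
     \<in> enveloping_ideal L"
| bracket: "\<lbrakk>w \<in> lists L; w' \<in> lists L; \<alpha> \<in> L; \<beta> \<in> L; \<gamma> \<in> L;
     finite {p. \<gamma> p \<noteq> lie (\<alpha> p) (\<beta> p)}\<rbrakk> \<Longrightarrow>
     Poly_Mapping.single (w @ \<alpha> # \<beta> # w') c
     - Poly_Mapping.single (w @ \<beta> # \<alpha> # w') c - Poly_Mapping.single (w @ \<gamma> # w') c
     \<in> enveloping_ideal L"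

definition free_eval :: "('l \<Rightarrow> 'u::complex_algebra_1) \<Rightarrow> ('l list \<Rightarrow>\<^sub>0 complex) \<Rightarrow> 'u" where
  "free_eval \<eta> a =
     (\<Sum>w\<in>Poly_Mapping.keys a. Poly_Mapping.lookup a w *\<^sub>C prod_list (map \<eta> w))"

definition generated_subalgebra :: "('l \<Rightarrow> 'u::complex_algebra_1) \<Rightarrow> 'l set \<Rightarrow> 'u set" where
  "generated_subalgebra \<eta> L = free_eval \<eta> ` {a. Poly_Mapping.keys a \<subseteq> lists L}"

text \<open>
  The algebra \<open>'u\<close> with \<open>\<eta>\<close> is (a copy of) the enveloping algebra of \<open>L\<close>:
  the canonical map from the free algebra on \<open>L\<close> is onto, with kernel the ideal above.
\<close>

definition is_enveloping_algebra ::
  "(proj_line \<Rightarrow> 'g::complex_lie_algebra) set \<Rightarrow>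
   ((proj_line \<Rightarrow> 'g) \<Rightarrow> 'u::complex_algebra_1) \<Rightarrow> bool" where
  "is_enveloping_algebra L \<eta> \<longleftrightarrow>
     generated_subalgebra \<eta> L = UNIV \<and>
     (\<forall>a. Poly_Mapping.keys a \<subseteq> lists L \<longrightarrow> (free_eval \<eta> a = 0 \<longleftrightarrow> a \<in> enveloping_ideal L))"

text \<open>
  From now on \<open>\<eta>\<close> exhibits \<open>'u\<close> as the enveloping algebra of \<open>gminus P {}\<close>. The enveloping
  algebra of a subalgebra embeds (Poincare-Birkhoff-Witt), and is taken to be its image.
\<close>

definition Usub ::
  "proj_line \<Rightarrow> ((proj_line \<Rightarrow> 'g::complex_lie_algebra) \<Rightarrow> 'u::complex_algebra_1) \<Rightarrow>
   proj_line set \<Rightarrow> 'u set" where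
  "Usub P \<eta> S = generated_subalgebra \<eta> (gminus P S)"


section \<open>Current operators\<close>

text \<open>The explicit value \<open>0\<close> at \<open>P\<close> is needed because \<open>u P\<close> is unspecified.\<close>

definition eps ::
  "proj_line \<Rightarrow> (proj_line \<Rightarrow> complex) \<Rightarrow>
   ((proj_line \<Rightarrow> 'g::complex_lie_algebra) \<Rightarrow> 'u::complex_algebra_1) \<Rightarrow>
   proj_line \<Rightarrow> 'g \<Rightarrow> 'u" where
  "eps P u \<eta> z v = \<eta> (\<lambda>p. if p = P then 0 else (1 / (u p - u z)) *\<^sub>C v)"

text \<open>
  The inductive characterisation of the family \<open>v \<mapsto> \<iota>\<^sup>v(z)\<close> of linear operators
  on \<open>Usub P \<eta> {z}\<close>; outside this subalgebra the operators are set to \<open>0\<close>, which makes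
  the family unique.
\<close>

definition is_iota ::
  "('g::complex_lie_algebra \<Rightarrow> 'g \<Rightarrow> complex) \<Rightarrow> proj_line \<Rightarrow> (proj_line \<Rightarrow> complex) \<Rightarrow>
   ((proj_line \<Rightarrow> 'g) \<Rightarrow> 'u::complex_algebra_1) \<Rightarrow> proj_line \<Rightarrow> ('g \<Rightarrow> 'u \<Rightarrow> 'u) \<Rightarrow> bool" where
  "is_iota B P u \<eta> z I \<longleftrightarrow>
     (\<forall>v. \<forall>x\<in>Usub P \<eta> {z}. I v x \<in> Usub P \<eta> {z}) \<and>
     (\<forall>v. \<forall>x\<in>Usub P \<eta> {z}. \<forall>y\<in>Usub P \<eta> {z}. I v (x + y) = I v x + I v y) \<and>
     (\<forall>v c. \<forall>x\<in>Usub P \<eta> {z}. I v (c *\<^sub>C x) = c *\<^sub>C I v x) \<and>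
     (\<forall>v x. x \<notin> Usub P \<eta> {z} \<longrightarrow> I v x = 0) \<and>
     (\<forall>v. I v 1 = 0) \<and>
     (\<forall>v. \<forall>\<alpha>\<in>gminus P {z}. \<forall>x\<in>Usub P \<eta> {z}.
        I v (\<eta> \<alpha> * x) - \<eta> \<alpha> * I v x =
          - ((eps P u \<eta> z v * \<eta> \<alpha> - \<eta> \<alpha> * eps P u \<eta> z v) * x)
          - B v (deriv_wrt u \<alpha> z) *\<^sub>C x
          + I (lie v (\<alpha> z)) x + eps P u \<eta> z (lie v (\<alpha> z)) * x)"

definition iota ::
  "('g::complex_lie_algebra \<Rightarrow> 'g \<Rightarrow> complex) \<Rightarrow> proj_line \<Rightarrow> (proj_line \<Rightarrow> complex) \<Rightarrow>
   ((proj_line \<Rightarrow> 'g) \<Rightarrow> 'u::complex_algebra_1) \<Rightarrow> proj_line \<Rightarrow> 'g \<Rightarrow> 'u \<Rightarrow> 'u" where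
  "iota B P u \<eta> z = (THE I. is_iota B P u \<eta> z I)"

text \<open>
  With \<open>\<alpha>\<close> the element \<open>v'/(u - u(z'))\<close> of \<open>gminus P {z}\<close> the term \<open>- (v, d\<alpha>(z))\<close>
  equals \<open>+ (v, v')/(u(z) - u(z'))\<^sup>2\<close>; this is the double pole of a product of two currents.
\<close>

definition current ::
  "('g::complex_lie_algebra \<Rightarrow> 'g \<Rightarrow> complex) \<Rightarrow> proj_line \<Rightarrow> (proj_line \<Rightarrow> complex) \<Rightarrow>
   ((proj_line \<Rightarrow> 'g) \<Rightarrow> 'u::complex_algebra_1) \<Rightarrow> proj_line \<Rightarrow> 'g \<Rightarrow> 'u \<Rightarrow> 'u" where
  "current B P u \<eta> z v x = eps P u \<eta> z v * x + iota B P u \<eta> z v x"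


section \<open>Limits in the enveloping algebra\<close>

definition locally_uniform_limit ::
  "proj_line set \<Rightarrow> ('a \<Rightarrow> proj_line \<Rightarrow> complex) \<Rightarrow> (proj_line \<Rightarrow> complex) \<Rightarrow> 'a filter \<Rightarrow> bool" where
  "locally_uniform_limit S f g F \<longleftrightarrow>
     (\<forall>p\<in>S. \<exists>r>0. uniform_limit (chart p ` ball 0 r) f g F)"

text \<open>
  The convergence on the enveloping algebra that is compatible with its algebra structure and
  is generated by locally uniform convergence, off some finite set not containing \<open>P\<close>,
  of meromorphic functions vanishing at \<open>P\<close>. (The exceptional set is needed
  as \<open>1/(u - u(z))\<close> tends to \<open>1/(u - u(z1))\<close> for \<open>z \<rightarrow> z1\<close> only off \<open>z1\<close>.)
  It implies convergence in every topology that makes \<open>'u\<close> a topological algebra and in which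
  such convergent families converge. Limits are unique: symmetrisation turns
  a convergent family into a pointwise convergent one of functions of several points.
\<close>

inductive U_tendsto ::
  "proj_line \<Rightarrow> ((proj_line \<Rightarrow> 'g::complex_lie_algebra) \<Rightarrow> 'u::complex_algebra_1) \<Rightarrow>
   ('a \<Rightarrow> 'u) \<Rightarrow> 'u \<Rightarrow> 'a filter \<Rightarrow> bool"
  for P \<eta> where
  const: "U_tendsto P \<eta> (\<lambda>_. x) x F"
| generator: "\<lbrakk>finite Q; P \<notin> Q; locally_uniform_limit (- Q) f g F;
     \<And>z. (\<lambda>p. f z p *\<^sub>C v) \<in> gminus P {}; (\<lambda>p. g p *\<^sub>C v) \<in> gminus P {}\<rbrakk> \<Longrightarrow>
     U_tendsto P \<eta> (\<lambda>z. \<eta> (\<lambda>p. f z p *\<^sub>C v)) (\<eta> (\<lambda>p. g p *\<^sub>C v)) F"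
| scale: "\<lbrakk>(c \<longlongrightarrow> d) F; U_tendsto P \<eta> X x F\<rbrakk> \<Longrightarrow> U_tendsto P \<eta> (\<lambda>z. c z *\<^sub>C X z) (d *\<^sub>C x) F"
| add: "\<lbrakk>U_tendsto P \<eta> X x F; U_tendsto P \<eta> Y y F\<rbrakk> \<Longrightarrow> U_tendsto P \<eta> (\<lambda>z. X z + Y z) (x + y) F"
| mult: "\<lbrakk>U_tendsto P \<eta> X x F; U_tendsto P \<eta> Y y F\<rbrakk> \<Longrightarrow> U_tendsto P \<eta> (\<lambda>z. X z * Y z) (x * y) F"
| cong: "\<lbrakk>U_tendsto P \<eta> X x F; \<forall>\<^sub>F z in F. X z = Y z\<rbrakk> \<Longrightarrow> U_tendsto P \<eta> Y x F"

text \<open>\<open>y\<close> is the derivative at \<open>z\<close>, with respect to \<open>u\<close>, of the family \<open>X\<close>.\<close>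

definition U_has_derivative ::
  "proj_line \<Rightarrow> (proj_line \<Rightarrow> complex) \<Rightarrow>
   ((proj_line \<Rightarrow> 'g::complex_lie_algebra) \<Rightarrow> 'u::complex_algebra_1) \<Rightarrow>
   (proj_line \<Rightarrow> 'u) \<Rightarrow> 'u \<Rightarrow> proj_line \<Rightarrow> bool" where
  "U_has_derivative P u \<eta> X y z \<longleftrightarrow>
     U_tendsto P \<eta> (\<lambda>z'. (1 / (u z' - u z)) *\<^sub>C (X z' - X z)) y (at_point z)"

end

theory Submission
  imports Defs
begin

text \<open>
  The operator \<open>\<iota>\<^sup>v(z)\<close> is prescribed by a recursion on words in \<open>g\<^sub>-\<^sup>z\<close>, and
  the point is that it respects the relations between words that hold in the enveloping algebra of the
  larger algebra \<open>g\<^sub>-\<close>. The usual route is the Poincare-Birkhoff-Witt theorem; here analytic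
  continuation in \<open>z\<close> replaces it. The recursion for \<open>j = \<epsilon> + \<iota>\<close> visibly respects
  the relations of \<open>g\<^sub>-\<^sup>z\<close>. A relation of \<open>g\<^sub>-\<close> involves finitely
  many maps, hence is a relation of \<open>g\<^sub>-\<^sup>z\<close> with \<open>z'\<close> in place of \<open>z\<close> for all
  \<open>z' \<noteq> z\<close> near \<open>z\<close>, so \<open>\<iota>\<^sup>v(z')\<close> kills it. If the words are regular at
  \<open>z\<close>, then \<open>\<iota>\<^sup>v(z')\<close> of it is a finite sum of fixed vectors with coefficients
  analytic in \<open>z'\<close>, because elements of \<open>g\<^sub>-\<close> are rational functions of \<open>u\<close> and
  the poles at \<open>z'\<close> cancel. Hence \<open>\<iota>\<^sup>v(z)\<close> kills it as well.

  The same expansion gives the limit and the derivative of \<open>\<iota>\<^sup>v(z')\<close> in the operator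
  product, which is computed by moving \<open>\<epsilon>(z\<^sub>1)\<close> through \<open>j(z\<^sub>2)\<close>.
\<close>

subsection \<open>Rational functions\<close>

text \<open>A derivation of a relation in \<open>g_-\<close> may pass through letters with a pole at
  \<open>z\<close>, whose values there mean nothing to the recursion; so the relation cannot be
  checked step by step at \<open>z\<close> itself. Neither the Lie algebra nor the enveloping
  algebra carries a topology or a bound on its dimension. Analyticity is therefore tested by
  arbitrary linear functionals, and a Hamel basis supplies enough of them to separate points.
  Recording the subspace in which the fixed vectors of a finite sum lie pays off twice: it shows
  that \<open>iota\<close> preserves regularity at further points, so that currents at distinct
  points compose, and that its value at \<open>z\<close> itself is regular although single terms of
  the recursion are not. Since only scalars move in such sums, their convergence reduces to that of
  numbers; locally uniform convergence of functions enters only through the family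
  \<open>eps\<close>.\<close>

lemma norm_poly_le_power_degree:
  fixes q :: "complex poly"
  assumes "1 \<le> norm w"
  shows "norm (poly q w) \<le> (\<Sum>i\<le>degree q. norm (coeff q i)) * norm w ^ degree q"
proof -
  have "norm (poly q w) \<le> (\<Sum>i\<le>degree q. norm (coeff q i * w ^ i))"
    unfolding poly_altdef by (rule norm_sum)
  also have "\<dots> \<le> (\<Sum>i\<le>degree q. norm (coeff q i) * norm w ^ degree q)"
    by (intro sum_mono) (auto simp: norm_mult norm_power intro!: mult_left_mono power_increasing assms)
  finally show ?thesis
    by (simp add: sum_distrib_right)
qed

text \<open>The exponent is the pole order read off the Laurent expansion, or 0 if there is no
  pole.\<close>

lemma meromorphic_clear_pole:
  assumes "F meromorphic_on {b}"
  shows "\<exists>m c. (\<lambda>w. F w * (w - b) ^ m) \<midarrow>b\<rightarrow> c"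
proof -
  obtain L where L: "(\<lambda>w. F (b + w)) has_laurent_expansion L"
    using assms unfolding meromorphic_on_def by blast
  define m where "m = nat (- fls_subdegree L)"
  have "(\<lambda>w. F (b + w) * w ^ m) has_laurent_expansion L * fls_X ^ m"
    by (intro laurent_expansion_intros L)
  hence 1: "(\<lambda>w. (\<lambda>w. F w * (w - b) ^ m) (b + w)) has_laurent_expansion L * fls_X ^ m"
    by simp
  have "fls_subdegree (L * fls_X ^ m) \<ge> 0"
    by (cases "L = 0") (auto simp: m_def fls_subdegree_pow)
  from has_laurent_expansion_imp_tendsto[OF 1 this] show ?thesis by blast
qed

text \<open>By Liouville's theorem the function equals its Taylor polynomial of degree
  \<open>n\<close>.\<close>

lemma entire_growth_imp_poly:
  fixes f :: "complex \<Rightarrow> complex"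
  assumes "f holomorphic_on UNIV" and "\<And>w. A \<le> norm w \<Longrightarrow> norm (f w) \<le> B * norm w ^ n"
  shows "\<exists>p. degree p \<le> n \<and> (\<forall>w. f w = poly p w)"
proof -
  define p where "p = (\<Sum>k\<le>n. monom ((deriv ^^ k) f 0 / fact k) k)"
  have "degree p \<le> n"
    unfolding p_def by (intro degree_sum_le) (auto intro: order_trans[OF degree_monom_le])
  moreover have "f w = poly p w" for w
    using Liouville_polynomial[OF assms(1), of A B n w] assms(2) by (simp add: p_def poly_sum poly_monom)
  ultimately show ?thesis by blast
qed

text \<open>Analyticity near infinity leaves finitely many poles; clearing them by a polynomial
  gives an entire function of polynomial growth. The decay becomes the strict degree inequality, and
  \<open>T\<close> collects the points where the denominator must not vanish.\<close>

lemma meromorphic_decaying_imp_rational: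
  assumes F: "F meromorphic_on UNIV"
    and ana: "F analytic_on {w. R \<le> norm w}"
    and decay: "\<And>w. R \<le> norm w \<Longrightarrow> norm (F w) \<le> B / norm w"
    and T: "finite T" "F analytic_on T"
  shows "\<exists>p q. degree p < degree q \<and> (\<forall>t\<in>T. poly q t \<noteq> 0) \<and>
           finite {w. F w \<noteq> poly p w / poly q w}"
proof -
  define N where "N = {w. \<not> F analytic_on {w}}"
  have anaN: "F analytic_on {w}" if "w \<notin> N" for w
    using that by (simp add: N_def)
  have "N sparse_in UNIV"
    using meromorphic_on_imp_analytic_cosparse[OF F] by (simp add: eventually_cosparse N_def)
  hence "N sparse_in cball 0 R"
    by (rule sparse_in_subset) auto
  hence "finite (cball 0 R \<inter> N)"
    by (rule sparse_in_compact_finite) auto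
  moreover have "N \<subseteq> cball 0 R"
    using ana by (force simp: N_def intro: analytic_on_subset)
  ultimately have finN: "finite N"
    by (simp add: Int_absorb1)
  obtain b0 where b0: "b0 \<notin> T"
    using ex_new_if_finite[OF infinite_UNIV_char_0 T(1)] by blast
  define N' where "N' = insert b0 N"
  have finN': "finite N'" by (simp add: N'_def finN)
  have T': "t \<notin> N'" if "t \<in> T" for t
    using that b0 T(2) by (auto simp: N'_def N_def intro: analytic_on_subset)
  have "\<exists>m c. (\<lambda>w. F w * (w - b) ^ m) \<midarrow>b\<rightarrow> c" for b
    by (rule meromorphic_clear_pole) (rule meromorphic_on_subset[OF F], simp)
  then obtain m c where residue_u: "\<And>b. (\<lambda>w. F w * (w - b) ^ m b) \<midarrow>b\<rightarrow> c b"
    by metis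
  \<comment> \<open>The power \<open>m b\<close> would be enough for a finite limit. One more makes
    \<open>q\<close> vanish at every point of \<open>N'\<close>, also where \<open>m b\<close> is 0,
    so that the zero set of \<open>q\<close> is exactly \<open>N'\<close>.\<close>
  define q where "q = (\<Prod>b\<in>N'. [:-b, 1:] ^ Suc (m b))"
  have q0: "poly q w = 0 \<longleftrightarrow> w \<in> N'" for w
    by (auto simp: q_def poly_prod finN' simp del: power_Suc)
  have "q \<noteq> 0" using q0[of "SOME t. t \<notin> N'"] someI_ex[OF ex_new_if_finite[OF infinite_UNIV_char_0 finN']]
    by auto
  moreover have "poly q b0 = 0" by (simp add: q0 N'_def)
  ultimately have degq: "degree q > 0"
    by (metis degree_eq_zeroE gr0I poly_pCons mult_zero_right poly_0 add.right_neutral pCons_0_0)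
  define H where "H = (\<lambda>w. F w * poly q w)"
  have Hmero: "H meromorphic_on UNIV"
    unfolding H_def
    by (intro meromorphic_intros F analytic_on_imp_meromorphic_on)
       (auto simp: analytic_on_holomorphic intro!: holomorphic_intros exI[of _ UNIV])
  have anaH: "H analytic_on {w}" if "w \<notin> N" for w
    unfolding H_def
    by (intro analytic_on_mult anaN that)
       (auto simp: analytic_on_holomorphic intro!: holomorphic_intros exI[of _ UNIV])
  have limH: "\<exists>c. H \<midarrow>w\<rightarrow> c" for w
  proof (cases "w \<in> N")
    case False
    thus ?thesis using anaH analytic_at_imp_isCont isContD by blast
  next
    case True
    define r where "r = (\<Prod>b\<in>N'-{w}. [:-b, 1:] ^ Suc (m b))"
    have "q = [:-w, 1:] ^ Suc (m w) * r"
      unfolding q_def r_def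
      by (subst prod.remove[of _ w]) (use True in \<open>auto simp: finN finN' N'_def\<close>)
    hence "poly q x = (x - w) ^ Suc (m w) * poly r x" for x
      by (simp only: poly_mult poly_power) simp
    hence "H = (\<lambda>x. (F x * (x - w) ^ m w) * ((x - w) * poly r x))"
      by (simp add: H_def ac_simps)
    moreover have "\<dots> \<midarrow>w\<rightarrow> c w * ((w - w) * poly r w)"
      by (intro tendsto_intros residue_u)
    ultimately show ?thesis by auto
  qed
  \<comment> \<open>The values of \<open>H\<close> on \<open>N\<close> are arbitrary; the removable
    singularities are filled in to obtain an entire function.\<close>
  have G: "remove_sings H analytic_on {w}" for w
  proof -
    obtain c where "H \<midarrow>w\<rightarrow> c" using limH by blast
    moreover have "isolated_singularity_at H w"
      using meromorphic_on_subset[OF Hmero, of "{w}"] by (simp add: meromorphic_at_iff)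
    ultimately show ?thesis
      by (rule remove_sings_analytic_at[rotated])
  qed
  hence Ghol: "remove_sings H holomorphic_on UNIV"
    using analytic_on_analytic_at analytic_imp_holomorphic by blast
  have GH: "remove_sings H w = H w" if "w \<notin> N" for w
    using anaH[OF that] by simp
  define C where "C = (\<Sum>i\<le>degree q. norm (coeff q i))"
  have "norm (remove_sings H w) \<le> (B * C) * norm w ^ (degree q - 1)"
    if w: "max 1 (R + 1) \<le> norm w" for w
  proof -
    have "w \<notin> N" using w \<open>N \<subseteq> cball 0 R\<close> by auto
    have "B / norm w \<ge> 0"
      using order_trans[OF norm_ge_zero decay[of w]] w by auto
    have "norm (remove_sings H w) = norm (F w) * norm (poly q w)"
      using GH[OF \<open>w \<notin> N\<close>] by (simp add: H_def norm_mult)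
    also have "\<dots> \<le> (B / norm w) * (C * norm w ^ degree q)"
      unfolding C_def by (intro mult_mono decay norm_poly_le_power_degree) (use w \<open>B / norm w \<ge> 0\<close> in auto)
    also have "\<dots> = (B * C) * norm w ^ (degree q - 1)"
      using w degq by (cases "degree q") (auto simp: field_simps)
    finally show ?thesis .
  qed
  from entire_growth_imp_poly[OF Ghol this] obtain p where
    p: "degree p \<le> degree q - 1" "\<And>w. remove_sings H w = poly p w" by blast
  have "F w = poly p w / poly q w" if "w \<notin> N'" for w
    using GH[of w] p(2)[of w] that q0[of w] by (auto simp: H_def N'_def field_simps)
  hence "finite {w. F w \<noteq> poly p w / poly q w}"
    by (intro finite_subset[OF _ finN']) auto
  moreover have "\<forall>t\<in>T. poly q t \<noteq> 0" using T' q0 by blast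
  ultimately show ?thesis using p(1) degq by (intro exI[of _ p] exI[of _ q]) auto
qed

subsection \<open>Analytic families of vectors\<close>

interpretation cvec: vector_space "scaleC :: complex \<Rightarrow> 'a \<Rightarrow> 'a::complex_vector"
  by unfold_locales (auto simp: scaleC_add_right scaleC_add_left scaleC_scaleC scaleC_one)

definition clinear :: "('a::complex_vector \<Rightarrow> complex) \<Rightarrow> bool" where
  "clinear \<phi> \<longleftrightarrow> (\<forall>x y. \<phi> (x + y) = \<phi> x + \<phi> y) \<and> (\<forall>c x. \<phi> (c *\<^sub>C x) = c * \<phi> x)"

abbreviation ambient_basis :: "'a::complex_vector set" where
  "ambient_basis \<equiv> cvec.extend_basis {}"

text \<open>Coordinates over a Hamel basis, the source of linear functionals on a space without
  topology.\<close>

definition coord :: "'a::complex_vector \<Rightarrow> 'a \<Rightarrow> complex" where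
  "coord b x = cvec.representation ambient_basis x b"

lemma ambient_basis: "cvec.independent (ambient_basis :: 'a::complex_vector set)"
    "cvec.span (ambient_basis :: 'a set) = UNIV"
  by (simp_all add: cvec.independent_extend_basis cvec.independent_empty cvec.span_extend_basis)

lemma clinear_coord: "clinear (coord b)"
  unfolding clinear_def coord_def
  by (simp add: cvec.representation_add cvec.representation_scale ambient_basis)

lemma finite_coord: "finite {b. coord b x \<noteq> 0}"
  unfolding coord_def by (rule cvec.finite_representation)

lemma sum_coord:
  assumes "finite I" "{b. coord b x \<noteq> 0} \<subseteq> I"
  shows "(\<Sum>b\<in>I. coord b x *\<^sub>C b) = x"
proof -
  have "(\<Sum>b\<in>I. coord b x *\<^sub>C b) = (\<Sum>b | coord b x \<noteq> 0. coord b x *\<^sub>C b)"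
    by (rule sum.mono_neutral_right) (use assms in auto)
  also have "\<dots> = x"
    unfolding coord_def
    by (rule cvec.sum_nonzero_representation_eq[OF ambient_basis(1)], subst ambient_basis(2), rule UNIV_I)
  finally show ?thesis .
qed

lemma clinear_separates:
  assumes "\<And>\<phi>. clinear \<phi> \<Longrightarrow> \<phi> x = \<phi> y"
  shows "x = (y::'a::complex_vector)"
proof -
  have "coord b x = coord b y" for b :: 'a
    using assms clinear_coord by blast
  hence "(\<Sum>b | coord b x \<noteq> 0. coord b x *\<^sub>C b) = (\<Sum>b | coord b y \<noteq> 0. coord b y *\<^sub>C b)"
    by presburger
  thus ?thesis
    unfolding sum_coord[OF finite_coord order_refl] .
qed

lemma clinear_add: "clinear \<phi> \<Longrightarrow> \<phi> (x + y) = \<phi> x + \<phi> y"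
  and clinear_scale: "clinear \<phi> \<Longrightarrow> \<phi> (c *\<^sub>C x) = c * \<phi> x"
  by (auto simp: clinear_def)

lemma clinear_0: "clinear \<phi> \<Longrightarrow> \<phi> 0 = 0"
  using clinear_scale[of \<phi> 0 0] by simp

lemma clinear_sum: "clinear \<phi> \<Longrightarrow> \<phi> (sum f A) = (\<Sum>i\<in>A. \<phi> (f i))"
  by (induction A rule: infinite_finite_induct) (auto simp: clinear_0 clinear_add)

section \<open>Finite sums of fixed vectors with analytic coefficients\<close>

lemma analytic_at_has_derivative:
  "f analytic_on {a} \<Longrightarrow> (f has_field_derivative deriv f a) (at a)"
  by (simp add: DERIV_deriv_iff_field_differentiable analytic_on_imp_differentiable_at)

text \<open>The set \<open>Y\<close> records where the fixed vectors lie. The rule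
  \<open>cong\<close> works on full neighbourhoods of \<open>a\<close>, so that the value at
  \<open>a\<close> itself is controlled.\<close>

inductive analytic_family :: "complex \<Rightarrow> 'a::complex_vector set \<Rightarrow> (complex \<Rightarrow> 'a) \<Rightarrow> bool"
  for a Y where
  zero: "analytic_family a Y (\<lambda>_. 0)"
| scale: "\<lbrakk>c analytic_on {a}; y \<in> Y\<rbrakk> \<Longrightarrow> analytic_family a Y (\<lambda>w. c w *\<^sub>C y)"
| add: "\<lbrakk>analytic_family a Y X; analytic_family a Y X'\<rbrakk> \<Longrightarrow> analytic_family a Y (\<lambda>w. X w + X' w)"
| cong: "\<lbrakk>analytic_family a Y X; \<forall>\<^sub>F w in nhds a. X w = X' w\<rbrakk> \<Longrightarrow> analytic_family a Y X'"

lemma analytic_family_sum: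
  "(\<And>i. i \<in> I \<Longrightarrow> analytic_family a Y (X i)) \<Longrightarrow> analytic_family a Y (\<lambda>w. \<Sum>i\<in>I. X i w)"
  by (induction I rule: infinite_finite_induct) (auto intro: analytic_family.zero analytic_family.add)

lemma analytic_family_mult:
  assumes "analytic_family a Y X" "c analytic_on {a}"
  shows "analytic_family a Y (\<lambda>w. c w *\<^sub>C X w)"
  using assms(1)
proof induction
  case zero thus ?case by (simp add: analytic_family.zero)
next
  case (scale d y)
  thus ?case using analytic_family.scale[of "\<lambda>w. c w * d w" a y Y] assms(2)
    by (simp add: analytic_on_mult scaleC_scaleC)
next
  case (add X X') thus ?case using analytic_family.add by (simp add: scaleC_add_right)
next
  case (cong X X')
  from cong.hyps(2) have "\<forall>\<^sub>F w in nhds a. c w *\<^sub>C X w = c w *\<^sub>C X' w"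
    by eventually_elim simp
  with cong.IH show ?case by (rule analytic_family.cong)
qed

lemma analytic_family_linear_image:
  assumes "analytic_family a Y X"
    and "\<And>x y. L (x + y) = L x + L y" "\<And>c x. L (c *\<^sub>C x) = c *\<^sub>C L x" "L ` Y \<subseteq> Y'"
  shows "analytic_family a Y' (\<lambda>w. L (X w))"
  using assms(1)
proof induction
  case zero
  have "L 0 = 0" using assms(3)[of 0 0] by simp
  thus ?case by (simp add: analytic_family.zero)
next
  case (scale d y)
  thus ?case using assms by (auto simp: intro: analytic_family.scale)
next
  case (add X X') thus ?case using analytic_family.add assms by simp
next
  case (cong X X')
  from cong.hyps(2) have "\<forall>\<^sub>F w in nhds a. L (X w) = L (X' w)"
    by eventually_elim simp
  with cong.IH show ?case by (rule analytic_family.cong)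
qed

lemma analytic_family_functional:
  assumes "analytic_family a Y X" "clinear \<phi>"
  shows "(\<lambda>w. \<phi> (X w)) analytic_on {a}"
  using assms(1)
proof induction
  case (cong X X')
  from cong.hyps(2) have "\<forall>\<^sub>F w in nhds a. \<phi> (X w) = \<phi> (X' w)"
    by eventually_elim simp
  from analytic_at_cong[OF this refl] show ?case using cong.IH by simp
qed (auto simp: clinear_0 clinear_add clinear_scale assms intro!: analytic_intros)

text \<open>Every functional of either family is continuous at \<open>a\<close>, so no functional
  distinguishes the two values.\<close>

lemma analytic_family_identity:
  assumes "analytic_family a Y X" "analytic_family a Y' X'" "\<forall>\<^sub>F w in at a. X w = X' w"
  shows "X a = X' a"
proof (rule clinear_separates)
  fix \<phi> :: "'a \<Rightarrow> complex" assume \<phi>: "clinear \<phi>"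
  have 1: "((\<lambda>w. \<phi> (X w)) \<longlongrightarrow> \<phi> (X a)) (at a)" "((\<lambda>w. \<phi> (X' w)) \<longlongrightarrow> \<phi> (X' a)) (at a)"
    using analytic_family_functional[OF assms(1) \<phi>] analytic_family_functional[OF assms(2) \<phi>]
    by (auto dest: analytic_at_imp_isCont isContD)
  have "\<forall>\<^sub>F w in at a. \<phi> (X w) = \<phi> (X' w)"
    using assms(3) by eventually_elim simp
  hence "((\<lambda>w. \<phi> (X' w)) \<longlongrightarrow> \<phi> (X a)) (at a)"
    using 1(1) tendsto_cong by fast
  with 1(2) show "\<phi> (X a) = \<phi> (X' a)"
    using tendsto_unique trivial_limit_at by blast
qed

lemma analytic_family_identity_nhds:
  assumes "analytic_family a Y X" "analytic_family a Y' X'" "\<forall>\<^sub>F w in at a. X w = X' w"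
  shows "\<forall>\<^sub>F w in nhds a. X w = X' w"
proof -
  from assms(3) have "\<forall>\<^sub>F w in nhds a. w \<noteq> a \<longrightarrow> X w = X' w"
    by (simp add: eventually_at_filter)
  thus ?thesis
    by eventually_elim (use analytic_family_identity[OF assms] in auto)
qed

section \<open>Weak derivatives and brackets of families\<close>

text \<open>The derivative is tested by all functionals, for want of a norm. It is unique because
  functionals separate points, and this makes the definite description in \<open>deriv_wrt\<close>
  meaningful.\<close>

definition has_weak_deriv :: "(complex \<Rightarrow> 'a::complex_vector) \<Rightarrow> 'a \<Rightarrow> complex \<Rightarrow> bool" where
  "has_weak_deriv X d a \<longleftrightarrow>
     (\<forall>\<phi>. clinear \<phi> \<longrightarrow> ((\<lambda>w. \<phi> (X w)) has_field_derivative \<phi> d) (at a))"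

lemma has_weak_deriv_unique: "has_weak_deriv X d a \<Longrightarrow> has_weak_deriv X d' a \<Longrightarrow> d = d'"
  unfolding has_weak_deriv_def by (blast intro: clinear_separates DERIV_unique)

lemma has_weak_deriv_zero: "has_weak_deriv (\<lambda>_. 0) 0 a"
  by (simp add: has_weak_deriv_def clinear_0)

lemma has_weak_deriv_add:
  "has_weak_deriv X d a \<Longrightarrow> has_weak_deriv X' d' a \<Longrightarrow> has_weak_deriv (\<lambda>w. X w + X' w) (d + d') a"
  by (auto simp: has_weak_deriv_def clinear_add intro!: derivative_intros)

lemma has_weak_deriv_scale:
  "(c has_field_derivative c') (at a) \<Longrightarrow> has_weak_deriv (\<lambda>w. c w *\<^sub>C y) (c' *\<^sub>C y) a"
  by (auto simp: has_weak_deriv_def clinear_scale intro!: derivative_eq_intros)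

lemma has_weak_deriv_sum:
  "(\<And>i. i \<in> I \<Longrightarrow> has_weak_deriv (X i) (d i) a) \<Longrightarrow>
    has_weak_deriv (\<lambda>w. \<Sum>i\<in>I. X i w) (\<Sum>i\<in>I. d i) a"
  by (induction I rule: infinite_finite_induct) (auto intro: has_weak_deriv_zero has_weak_deriv_add)

lemma has_weak_deriv_cong:
  assumes "has_weak_deriv X d a" "\<forall>\<^sub>F w in nhds a. X w = X' w"
  shows "has_weak_deriv X' d a"
  unfolding has_weak_deriv_def
proof (intro allI impI)
  fix \<phi> :: "'a \<Rightarrow> complex" assume \<phi>: "clinear \<phi>"
  have "\<forall>\<^sub>F w in nhds a. \<phi> (X w) = \<phi> (X' w)" using assms(2) by eventually_elim simp
  thus "((\<lambda>w. \<phi> (X' w)) has_field_derivative \<phi> d) (at a)"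
    using assms(1) \<phi> by (metis has_weak_deriv_def DERIV_cong_ev)
qed

text \<open>The derivative is wanted at all points near \<open>a\<close>: it is later identified
  with \<open>deriv_wrt\<close> at a moving point, and that it is again a family makes this
  expression analytic in the point.\<close>

lemma analytic_family_has_weak_deriv:
  assumes "analytic_family a Y X"
  shows "\<exists>d. analytic_family a Y d \<and> (\<forall>\<^sub>F w in nhds a. has_weak_deriv X (d w) w)"
  using assms
proof induction
  case zero
  show ?case
    by (intro exI[of _ "\<lambda>_. 0"]) (simp add: analytic_family.zero has_weak_deriv_zero)
next
  case (scale c y)
  have "\<forall>\<^sub>F w in nhds a. c analytic_on {w}"
  proof -
    obtain S where "open S" "a \<in> S" "c analytic_on S"
      using scale.hyps(1) by (auto simp: analytic_at analytic_on_open)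
    thus ?thesis
      by (auto simp: eventually_nhds intro!: exI[of _ S] intro: analytic_on_subset)
  qed
  hence "\<forall>\<^sub>F w in nhds a. has_weak_deriv (\<lambda>w. c w *\<^sub>C y) (deriv c w *\<^sub>C y) w"
    by eventually_elim
      (intro has_weak_deriv_scale analytic_at_has_derivative)
  moreover have "analytic_family a Y (\<lambda>w. deriv c w *\<^sub>C y)"
    by (intro analytic_family.scale scale analytic_deriv)
  ultimately show ?case by blast
next
  case (add X X')
  then obtain d d' where d: "analytic_family a Y d" "\<forall>\<^sub>F w in nhds a. has_weak_deriv X (d w) w"
    "analytic_family a Y d'" "\<forall>\<^sub>F w in nhds a. has_weak_deriv X' (d' w) w" by blast
  from d(2,4) have "\<forall>\<^sub>F w in nhds a. has_weak_deriv (\<lambda>w. X w + X' w) (d w + d' w) w"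
    by eventually_elim (rule has_weak_deriv_add)
  thus ?case using analytic_family.add[OF d(1,3)] by blast
next
  case (cong X X')
  then obtain d where d: "analytic_family a Y d" "\<forall>\<^sub>F w in nhds a. has_weak_deriv X (d w) w"
    by blast
  from cong.hyps(2) have "\<forall>\<^sub>F w in nhds a. \<forall>\<^sub>F w in nhds w. X w = X' w"
    by (simp add: eventually_eventually)
  with d(2) have "\<forall>\<^sub>F w in nhds a. has_weak_deriv X' (d w) w"
    by eventually_elim (rule has_weak_deriv_cong)
  with d(1) show ?case by blast
qed

lemma lie_zero [simp]: "lie 0 x = 0" "lie x 0 = 0"
  using lie_scaleC_left[of 0 0 x] lie_scaleC_right[of x 0 0] by auto

lemma lie_minus_commute: "lie x y = - lie y x"
proof -
  have "lie x y + lie y x = lie (x + y) (x + y)"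
    by (simp add: lie_add_left lie_add_right lie_self[of x] lie_self[of y])
  also have "\<dots> = 0"
    by (rule lie_self)
  finally show ?thesis unfolding eq_neg_iff_add_eq_0 .
qed

lemma lie_minus_left: "lie (- x) y = - lie x y"
  using lie_scaleC_left[of "-1" x y] by (simp add: cvec.scale_minus_left scaleC_one)

lemma has_weak_deriv_linear:
  assumes "has_weak_deriv X d a" "\<And>x y. L (x + y) = L x + L y" "\<And>c x. L (c *\<^sub>C x) = c *\<^sub>C L x"
  shows "has_weak_deriv (\<lambda>w. L (X w)) (L d) a"
  unfolding has_weak_deriv_def
proof (intro allI impI)
  fix \<phi> :: "'b \<Rightarrow> complex" assume "clinear \<phi>"
  hence "clinear (\<lambda>x. \<phi> (L x))" by (simp add: clinear_def assms(2,3))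
  thus "((\<lambda>w. \<phi> (L (X w))) has_field_derivative \<phi> (L d)) (at a)"
    using assms(1) unfolding has_weak_deriv_def by blast
qed

text \<open>A functional of the bracket does not factor through functionals of the two arguments.
  Writing the first argument as a finite sum leaves brackets with fixed vectors, which are linear
  maps.\<close>

lemma has_weak_deriv_lie:
  assumes "analytic_family a Y X" "has_weak_deriv X d a" "has_weak_deriv X' d' a"
  shows "has_weak_deriv (\<lambda>w. lie (X w) (X' w)) (lie d (X' a) + lie (X a) d') a"
  using assms(1,2)
proof (induction arbitrary: d)
  case zero
  hence "d = 0" using has_weak_deriv_unique has_weak_deriv_zero by blast
  thus ?case by (simp add: has_weak_deriv_zero)
next
  case (scale c y)
  have c: "(c has_field_derivative deriv c a) (at a)"
    using scale.hyps(1) by (rule analytic_at_has_derivative)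
  hence d: "d = deriv c a *\<^sub>C y"
    using has_weak_deriv_unique has_weak_deriv_scale scale.prems by blast
  have "has_weak_deriv (\<lambda>w. lie y (X' w)) (lie y d') a"
    by (rule has_weak_deriv_linear[OF assms(3)]) (auto simp: lie_add_right lie_scaleC_right)
  hence "has_weak_deriv (\<lambda>w. c w *\<^sub>C lie y (X' w)) (deriv c a *\<^sub>C lie y (X' a) + c a *\<^sub>C lie y d') a"
    using c by (auto simp: has_weak_deriv_def clinear_scale clinear_add intro!: derivative_eq_intros)
  thus ?case by (simp add: d lie_scaleC_left)
next
  case (add X1 X2)
  obtain d1 d2 where d: "has_weak_deriv X1 d1 a" "has_weak_deriv X2 d2 a"
    using add.hyps[THEN analytic_family_has_weak_deriv] by (metis eventually_nhds_x_imp_x)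
  hence "d = d1 + d2"
    using add.prems has_weak_deriv_unique has_weak_deriv_add by blast
  thus ?case
    using has_weak_deriv_add[OF add.IH(1)[OF d(1)] add.IH(2)[OF d(2)]]
    by (simp add: lie_add_left algebra_simps)
next
  case (cong X1 X2)
  have ev: "\<forall>\<^sub>F w in nhds a. X2 w = X1 w" using cong.hyps(2) by eventually_elim simp
  hence a: "X2 a = X1 a" by (rule eventually_nhds_x_imp_x)
  have "\<forall>\<^sub>F w in nhds a. lie (X1 w) (X' w) = lie (X2 w) (X' w)"
    using cong.hyps(2) by eventually_elim simp
  from has_weak_deriv_cong[OF cong.IH[OF has_weak_deriv_cong[OF cong.prems ev]] this]
  show ?case by (simp add: a)
qed

text \<open>Vector and linear map both move with \<open>w\<close>. This serves the term of the
  recursion whose label \<open>lie v (\<alpha> z)\<close> depends on the point.\<close>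

lemma analytic_family_apply:
  assumes "analytic_family a UNIV X" "\<And>v. analytic_family a Y (\<lambda>w. G w v)"
    and "\<And>w x y. G w (x + y) = G w x + G w y" "\<And>w c x. G w (c *\<^sub>C x) = c *\<^sub>C G w x"
  shows "analytic_family a Y (\<lambda>w. G w (X w))"
  using assms(1)
proof induction
  case zero
  have "G w 0 = 0" for w using assms(4)[of w 0 0] by simp
  thus ?case by (simp add: analytic_family.zero)
next
  case (scale c y)
  from analytic_family_mult[OF assms(2) scale(1)] show ?case by (simp add: assms(4))
next
  case (add X X') thus ?case by (simp add: assms(3) analytic_family.add)
next
  case (cong X X')
  from cong.hyps(2) have "\<forall>\<^sub>F w in nhds a. G w (X w) = G w (X' w)" by eventually_elim simp
  with cong.IH show ?case by (rule analytic_family.cong)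
qed

lemma analytic_family_uminus: "analytic_family a Y X \<Longrightarrow> analytic_family a Y (\<lambda>w. - X w)"
  using analytic_family_mult[of a Y X "\<lambda>_. -1"] by (simp add: cvec.scale_minus_left scaleC_one)

lemma analytic_family_diff:
  "analytic_family a Y X \<Longrightarrow> analytic_family a Y X' \<Longrightarrow> analytic_family a Y (\<lambda>w. X w - X' w)"
  using analytic_family.add[OF _ analytic_family_uminus, of a Y X X'] by simp

lemma analytic_family_in_span:
  assumes "analytic_family a Y X" "0 \<in> Y" "\<And>x y. x \<in> Y \<Longrightarrow> y \<in> Y \<Longrightarrow> x + y \<in> Y"
    "\<And>c x. x \<in> Y \<Longrightarrow> c *\<^sub>C x \<in> Y"
  shows "X a \<in> Y"
  using assms(1)
proof induction
  case (cong X X') thus ?case using eventually_nhds_x_imp_x[OF cong.hyps(2)] by simp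
qed (use assms(2-) in auto)

lemma analytic_family_lie:
  assumes "analytic_family a UNIV X" "analytic_family a UNIV X'"
  shows "analytic_family a UNIV (\<lambda>w. lie (X w) (X' w))"
  using assms(1)
proof induction
  case zero thus ?case by (simp add: analytic_family.zero)
next
  case (scale c y)
  have "analytic_family a UNIV (\<lambda>w. lie y (X' w))"
    by (rule analytic_family_linear_image[OF assms(2)]) (auto simp: lie_add_right lie_scaleC_right)
  from analytic_family_mult[OF this scale(1)] show ?case by (simp add: lie_scaleC_left)
next
  case (add X Y) thus ?case by (simp add: lie_add_left analytic_family.add)
next
  case (cong X Y)
  from cong.hyps(2) have "\<forall>\<^sub>F w in nhds a. lie (X w) (X' w) = lie (Y w) (X' w)"
    by eventually_elim simp
  with cong.IH show ?case by (rule analytic_family.cong)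
qed

subsection \<open>Coordinates on the projective line\<close>

lemma analytic_at_comp:
  assumes "f analytic_on {g a}" "g analytic_on {a}"
  shows "(\<lambda>x. f (g x)) analytic_on {a}"
  using analytic_on_compose_gen[OF assms(2,1)] by (simp add: o_def)

lemma eventually_nhds_compose_analytic:
  assumes "\<forall>\<^sub>F y in nhds (g a). Q y" "g analytic_on {a}"
  shows "\<forall>\<^sub>F x in nhds a. Q (g x)"
proof -
  have "filterlim g (nhds (g a)) (nhds a)"
    using analytic_at_imp_isCont[OF assms(2)] by (simp add: isCont_def tendsto_at_iff_tendsto_nhds)
  with assms(1) show ?thesis by (rule eventually_compose_filterlim)
qed

lemma chart_0 [simp]: "chart p 0 = p"
  by (cases p) auto

lemma inj_chart: "inj (chart p)"
  by (cases p) (auto simp: inj_on_def split: if_splits)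

lemma chart_eq_iff [simp]: "chart p s = chart p t \<longleftrightarrow> s = t"
  using inj_chart by (auto dest: injD)

lemma eventually_chart_neq: "\<forall>\<^sub>F t in at 0. chart z t \<noteq> p"
proof (cases "\<exists>s. s \<noteq> 0 \<and> chart z s = p")
  case True
  then obtain s where s: "s \<noteq> 0" "chart z s = p" by blast
  have "\<forall>\<^sub>F t in at 0. t \<noteq> s"
    using s(1) by (intro tendsto_imp_eventually_ne) auto
  thus ?thesis by eventually_elim (use s in auto)
next
  case False
  hence "chart z t \<noteq> p" if "t \<noteq> 0" for t using that by blast
  thus ?thesis by (simp add: eventually_at_filter)
qed

text \<open>The single point that the chart around \<open>p\<close> misses; around
  \<open>Infty\<close> it is \<open>Aff 0\<close>, since \<open>1 / t\<close> never
  vanishes.\<close>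

fun antipode :: "proj_line \<Rightarrow> proj_line" where
  "antipode (Aff a) = Infty"
| "antipode Infty = Aff 0"

lemma antipode_neq: "antipode p \<noteq> p"
  by (cases p) auto

lemma chart_surj:
  assumes "x \<noteq> antipode p"
  shows "\<exists>t. x = chart p t"
proof (cases p)
  case (Aff a)
  with assms obtain b where "x = Aff b" by (cases x) auto
  thus ?thesis by (intro exI[of _ "b - a"]) (simp add: Aff)
next
  case Infty
  show ?thesis
  proof (cases x)
    case (Aff b)
    thus ?thesis by (intro exI[of _ "1 / b"]) (use assms Infty in auto)
  qed (auto intro!: exI[of _ 0] simp: Infty)
qed

text \<open>Regularity is stated in the chart centred at the point in question; the coordinate
  change lets it be read in a fixed chart.\<close>

lemma chart_transition:
  assumes "t0 \<noteq> 0"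
  shows "\<exists>\<sigma>. \<sigma> analytic_on {t0} \<and> \<sigma> t0 = 0 \<and>
           (\<forall>\<^sub>F t in nhds t0. chart p t = chart (chart p t0) (\<sigma> t))"
proof (cases p)
  case (Aff a)
  show ?thesis
    by (intro exI[of _ "\<lambda>t. t - t0"]) (auto simp: Aff intro!: analytic_intros)
next
  case Infty
  have "\<forall>\<^sub>F t in nhds t0. t \<noteq> 0"
    using assms by (rule t1_space_nhds)
  hence "\<forall>\<^sub>F t in nhds t0. chart p t = chart (chart p t0) (1 / t - 1 / t0)"
    by eventually_elim (use assms in \<open>auto simp: Infty\<close>)
  thus ?thesis
    using assms by (intro exI[of _ "\<lambda>t. 1 / t - 1 / t0"]) (auto intro!: analytic_intros)
qed

lemma chart_transition_antipode:
  "\<exists>\<sigma>. \<sigma> analytic_on {0} \<and> \<sigma> 0 = 0 \<and>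
     (\<forall>\<^sub>F s in nhds 0. (if s = 0 then antipode p else chart p (1 / s)) = chart (antipode p) (\<sigma> s))"
proof (cases p)
  case (Aff a)
  have "\<forall>\<^sub>F s in nhds 0. a * s + 1 \<noteq> 0"
    by (rule eventually_nhds_compose_analytic[where g = "\<lambda>s. a * s + 1"])
       (auto intro!: t1_space_nhds analytic_intros)
  hence "\<forall>\<^sub>F s in nhds 0. (if s = 0 then antipode p else chart p (1 / s)) = chart (antipode p) (s / (a * s + 1))"
    by eventually_elim (auto simp: Aff field_simps)
  thus ?thesis
    by (intro exI[of _ "\<lambda>s. s / (a * s + 1)"]) (auto intro!: analytic_intros)
next
  case Infty
  show ?thesis
    by (intro exI[of _ "\<lambda>s. s"]) (auto simp: Infty intro!: analytic_intros)
qed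

lemma regular_fun_chart:
  assumes "regular_fun f (chart p t0)" "t0 \<noteq> 0"
  shows "(\<lambda>t. f (chart p t)) analytic_on {t0}"
proof -
  obtain \<sigma> where \<sigma>: "\<sigma> analytic_on {t0}" "\<sigma> t0 = 0"
    "\<forall>\<^sub>F t in nhds t0. chart p t = chart (chart p t0) (\<sigma> t)"
    using chart_transition[OF assms(2)] by blast
  have "\<forall>\<^sub>F t in nhds t0. f (chart p t) = f (chart (chart p t0) (\<sigma> t))"
    using \<sigma>(3) by eventually_elim simp
  moreover have "(\<lambda>t. f (chart (chart p t0) (\<sigma> t))) analytic_on {t0}"
    by (rule analytic_at_comp) (use assms(1) \<sigma> in \<open>auto simp: regular_fun_def\<close>)
  ultimately show ?thesis using analytic_at_cong by fast
qed

lemma tendsto_antipode: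
  assumes "regular_fun f (antipode p)"
  shows "((\<lambda>s. f (chart p (1 / s))) \<longlongrightarrow> f (antipode p)) (at 0)"
proof -
  obtain \<sigma> where \<sigma>: "\<sigma> analytic_on {0}" "\<sigma> 0 = 0"
    "\<forall>\<^sub>F s in nhds 0. (if s = 0 then antipode p else chart p (1 / s)) = chart (antipode p) (\<sigma> s)"
    using chart_transition_antipode by blast
  have "(\<lambda>s. f (chart (antipode p) (\<sigma> s))) analytic_on {0}"
    by (rule analytic_at_comp) (use assms(1) \<sigma> in \<open>auto simp: regular_fun_def\<close>)
  hence "((\<lambda>s. f (chart (antipode p) (\<sigma> s))) \<longlongrightarrow> f (antipode p)) (at 0)"
    using \<sigma>(2) analytic_at_imp_isCont isContD by fastforce
  moreover from \<sigma>(3) have "\<forall>\<^sub>F s in at 0. f (chart (antipode p) (\<sigma> s)) = f (chart p (1 / s))"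
    unfolding eventually_at_filter by eventually_elim auto
  ultimately show ?thesis using tendsto_cong by fast
qed

section \<open>The coordinate as a Moebius map and its inverse\<close>

text \<open>Multiplication by \<open>t\<close> cancels the simple pole, and regularity at the
  antipode bounds \<open>u\<close> as \<open>t\<close> tends to infinity. The product is thus entire
  of linear growth.\<close>

lemma coordinate_moebius:
  assumes "coordinate_with_pole u P"
  shows "\<exists>c d. c \<noteq> 0 \<and> u (antipode P) = d \<and> (\<forall>t. t \<noteq> 0 \<longrightarrow> u (chart P t) = c / t + d)"
proof -
  define h where "h = (\<lambda>t. u (chart P t))"
  have reg: "regular_fun u p" if "p \<noteq> P" for p
    using assms that by (simp add: coordinate_with_pole_def)
  have pole: "is_pole h 0" and zo: "zorder h 0 = -1" and mero: "h meromorphic_on {0}"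
    using assms by (auto simp: coordinate_with_pole_def h_def meromorphic_fun_def)
  have hana: "h analytic_on {t}" if "t \<noteq> 0" for t
    unfolding h_def by (rule regular_fun_chart) (use reg chart_eq_iff[of P t 0] that in auto)
  have hol: "h holomorphic_on UNIV - {0}"
    by (rule analytic_imp_holomorphic, subst analytic_on_analytic_at) (use hana in auto)
  obtain r where r: "r > 0" "zor_poly h 0 holomorphic_on cball 0 r" "zor_poly h 0 0 \<noteq> 0"
    "\<And>w. w \<in> cball 0 r - {0} \<Longrightarrow> h w = zor_poly h 0 w / w"
    using zorder_exist_pole[OF hol open_UNIV UNIV_I pole] by (auto simp: zo)
  \<comment> \<open>The value at 0 is the leading coefficient at the pole; \<open>t * h t\<close>
    itself would give 0 there.\<close>
  define K where "K = (\<lambda>t. if t = 0 then zor_poly h 0 0 else t * h t)"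
  have K0: "K analytic_on {0}"
  proof -
    have "zor_poly h 0 analytic_on {0}"
      using r(1,2) by (auto simp: analytic_at intro!: exI[of _ "ball 0 r"] elim: holomorphic_on_subset)
    moreover have "\<forall>\<^sub>F t in nhds 0. t \<in> ball 0 r"
      using r(1) by (intro eventually_nhds_in_open) auto
    hence "\<forall>\<^sub>F t in nhds 0. zor_poly h 0 t = K t"
      by eventually_elim (use r(4) in \<open>auto simp: K_def\<close>)
    ultimately show ?thesis using analytic_at_cong by fast
  qed
  have "K analytic_on {t}" if "t \<noteq> 0" for t
  proof -
    have "\<forall>\<^sub>F x in nhds t. x \<noteq> 0" using that by (rule t1_space_nhds)
    hence "\<forall>\<^sub>F x in nhds t. x * h x = K x" by eventually_elim (auto simp: K_def)
    moreover have "(\<lambda>x. x * h x) analytic_on {t}" by (intro analytic_intros hana that)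
    ultimately show ?thesis using analytic_at_cong by fast
  qed
  with K0 have Khol: "K holomorphic_on UNIV"
    by (intro analytic_imp_holomorphic, subst analytic_on_analytic_at) metis
  define d where "d = u (antipode P)"
  have lim: "((\<lambda>s. h (1 / s)) \<longlongrightarrow> d) (at 0)"
  proof -
    have "antipode P \<noteq> P" by (cases P) auto
    thus ?thesis unfolding h_def d_def by (intro tendsto_antipode reg)
  qed
  have "\<forall>\<^sub>F s in at 0. norm (h (1 / s)) < norm d + 1"
    by (rule order_tendstoD[OF tendsto_norm[OF lim]]) simp
  then obtain e where e: "e > 0" "\<And>s. s \<noteq> 0 \<Longrightarrow> norm s < e \<Longrightarrow> norm (h (1 / s)) < norm d + 1"
    by (auto simp: eventually_at dist_norm)
  have "norm (K w) \<le> (norm d + 1) * norm w ^ 1" if "1 / e + 1 \<le> norm w" for w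
  proof -
    have "1 / e > 0" using e(1) by simp
    with that have "norm w > 1 / e" "norm w > 0" by linarith+
    hence "w \<noteq> 0" by auto
    have "norm (1 / w) < e" using \<open>norm w > 1 / e\<close> \<open>norm w > 0\<close> e(1) by (simp add: norm_divide field_simps)
    from e(2)[OF _ this] have "norm (h w) < norm d + 1" using \<open>w \<noteq> 0\<close> by simp
    thus ?thesis using \<open>w \<noteq> 0\<close> by (simp add: K_def norm_mult mult.commute)
  qed
  from entire_growth_imp_poly[OF Khol this] obtain p where p: "degree p \<le> 1" "\<And>w. K w = poly p w"
    by blast
  define c where "c = coeff p 0"
  define d' where "d' = coeff p 1"
  have "p = [:c, d':]"
    using p(1) by (intro poly_eqI) (auto simp: c_def d'_def coeff_pCons coeff_eq_0 split: nat.splits)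
  hence K: "K w = c + d' * w" for w using p(2)[of w] by (simp add: mult.commute)
  have "c \<noteq> 0" using K[of 0] r(3) by (simp add: K_def)
  have h: "h t = c / t + d'" if "t \<noteq> 0" for t
    using K[of t] that by (simp add: K_def field_simps)
  \<comment> \<open>With \<open>t = 1 / s\<close> the limit of \<open>c / t + d'\<close> at infinity
    is \<open>d'\<close>, and it is also the value of \<open>u\<close> at the antipode.\<close>
  have "((\<lambda>s. c * s + d') \<longlongrightarrow> c * 0 + d') (at 0)"
    by (intro tendsto_intros)
  moreover have "\<forall>\<^sub>F s in at 0. c * s + d' = h (1 / s)"
    by (auto simp: eventually_at_filter h)
  ultimately have "((\<lambda>s. h (1 / s)) \<longlongrightarrow> d') (at 0)"
    using tendsto_cong by fastforce
  with lim have "d = d'" using tendsto_unique trivial_limit_at by blast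
  thus ?thesis using \<open>c \<noteq> 0\<close> h by (auto simp: d_def h_def)
qed

locale line_coordinate =
  fixes P :: proj_line and u :: "proj_line \<Rightarrow> complex"
  assumes coordinate: "coordinate_with_pole u P"
begin

definition residue_u :: complex where
  "residue_u = (SOME c. c \<noteq> 0 \<and> (\<forall>t. t \<noteq> 0 \<longrightarrow> u (chart P t) = c / t + u (antipode P)))"

abbreviation u_antipode :: complex where "u_antipode \<equiv> u (antipode P)"

lemma residue_u_nonzero: "residue_u \<noteq> 0" and u_chart_P: "t \<noteq> 0 \<Longrightarrow> u (chart P t) = residue_u / t + u_antipode"
proof -
  have "\<exists>c. c \<noteq> 0 \<and> (\<forall>t. t \<noteq> 0 \<longrightarrow> u (chart P t) = c / t + u (antipode P))"
    using coordinate_moebius[OF coordinate] by blast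
  from someI_ex[OF this, folded residue_u_def]
  show "residue_u \<noteq> 0" "t \<noteq> 0 \<Longrightarrow> u (chart P t) = residue_u / t + u_antipode"
    by blast+
qed

text \<open>The inverse of \<open>u\<close> off \<open>P\<close>. The antipode is a separate case
  because it has no parameter in the chart around \<open>P\<close>.\<close>

definition pt :: "complex \<Rightarrow> proj_line" where
  "pt w = (if w = u_antipode then antipode P else chart P (residue_u / (w - u_antipode)))"

lemma u_pt [simp]: "u (pt w) = w"
  using residue_u_nonzero by (simp add: pt_def u_chart_P)

lemma pt_neq_P [simp]: "pt w \<noteq> P"
  using residue_u_nonzero antipode_neq[of P] chart_eq_iff[of P "residue_u / (w - u_antipode)" 0] by (auto simp: pt_def)

lemma pt_u [simp]: "p \<noteq> P \<Longrightarrow> pt (u p) = p"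
proof (cases "p = antipode P")
  case False
  assume "p \<noteq> P"
  from False obtain t where t: "p = chart P t" using chart_surj by blast
  with \<open>p \<noteq> P\<close> have "t \<noteq> 0" by auto
  thus ?thesis using residue_u_nonzero by (simp add: t u_chart_P pt_def)
qed (auto simp: pt_def)

lemma u_eq_iff: "p \<noteq> P \<Longrightarrow> q \<noteq> P \<Longrightarrow> u p = u q \<longleftrightarrow> p = q"
  by (metis pt_u)

lemma pt_eq_iff_u: "p \<noteq> P \<Longrightarrow> pt w = p \<longleftrightarrow> w = u p"
  by (metis pt_u u_pt)

lemma finite_u_vimage: "finite A \<Longrightarrow> finite {p. u p \<in> A}"
  by (rule finite_subset[of _ "insert P (pt ` A)"]) (auto simp: image_iff intro: pt_u[symmetric])

lemma finite_pt_vimage: "finite A \<Longrightarrow> finite {w. pt w \<in> A}"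
  by (rule finite_subset[of _ "u ` A"]) (auto simp: image_iff intro: u_pt[symmetric])

text \<open>The chart parameter is an analytic function of \<open>u\<close>. This is the bridge from
  regularity, stated in charts, to analyticity in the coordinate.\<close>

lemma pt_chart:
  assumes "z \<noteq> P"
  shows "\<exists>\<psi>. \<psi> analytic_on {u z} \<and> \<psi> (u z) = 0 \<and> (\<forall>\<^sub>F w in nhds (u z). chart z (\<psi> w) = pt w)"
proof (cases "z = antipode P")
  case True
  obtain \<sigma> where \<sigma>: "\<sigma> analytic_on {0}" "\<sigma> 0 = 0"
    "\<forall>\<^sub>F s in nhds 0. (if s = 0 then antipode P else chart P (1 / s)) = chart (antipode P) (\<sigma> s)"
    using chart_transition_antipode by blast
  have an: "(\<lambda>w. (w - u_antipode) / residue_u) analytic_on {u_antipode}" using residue_u_nonzero by (intro analytic_intros) auto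
  have "\<forall>\<^sub>F w in nhds u_antipode. (if (w - u_antipode) / residue_u = 0 then antipode P else chart P (1 / ((w - u_antipode) / residue_u)))
      = chart (antipode P) (\<sigma> ((w - u_antipode) / residue_u))"
    by (rule eventually_nhds_compose_analytic[OF _ an]) (use \<sigma>(3) in simp)
  hence "\<forall>\<^sub>F w in nhds u_antipode. chart z (\<sigma> ((w - u_antipode) / residue_u)) = pt w"
    by eventually_elim (use residue_u_nonzero in \<open>auto simp: pt_def True split: if_splits\<close>)
  moreover have "(\<lambda>w. \<sigma> ((w - u_antipode) / residue_u)) analytic_on {u_antipode}"
    by (rule analytic_at_comp[OF _ an]) (use \<sigma> in simp)
  ultimately show ?thesis using \<sigma>(2) by (intro exI[of _ "\<lambda>w. \<sigma> ((w - u_antipode) / residue_u)"]) (auto simp: True)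
next
  case False
  then obtain t0 where t0: "z = chart P t0" using chart_surj by blast
  with assms have "t0 \<noteq> 0" by auto
  obtain \<sigma> where \<sigma>: "\<sigma> analytic_on {t0}" "\<sigma> t0 = 0"
    "\<forall>\<^sub>F t in nhds t0. chart P t = chart (chart P t0) (\<sigma> t)"
    using chart_transition[OF \<open>t0 \<noteq> 0\<close>] by blast
  have uz: "u z = residue_u / t0 + u_antipode" using \<open>t0 \<noteq> 0\<close> by (simp add: t0 u_chart_P)
  hence uz_neq: "u z \<noteq> u_antipode" using residue_u_nonzero \<open>t0 \<noteq> 0\<close> by simp
  have eq: "residue_u / (u z - u_antipode) = t0" using residue_u_nonzero by (simp add: uz)
  have an: "(\<lambda>w. residue_u / (w - u_antipode)) analytic_on {u z}" using uz_neq by (intro analytic_intros) auto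
  have "\<forall>\<^sub>F w in nhds (u z). chart P (residue_u / (w - u_antipode)) = chart z (\<sigma> (residue_u / (w - u_antipode)))"
    by (rule eventually_nhds_compose_analytic[OF _ an]) (use \<sigma>(3) in \<open>simp add: eq t0[symmetric]\<close>)
  moreover have "\<forall>\<^sub>F w in nhds (u z). w \<noteq> u_antipode" using uz_neq by (rule t1_space_nhds)
  ultimately have "\<forall>\<^sub>F w in nhds (u z). chart z (\<sigma> (residue_u / (w - u_antipode))) = pt w"
    by eventually_elim (auto simp: pt_def)
  moreover have "(\<lambda>w. \<sigma> (residue_u / (w - u_antipode))) analytic_on {u z}"
    by (rule analytic_at_comp[OF _ an]) (use \<sigma> eq in simp)
  ultimately show ?thesis
    using \<sigma>(2) eq by (intro exI[of _ "\<lambda>w. \<sigma> (residue_u / (w - u_antipode))"]) auto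
qed

lemma u_chart_analytic: "z \<noteq> P \<Longrightarrow> (\<lambda>t. u (chart z t)) analytic_on {0}"
  using coordinate by (simp add: coordinate_with_pole_def regular_fun_def)

lemma u_chart_meromorphic: "(\<lambda>t. u (chart z t)) meromorphic_on {0}"
  using coordinate by (simp add: coordinate_with_pole_def meromorphic_fun_def)

text \<open>In the chart \<open>u\<close> is a local homeomorphism with inverse
  \<open>\<psi>\<close>, so punctured neighbourhoods correspond.\<close>

lemma filtermap_u_chart:
  assumes "z \<noteq> P"
  shows "filtermap (\<lambda>t. u (chart z t)) (at 0) = at (u z)"
proof -
  obtain \<psi> where \<psi>: "\<psi> analytic_on {u z}" "\<psi> (u z) = 0"
    "\<forall>\<^sub>F w in nhds (u z). chart z (\<psi> w) = pt w"
    using pt_chart[OF assms] by blast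
  have "\<forall>\<^sub>F w in at (u z). chart z (\<psi> w) = pt w"
    using \<psi>(3) by (auto simp: eventually_at_filter elim: eventually_mono)
  hence ev: "\<forall>\<^sub>F w in at (u z). u (chart z (\<psi> w)) = w"
    by eventually_elim simp
  show ?thesis
  proof (rule filtermap_fun_inverse[where g = \<psi>])
    show "\<forall>\<^sub>F w in at (u z). u (chart z (\<psi> w)) = w" by (rule ev)
    have "(\<psi> \<longlongrightarrow> 0) (at (u z))" using analytic_at_imp_isCont[OF \<psi>(1)] \<psi>(2) by (simp add: isCont_def)
    moreover from ev have "\<forall>\<^sub>F w in at (u z). \<psi> w \<noteq> 0"
      unfolding eventually_at_filter by eventually_elim auto
    ultimately show "filterlim \<psi> (at 0) (at (u z))" by (simp add: filterlim_at)
    have "((\<lambda>t. u (chart z t)) \<longlongrightarrow> u z) (at 0)"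
      using analytic_at_imp_isCont[OF u_chart_analytic[OF assms]] by (simp add: isCont_def)
    moreover have "\<forall>\<^sub>F t in at 0. u (chart z t) \<noteq> u z"
      using eventually_chart_neq[of z P] eventually_chart_neq[of z z]
      by eventually_elim (use assms u_eq_iff in auto)
    ultimately show "filterlim (\<lambda>t. u (chart z t)) (at (u z)) (at 0)" by (simp add: filterlim_at)
  qed
qed

lemma at_point_eq:
  assumes "z \<noteq> P"
  shows "at_point z = filtermap pt (at (u z))"
proof -
  have "\<forall>\<^sub>F t in at 0. pt (u (chart z t)) = chart z t"
    using eventually_chart_neq[of z P] by eventually_elim simp
  hence "filtermap pt (filtermap (\<lambda>t. u (chart z t)) (at 0)) = at_point z"
    unfolding at_point_def filter_eq_iff eventually_filtermap
    by (intro allI eventually_subst) (auto elim: eventually_mono)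
  thus ?thesis
    unfolding filtermap_u_chart[OF assms] by (rule sym)
qed

lemma eventually_at_point: "z \<noteq> P \<Longrightarrow> (\<forall>\<^sub>F x in at_point z. Q x) \<longleftrightarrow> (\<forall>\<^sub>F w in at (u z). Q (pt w))"
  by (simp add: at_point_eq eventually_filtermap)

lemma eventually_chart_neq_P: "z \<noteq> P \<Longrightarrow> \<forall>\<^sub>F t in nhds 0. chart z t \<noteq> P"
  using eventually_chart_neq[of z P] unfolding eventually_at_filter
  by (auto elim: eventually_mono)

lemma analytic_expansion_pt:
  assumes "z \<noteq> P" "analytic_expansion \<alpha> z n f e"
  shows "\<exists>g. (\<forall>k<n. g k analytic_on {u z} \<and>
             deriv (g k) (u z) = deriv (f k) 0 / deriv (\<lambda>t. u (chart z t)) 0) \<and>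
           (\<forall>\<^sub>F w in nhds (u z). \<alpha> (pt w) = (\<Sum>k<n. g k w *\<^sub>C e k))"
proof -
  obtain \<psi> where \<psi>: "\<psi> analytic_on {u z}" "\<psi> (u z) = 0"
    "\<forall>\<^sub>F w in nhds (u z). chart z (\<psi> w) = pt w"
    using pt_chart[OF assms(1)] by blast
  have f: "f k analytic_on {0}" if "k < n" for k
    using assms(2) that by (auto simp: analytic_expansion_def)
  have ev: "\<forall>\<^sub>F t in nhds 0. \<alpha> (chart z t) = (\<Sum>k<n. f k t *\<^sub>C e k)"
    using assms(2) by (auto simp: analytic_expansion_def)
  have D\<psi>: "(\<psi> has_field_derivative deriv \<psi> (u z)) (at (u z))"
    using \<psi>(1) by (rule analytic_at_has_derivative)
  have Du: "((\<lambda>t. u (chart z t)) has_field_derivative deriv (\<lambda>t. u (chart z t)) 0) (at (\<psi> (u z)))"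
    using u_chart_analytic[OF assms(1)] \<psi>(2) by (simp add: analytic_at_has_derivative)
  have D: "((\<lambda>w. u (chart z (\<psi> w))) has_field_derivative deriv (\<lambda>t. u (chart z t)) 0 * deriv \<psi> (u z)) (at (u z))"
    using DERIV_chain2[OF Du D\<psi>] .
  have ev': "\<forall>\<^sub>F w in nhds (u z). u (chart z (\<psi> w)) = w"
    using \<psi>(3) by eventually_elim simp
  from D have "((\<lambda>w. w) has_field_derivative deriv (\<lambda>t. u (chart z t)) 0 * deriv \<psi> (u z)) (at (u z))"
    unfolding DERIV_cong_ev[OF refl ev' refl] .
  \<comment> \<open>Differentiating \<open>u (chart z (\<psi> w)) = w\<close> also shows that the
    derivative of \<open>u\<close> does not vanish at \<open>z\<close>, so that dividing by it is
    legitimate.\<close>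
  hence one: "deriv (\<lambda>t. u (chart z t)) 0 * deriv \<psi> (u z) = 1"
    using DERIV_unique[OF _ DERIV_ident] by blast
  define g where "g = (\<lambda>k w. f k (\<psi> w))"
  have "g k analytic_on {u z}" if "k < n" for k
    unfolding g_def by (rule analytic_at_comp[OF _ \<psi>(1)]) (use f that \<psi>(2) in simp)
  moreover have "deriv (g k) (u z) = deriv (f k) 0 / deriv (\<lambda>t. u (chart z t)) 0" if "k < n" for k
  proof -
    have "(f k has_field_derivative deriv (f k) 0) (at (\<psi> (u z)))"
      using f[OF that] \<psi>(2) by (simp add: analytic_at_has_derivative)
    from DERIV_chain2[OF this D\<psi>] have "deriv (g k) (u z) = deriv (f k) 0 * deriv \<psi> (u z)"
      unfolding g_def by (rule DERIV_imp_deriv)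
    also have "deriv \<psi> (u z) = 1 / deriv (\<lambda>t. u (chart z t)) 0"
      using one by (metis nonzero_mult_div_cancel_left mult_zero_left zero_neq_one)
    finally show ?thesis by simp
  qed
  moreover have "\<forall>\<^sub>F w in nhds (u z). \<alpha> (pt w) = (\<Sum>k<n. g k w *\<^sub>C e k)"
  proof -
    have "\<forall>\<^sub>F w in nhds (u z). \<alpha> (chart z (\<psi> w)) = (\<Sum>k<n. g k w *\<^sub>C e k)"
      unfolding g_def by (rule eventually_nhds_compose_analytic[OF _ \<psi>(1)]) (use ev \<psi>(2) in simp)
    with \<psi>(3) show ?thesis by eventually_elim simp
  qed
  ultimately show ?thesis by blast
qed

lemma regular_map_imp_analytic_family:
  assumes "z \<noteq> P" "regular_map \<alpha> z"
  shows "analytic_family (u z) UNIV (\<lambda>w. \<alpha> (pt w))"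
proof -
  obtain n f e where "analytic_expansion \<alpha> z n f e" using assms(2) by (auto simp: regular_map_def)
  from analytic_expansion_pt[OF assms(1) this] obtain g where
    g: "\<And>k. k < n \<Longrightarrow> g k analytic_on {u z}" "\<forall>\<^sub>F w in nhds (u z). \<alpha> (pt w) = (\<Sum>k<n. g k w *\<^sub>C e k)"
    by blast
  have "analytic_family (u z) UNIV (\<lambda>w. \<Sum>k<n. g k w *\<^sub>C e k)"
    by (intro analytic_family_sum analytic_family.scale g) auto
  thus ?thesis by (rule analytic_family.cong) (use g(2) in \<open>simp add: eq_commute\<close>)
qed

text \<open>Every expansion computes the weak derivative of one and the same function, hence the
  result does not depend on the expansion.\<close>

lemma deriv_wrt:
  assumes "z \<noteq> P" "regular_map \<alpha> z"
  shows "has_weak_deriv (\<lambda>w. \<alpha> (pt w)) (deriv_wrt u \<alpha> z) (u z)"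
proof -
  have *: "has_weak_deriv (\<lambda>w. \<alpha> (pt w))
      (\<Sum>k<n. (deriv (f k) 0 / deriv (\<lambda>t. u (chart z t)) 0) *\<^sub>C e k) (u z)"
    if "analytic_expansion \<alpha> z n f e" for n f e
  proof -
    from analytic_expansion_pt[OF assms(1) that] obtain g where
      g: "\<And>k. k < n \<Longrightarrow> g k analytic_on {u z}"
        "\<And>k. k < n \<Longrightarrow> deriv (g k) (u z) = deriv (f k) 0 / deriv (\<lambda>t. u (chart z t)) 0"
        "\<forall>\<^sub>F w in nhds (u z). (\<Sum>k<n. g k w *\<^sub>C e k) = \<alpha> (pt w)"
      by (auto simp: eq_commute)
    have "has_weak_deriv (\<lambda>w. \<Sum>k<n. g k w *\<^sub>C e k)
      (\<Sum>k<n. (deriv (f k) 0 / deriv (\<lambda>t. u (chart z t)) 0) *\<^sub>C e k) (u z)"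
      by (intro has_weak_deriv_sum has_weak_deriv_scale)
         (use g(1) in \<open>simp add: analytic_at_has_derivative flip: g(2)\<close>)
    thus ?thesis by (rule has_weak_deriv_cong) (rule g)
  qed
  obtain n f e where nfe: "analytic_expansion \<alpha> z n f e" using assms(2) by (auto simp: regular_map_def)
  have "deriv_wrt u \<alpha> z = (\<Sum>k<n. (deriv (f k) 0 / deriv (\<lambda>t. u (chart z t)) 0) *\<^sub>C e k)"
    unfolding deriv_wrt_def
    by (rule the_equality) (use nfe has_weak_deriv_unique * in blast)+
  thus ?thesis using *[OF nfe] by simp
qed

lemma regular_map_pt:
  assumes "z \<noteq> P" "c analytic_on {u z}" "\<forall>\<^sub>F w in nhds (u z). \<alpha> (pt w) = c w *\<^sub>C y"
  shows "regular_map \<alpha> z"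
proof -
  have "\<forall>\<^sub>F t in nhds 0. \<alpha> (pt (u (chart z t))) = c (u (chart z t)) *\<^sub>C y"
    by (rule eventually_nhds_compose_analytic[OF _ u_chart_analytic[OF assms(1)]])
       (use assms(3) in simp)
  with eventually_chart_neq_P[OF assms(1)]
  have "\<forall>\<^sub>F t in nhds 0. \<alpha> (chart z t) = (\<Sum>k<Suc 0. c (u (chart z t)) *\<^sub>C y)"
    by eventually_elim simp
  moreover have "(\<lambda>t. c (u (chart z t))) analytic_on {0}"
    by (rule analytic_at_comp[OF _ u_chart_analytic[OF assms(1)]]) (use assms(2) in simp)
  ultimately have "analytic_expansion \<alpha> z (Suc 0) (\<lambda>_ t. c (u (chart z t))) (\<lambda>_. y)"
    by (simp add: analytic_expansion_def)
  thus ?thesis unfolding regular_map_def by blast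
qed

text \<open>The identity principle: a finite exceptional set does not accumulate at
  \<open>u z\<close>, and regularity includes the correct value at \<open>z\<close>.\<close>

lemma regular_maps_agree:
  assumes "z \<noteq> P" "regular_map \<alpha> z" "regular_map \<beta> z" "finite {p. \<alpha> p \<noteq> \<beta> p}"
  shows "\<forall>\<^sub>F w in nhds (u z). \<alpha> (pt w) = \<beta> (pt w)"
proof (rule analytic_family_identity_nhds)
  show "analytic_family (u z) UNIV (\<lambda>w. \<alpha> (pt w))" "analytic_family (u z) UNIV (\<lambda>w. \<beta> (pt w))"
    using regular_map_imp_analytic_family assms by blast+
  have "finite {w. pt w \<in> {p. \<alpha> p \<noteq> \<beta> p}}" by (rule finite_pt_vimage[OF assms(4)])
  hence "\<forall>\<^sub>F w in at (u z). w \<notin> {w. pt w \<in> {p. \<alpha> p \<noteq> \<beta> p}}"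
    using islimpt_iff_eventually islimpt_finite by blast
  thus "\<forall>\<^sub>F w in at (u z). \<alpha> (pt w) = \<beta> (pt w)"
    by eventually_elim simp
qed

end

subsection \<open>Maps as rational functions of the coordinate\<close>

lemma analytic_at_poly_compose: "f analytic_on {a} \<Longrightarrow> (\<lambda>x. poly p (f x)) analytic_on {a}"
  unfolding poly_altdef by (intro analytic_intros)

lemma meromorphic_at_poly_compose: "f meromorphic_on A \<Longrightarrow> (\<lambda>x. poly p (f x)) meromorphic_on A"
  unfolding poly_altdef by (intro meromorphic_intros)

lemma poly_divide_reflect:
  fixes p :: "complex poly"
  assumes "s \<noteq> 0"
  shows "poly p (1 / s) = poly (reflect_poly p) s / s ^ degree p"
  using assms poly_reflect_poly_nz[of s p] by (simp add: field_simps inverse_eq_divide)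

lemma coeff_synthetic_div_analytic: "(\<lambda>c. coeff (synthetic_div p c) i) analytic_on {a}"
proof (induction p arbitrary: i)
  case (pCons b p)
  have "(\<lambda>c. poly p c) analytic_on {a}" by (intro analytic_at_poly_compose analytic_intros)
  with pCons show ?case by (cases i) auto
qed simp

lemma meromorphic_at_cong:
  assumes "f meromorphic_on {a}" "\<forall>\<^sub>F x in at a. f x = g x"
  shows "g meromorphic_on {a}"
  using meromorphic_on_cong[of "{a}" f g "{a}"] assms by simp

lemma meromorphic_funD: "meromorphic_fun f \<Longrightarrow> (\<lambda>t. f (chart p t)) meromorphic_on {0}"
  by (simp add: meromorphic_fun_def)

lemma sum_scaleC_concat:
  fixes n m :: nat and e e' :: "nat \<Rightarrow> 'a::complex_vector"
  shows "(\<Sum>k<n + m. (if k < n then f k else f' (k - n)) *\<^sub>C (if k < n then e k else e' (k - n))) =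
     (\<Sum>k<n. f k *\<^sub>C e k) + (\<Sum>k<m. f' k *\<^sub>C e' k)"
  by (induction m) (simp_all add: add.assoc)

lemma meromorphic_map_add:
  assumes "meromorphic_map \<alpha>" "meromorphic_map \<beta>"
  shows "meromorphic_map (\<lambda>p. \<alpha> p + \<beta> p)"
proof -
  obtain n f e where 1: "\<forall>k<n::nat. meromorphic_fun (f k)" "\<And>p. \<alpha> p = (\<Sum>k<n. f k p *\<^sub>C e k)"
    using assms(1) by (auto simp: meromorphic_map_def)
  obtain m f' e' where 2: "\<forall>k<m::nat. meromorphic_fun (f' k)" "\<And>p. \<beta> p = (\<Sum>k<m. f' k p *\<^sub>C e' k)"
    using assms(2) by (auto simp: meromorphic_map_def)
  have "meromorphic_fun (\<lambda>p. if k < n then f k p else f' (k - n) p)" if "k < n + m" for k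
    using 1(1) 2(1) that by (cases "k < n") auto
  thus ?thesis
    unfolding meromorphic_map_def 1(2) 2(2) sum_scaleC_concat[symmetric]
    by (intro exI[of _ "n + m"] exI[of _ "\<lambda>k p. if k < n then f k p else f' (k - n) p"]
        exI[of _ "\<lambda>k. if k < n then e k else e' (k - n)"]) simp
qed

lemma regular_map_add:
  assumes "regular_map \<alpha> z" "regular_map \<beta> z"
  shows "regular_map (\<lambda>p. \<alpha> p + \<beta> p) z"
proof -
  obtain n f e where 1: "\<forall>k<n::nat. f k analytic_on {0}" "\<forall>\<^sub>F t in nhds 0. \<alpha> (chart z t) = (\<Sum>k<n. f k t *\<^sub>C e k)"
    using assms(1) by (auto simp: regular_map_def analytic_expansion_def)
  obtain m f' e' where 2: "\<forall>k<m::nat. f' k analytic_on {0}" "\<forall>\<^sub>F t in nhds 0. \<beta> (chart z t) = (\<Sum>k<m. f' k t *\<^sub>C e' k)"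
    using assms(2) by (auto simp: regular_map_def analytic_expansion_def)
  have "\<forall>\<^sub>F t in nhds 0. \<alpha> (chart z t) + \<beta> (chart z t) =
      (\<Sum>k<n + m. (if k < n then f k t else f' (k - n) t) *\<^sub>C (if k < n then e k else e' (k - n)))"
    using 1(2) 2(2)
  proof eventually_elim
    case (elim t)
    show ?case
      unfolding elim by (rule sum_scaleC_concat[where f = "\<lambda>k. f k t" and f' = "\<lambda>k. f' k t"
        and e = e and e' = e' and n = n and m = m, symmetric])
  qed
  moreover have "(\<lambda>t. if k < n then f k t else f' (k - n) t) analytic_on {0}" if "k < n + m" for k
    using 1(1) 2(1) that by (cases "k < n") auto
  ultimately have "analytic_expansion (\<lambda>p. \<alpha> p + \<beta> p) z (n + m) (\<lambda>k t. if k < n then f k t else f' (k - n) t)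
      (\<lambda>k. if k < n then e k else e' (k - n))"
    by (simp add: analytic_expansion_def)
  thus ?thesis unfolding regular_map_def by blast
qed

lemma zero_in_gminus: "(\<lambda>_. 0) \<in> gminus P S"
proof -
  have "meromorphic_map (\<lambda>_. 0 :: 'a)"
    unfolding meromorphic_map_def by (intro exI[of _ 0]) simp
  moreover have "regular_map (\<lambda>_. 0 :: 'a) z" for z
    unfolding regular_map_def analytic_expansion_def by (intro exI[of _ 0]) simp
  ultimately show ?thesis by (simp add: gminus_def)
qed

lemma add_in_gminus: "\<alpha> \<in> gminus P S \<Longrightarrow> \<beta> \<in> gminus P S \<Longrightarrow> (\<lambda>p. \<alpha> p + \<beta> p) \<in> gminus P S"
  by (simp add: gminus_def meromorphic_map_add regular_map_add)

lemma sum_in_gminus: "(\<And>i. i \<in> I \<Longrightarrow> \<alpha> i \<in> gminus P S) \<Longrightarrow> (\<lambda>p. \<Sum>i\<in>I. \<alpha> i p) \<in> gminus P S"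
  by (induction I rule: infinite_finite_induct) (auto intro: zero_in_gminus add_in_gminus)

lemma gminus_mono: "S \<subseteq> S' \<Longrightarrow> gminus P S' \<subseteq> gminus P S"
  by (auto simp: gminus_def)

context line_coordinate
begin

section \<open>Rational maps and their regularity\<close>

definition ratfun :: "complex poly \<Rightarrow> complex poly \<Rightarrow> proj_line \<Rightarrow> complex" where
  "ratfun p q x = (if x = P then 0 else poly p (u x) / poly q (u x))"

lemma meromorphic_ratfun: "meromorphic_fun (ratfun p q)"
  unfolding meromorphic_fun_def
proof
  fix z
  have "(\<lambda>t. poly p (u (chart z t)) / poly q (u (chart z t))) meromorphic_on {0}"
    by (intro meromorphic_intros meromorphic_at_poly_compose u_chart_meromorphic)
  moreover have "\<forall>\<^sub>F t in at 0. poly p (u (chart z t)) / poly q (u (chart z t)) = ratfun p q (chart z t)"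
    using eventually_chart_neq[of z P] by eventually_elim (simp add: ratfun_def)
  ultimately show "(\<lambda>t. ratfun p q (chart z t)) meromorphic_on {0}"
    by (rule meromorphic_at_cong)
qed

text \<open>With \<open>s = t / residue_u\<close> the coordinate is
  \<open>1 / s + u_antipode\<close>. Shifting both polynomials and reversing their coefficients
  leaves the factor \<open>s ^ (degree q - degree p)\<close>, which vanishes at
  \<open>P\<close>.\<close>

lemma ratfun_chart_P:
  assumes "degree p < degree q"
  shows "(\<lambda>t. ratfun p q (chart P t)) analytic_on {0}"
proof -
  define p' where "p' = pcompose p [:u_antipode, 1:]"
  define q' where "q' = pcompose q [:u_antipode, 1:]"
  define g where "g = (\<lambda>t. (t / residue_u) ^ (degree q - degree p) * poly (reflect_poly p') (t / residue_u) / poly (reflect_poly q') (t / residue_u))"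
  have deg: "degree p' = degree p" "degree q' = degree q"
    by (auto simp: p'_def q'_def degree_pcompose)
  have "q' \<noteq> 0" using assms deg by auto
  hence "g analytic_on {0}"
    unfolding g_def by (intro analytic_intros analytic_at_poly_compose) (auto simp: residue_u_nonzero poly_0_coeff_0)
  moreover have "\<forall>\<^sub>F t in nhds 0. poly (reflect_poly q') (t / residue_u) \<noteq> 0"
    by (rule eventually_nhds_compose_analytic[where g = "\<lambda>t. poly (reflect_poly q') (t / residue_u)"])
       (use \<open>q' \<noteq> 0\<close> in \<open>auto intro!: t1_space_nhds analytic_at_poly_compose analytic_intros
         simp: residue_u_nonzero poly_0_coeff_0\<close>)
  hence "\<forall>\<^sub>F t in nhds 0. g t = ratfun p q (chart P t)"
  proof eventually_elim
    case (elim t)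
    show ?case
    proof (cases "t = 0")
      case True thus ?thesis using assms by (simp add: g_def ratfun_def)
    next
      case False
      define s where "s = t / residue_u"
      have s: "s \<noteq> 0" "poly (reflect_poly q') s \<noteq> 0" using False elim residue_u_nonzero by (auto simp: s_def)
      have ut: "u (chart P t) = 1 / s + u_antipode" using False by (simp add: u_chart_P s_def)
      have neq: "chart P t \<noteq> P" using False chart_eq_iff[of P t 0] by simp
      have "poly p (1 / s + u_antipode) = poly (reflect_poly p') s / s ^ degree p"
        using poly_divide_reflect[OF s(1), of p'] deg by (simp add: p'_def poly_pcompose add.commute)
      moreover have "poly q (1 / s + u_antipode) = poly (reflect_poly q') s / s ^ degree q"
        using poly_divide_reflect[OF s(1), of q'] deg by (simp add: q'_def poly_pcompose add.commute)
      moreover have "s ^ degree q = s ^ degree p * s ^ (degree q - degree p)"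
        using assms by (simp flip: power_add)
      ultimately show ?thesis
        using s neq by (simp add: g_def ratfun_def ut s_def[symmetric])
    qed
  qed
  ultimately show ?thesis using analytic_at_cong by fast
qed

definition ratmap :: "complex poly \<Rightarrow> complex poly \<Rightarrow> 'g::complex_vector \<Rightarrow> proj_line \<Rightarrow> 'g" where
  "ratmap p q v x = ratfun p q x *\<^sub>C v"

lemma regular_ratmap:
  assumes "z \<noteq> P" "poly q (u z) \<noteq> 0"
  shows "regular_map (ratmap p q v) z"
proof (rule regular_map_pt[OF assms(1)])
  show "(\<lambda>w. poly p w / poly q w) analytic_on {u z}"
    using assms(2) by (intro analytic_intros analytic_at_poly_compose) auto
  show "\<forall>\<^sub>F w in nhds (u z). ratmap p q v (pt w) = (poly p w / poly q w) *\<^sub>C v"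
    by (simp add: ratmap_def ratfun_def)
qed

lemma ratmap_in_gminus:
  assumes "degree p < degree q" "\<And>s. s \<in> S \<Longrightarrow> s \<noteq> P \<and> poly q (u s) \<noteq> 0"
  shows "ratmap p q v \<in> gminus P S"
proof -
  have "meromorphic_map (ratmap p q v)"
    unfolding meromorphic_map_def
    by (intro exI[of _ "Suc 0"] exI[of _ "\<lambda>_. ratfun p q"] exI[of _ "\<lambda>_. v"])
       (simp add: ratmap_def meromorphic_ratfun)
  moreover have "analytic_expansion (ratmap p q v) P (Suc 0) (\<lambda>_ t. ratfun p q (chart P t)) (\<lambda>_. v)"
    using ratfun_chart_P[OF assms(1)] by (simp add: analytic_expansion_def ratmap_def)
  hence "regular_map (ratmap p q v) P" unfolding regular_map_def by blast
  moreover have "\<forall>s\<in>S. regular_map (ratmap p q v) s"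
    using assms(2) regular_ratmap by blast
  ultimately show ?thesis by (simp add: gminus_def) (simp add: ratmap_def ratfun_def)
qed

lemma regular_fun_pt:
  assumes "z \<noteq> P" "regular_fun f z"
  shows "(\<lambda>w. f (pt w)) analytic_on {u z}"
proof -
  obtain \<psi> where \<psi>: "\<psi> analytic_on {u z}" "\<psi> (u z) = 0"
    "\<forall>\<^sub>F w in nhds (u z). chart z (\<psi> w) = pt w"
    using pt_chart[OF assms(1)] by blast
  have "\<forall>\<^sub>F w in nhds (u z). f (chart z (\<psi> w)) = f (pt w)"
    using \<psi>(3) by eventually_elim simp
  moreover have "(\<lambda>w. f (chart z (\<psi> w))) analytic_on {u z}"
    by (rule analytic_at_comp[OF _ \<psi>(1)]) (use assms(2) \<psi>(2) in \<open>simp add: regular_fun_def\<close>)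
  ultimately show ?thesis using analytic_at_cong by fast
qed

lemma meromorphic_fun_pt:
  assumes "meromorphic_fun f"
  shows "(\<lambda>w. f (pt w)) meromorphic_on UNIV"
  unfolding meromorphic_on_meromorphic_at[of _ UNIV]
proof
  fix w0
  obtain \<psi> where \<psi>: "\<psi> analytic_on {w0}" "\<psi> w0 = 0"
    "\<forall>\<^sub>F w in nhds w0. chart (pt w0) (\<psi> w) = pt w"
    using pt_chart[of "pt w0"] by auto
  have "(\<lambda>w. f (chart (pt w0) (\<psi> w))) meromorphic_on {w0}"
    by (rule meromorphic_on_compose[OF meromorphic_funD[OF assms, of "pt w0"] \<psi>(1)]) (simp add: \<psi>(2))
  moreover have "\<forall>\<^sub>F w in at w0. f (chart (pt w0) (\<psi> w)) = f (pt w)"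
    using \<psi>(3) by (auto simp: eventually_at_filter elim: eventually_mono)
  ultimately show "(\<lambda>w. f (pt w)) meromorphic_on {w0}"
    by (rule meromorphic_at_cong)
qed

text \<open>Large \<open>w\<close> corresponds to a small parameter
  \<open>residue_u / (w - u_antipode)\<close> at \<open>P\<close>, and there \<open>f\<close> is at
  most a constant times the parameter.\<close>

lemma regular_fun_P_decay:
  assumes "regular_fun f P" "f P = 0"
  shows "\<exists>R B. (\<lambda>w. f (pt w)) analytic_on {w. R \<le> norm w} \<and>
               (\<forall>w. R \<le> norm w \<longrightarrow> norm (f (pt w)) \<le> B / norm w)"
proof -
  define g where "g = (\<lambda>t. f (chart P t))"
  have g: "g analytic_on {0}" "g 0 = 0" using assms by (auto simp: g_def regular_fun_def)
  then obtain T where T: "open T" "0 \<in> T" "g holomorphic_on T" by (auto simp: analytic_at)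
  then obtain r1 where r1: "r1 > 0" "ball 0 r1 \<subseteq> T" using openE by blast
  have "(g has_field_derivative deriv g 0) (at 0)" using g(1) by (rule analytic_at_has_derivative)
  hence "((\<lambda>t. g t / t) \<longlongrightarrow> deriv g 0) (at 0)"
    using g(2) by (simp add: has_field_derivative_iff)
  hence "\<forall>\<^sub>F t in at 0. norm (g t / t) < norm (deriv g 0) + 1"
    by (intro order_tendstoD(2)[OF tendsto_norm]) auto
  then obtain r2 where r2: "r2 > 0"
    "\<And>t. t \<noteq> 0 \<Longrightarrow> norm t < r2 \<Longrightarrow> norm (g t / t) < norm (deriv g 0) + 1"
    by (auto simp: eventually_at dist_norm)
  define r where "r = min r1 r2"
  have r: "r > 0" using r1 r2 by (simp add: r_def)
  \<comment> \<open>The first summand gives \<open>norm (w - u_antipode) \<ge> norm w / 2\<close>,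
    the second then puts the parameter below \<open>r\<close>, and the 1 makes \<open>norm w\<close>
    positive.\<close>
  define R where "R = 2 * norm u_antipode + 2 * norm residue_u / r + 1"
  have est: "w \<noteq> u_antipode \<and> norm (residue_u / (w - u_antipode)) \<le> 2 * norm residue_u / norm w \<and> norm (residue_u / (w - u_antipode)) < r"
    if w: "R \<le> norm w" for w
  proof -
    have "2 * norm residue_u / r \<ge> 0" using r by simp
    hence w2: "norm w \<ge> 2 * norm u_antipode" "norm w > 2 * norm residue_u / r" "norm w > 0"
      using w norm_ge_zero[of u_antipode] unfolding R_def by linarith+
    have tri: "norm (w - u_antipode) \<ge> norm w / 2"
      using norm_triangle_ineq2[of w u_antipode] w2 by simp
    hence pos: "norm (w - u_antipode) > 0" using w2(3) by linarith
    have 1: "norm (residue_u / (w - u_antipode)) \<le> 2 * norm residue_u / norm w"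
    proof -
      have "norm residue_u / norm (w - u_antipode) \<le> norm residue_u / (norm w / 2)"
        using tri w2(3) by (intro divide_left_mono) (auto intro: mult_pos_pos pos)
      thus ?thesis by (simp add: norm_divide mult.commute)
    qed
    have "2 * norm residue_u / norm w < r" using w2 r by (simp add: field_simps)
    with 1 pos show ?thesis by auto
  qed
  have eq: "f (pt w) = g (residue_u / (w - u_antipode))" if "w \<noteq> u_antipode" for w
    using that by (simp add: pt_def g_def)
  have "(\<lambda>w. f (pt w)) analytic_on {w0}" if w0: "R \<le> norm w0" for w0
  proof -
    have neq: "w0 \<noteq> u_antipode" using est[OF w0] by blast
    hence "\<forall>\<^sub>F w in nhds w0. w \<noteq> u_antipode" by (rule t1_space_nhds)
    hence "\<forall>\<^sub>F w in nhds w0. g (residue_u / (w - u_antipode)) = f (pt w)" by eventually_elim (simp add: eq)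
    have gan: "g analytic_on {residue_u / (w0 - u_antipode)}"
    proof -
      have "residue_u / (w0 - u_antipode) \<in> ball 0 r1" using est[OF w0] by (simp add: r_def)
      thus ?thesis
        using r1(2) T(1,3) unfolding analytic_at by blast
    qed
    have "(\<lambda>w. residue_u / (w - u_antipode)) analytic_on {w0}"
      using neq by (intro analytic_intros) auto
    from analytic_at_comp[where g = "\<lambda>w. residue_u / (w - u_antipode)", OF gan this]
    have "(\<lambda>w. g (residue_u / (w - u_antipode))) analytic_on {w0}" .
    from this \<open>\<forall>\<^sub>F w in nhds w0. g (residue_u / (w - u_antipode)) = f (pt w)\<close>
    show ?thesis using analytic_at_cong by fast
  qed
  hence "(\<lambda>w. f (pt w)) analytic_on {w. R \<le> norm w}"
    by (subst analytic_on_analytic_at) auto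
  moreover have "norm (f (pt w)) \<le> ((norm (deriv g 0) + 1) * (2 * norm residue_u)) / norm w" if w: "R \<le> norm w" for w
  proof -
    define t where "t = residue_u / (w - u_antipode)"
    have t: "t \<noteq> 0" "norm t < r2" "norm t \<le> 2 * norm residue_u / norm w" and neq: "w \<noteq> u_antipode"
      using est[OF w] residue_u_nonzero by (auto simp: t_def r_def)
    have "norm (g t) = norm (g t / t) * norm t" using t(1) by (simp add: norm_divide)
    also have "\<dots> \<le> (norm (deriv g 0) + 1) * (2 * norm residue_u / norm w)"
      using r2(2)[OF t(1,2)] t(3) by (intro mult_mono) auto
    finally show ?thesis using eq[OF neq] by (simp add: t_def)
  qed
  ultimately show ?thesis by blast
qed

lemma meromorphic_fun_rational:
  assumes "meromorphic_fun f" "regular_fun f P" "f P = 0"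
    and "finite S" "P \<notin> S" "\<And>s. s \<in> S \<Longrightarrow> regular_fun f s"
  shows "\<exists>p q. degree p < degree q \<and> (\<forall>s\<in>S. poly q (u s) \<noteq> 0) \<and> finite {x. f x \<noteq> ratfun p q x}"
proof -
  obtain R B where RB: "(\<lambda>w. f (pt w)) analytic_on {w. R \<le> norm w}"
    "\<And>w. R \<le> norm w \<Longrightarrow> norm (f (pt w)) \<le> B / norm w"
    using regular_fun_P_decay[OF assms(2,3)] by blast
  have "(\<lambda>w. f (pt w)) analytic_on u ` S"
    by (subst analytic_on_analytic_at) (use assms(5,6) in \<open>auto intro!: regular_fun_pt\<close>)
  from meromorphic_decaying_imp_rational[OF meromorphic_fun_pt[OF assms(1)] RB _ this] assms(4)
  obtain p q where pq: "degree p < degree q" "\<forall>s\<in>S. poly q (u s) \<noteq> 0"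
    "finite {w. f (pt w) \<noteq> poly p w / poly q w}"
    by auto
  have "{x. f x \<noteq> ratfun p q x} \<subseteq> {x. u x \<in> {w. f (pt w) \<noteq> poly p w / poly q w}}"
    using assms(3) by (auto simp: ratfun_def split: if_splits)
  from finite_subset[OF this finite_u_vimage[OF pq(3)]] show ?thesis using pq(1,2) by blast
qed

text \<open>The functions in a given presentation of \<open>\<alpha>\<close> may have poles on
  \<open>S\<close> that cancel only in the sum. Coordinates over a Hamel basis inherit the
  regularity of \<open>\<alpha>\<close>, so their denominators can be chosen nonzero on
  \<open>S\<close>.\<close>

lemma gminus_rational:
  assumes \<alpha>: "\<alpha> \<in> gminus P S" and S: "finite S" "P \<notin> S"
  shows "\<exists>I p q. finite I \<and> (\<forall>b\<in>I. degree (p b) < degree (q b) \<and> (\<forall>s\<in>S. poly (q b) (u s) \<noteq> 0)) \<and>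
           finite {x. \<alpha> x \<noteq> (\<Sum>b\<in>I. ratmap (p b) (q b) b x)}"
proof -
  obtain n f e where f: "\<And>k. k < n \<Longrightarrow> meromorphic_fun (f k)" "\<And>p. \<alpha> p = (\<Sum>k<n::nat. f k p *\<^sub>C e k)"
    using \<alpha> by (auto simp: gminus_def meromorphic_map_def)
  define I where "I = (\<Union>k<n. {b. coord b (e k) \<noteq> 0})"
  have finI: "finite I" by (auto simp: I_def finite_coord)
  define F where "F = (\<lambda>b x. coord b (\<alpha> x))"
  have coordF: "F b x = (\<Sum>k<n. f k x * coord b (e k))" for b x
    by (simp add: F_def f(2) clinear_sum[OF clinear_coord] clinear_scale[OF clinear_coord])
  have sumF: "\<alpha> x = (\<Sum>b\<in>I. F b x *\<^sub>C b)" for x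
  proof -
    have "{b. coord b (\<alpha> x) \<noteq> 0} \<subseteq> I"
      using coordF[of _ x] by (fastforce simp: F_def I_def intro: ccontr)
    from sum_coord[OF finI this] show ?thesis by (simp add: F_def)
  qed
  have mero: "meromorphic_fun (F b)" for b
    unfolding meromorphic_fun_def coordF
    by (intro allI meromorphic_intros meromorphic_funD f) auto
  have reg: "regular_fun (F b) x" if "regular_map \<alpha> x" for b x
  proof -
    obtain m g e' where g: "\<And>k. k < m \<Longrightarrow> g k analytic_on {0}"
      "\<forall>\<^sub>F t in nhds 0. \<alpha> (chart x t) = (\<Sum>k<m::nat. g k t *\<^sub>C e' k)"
      using \<open>regular_map \<alpha> x\<close> by (auto simp: regular_map_def analytic_expansion_def)
    from g(2) have "\<forall>\<^sub>F t in nhds 0. (\<Sum>k<m. g k t * coord b (e' k)) = F b (chart x t)"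
      by eventually_elim
        (simp add: F_def clinear_sum[OF clinear_coord] clinear_scale[OF clinear_coord])
    moreover have "(\<lambda>t. \<Sum>k<m. g k t * coord b (e' k)) analytic_on {0}"
      by (intro analytic_intros g(1)) auto
    ultimately show ?thesis unfolding regular_fun_def using analytic_at_cong by fast
  qed
  have "\<exists>p q. degree p < degree q \<and> (\<forall>s\<in>S. poly q (u s) \<noteq> 0) \<and> finite {x. F b x \<noteq> ratfun p q x}" for b
    using \<alpha> S by (intro meromorphic_fun_rational mero reg)
      (auto simp: gminus_def F_def clinear_0[OF clinear_coord])
  then obtain p q where pq: "\<And>b. degree (p b) < degree (q b)" "\<And>b s. s \<in> S \<Longrightarrow> poly (q b) (u s) \<noteq> 0"
    "\<And>b. finite {x. F b x \<noteq> ratfun (p b) (q b) x}"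
    by metis
  have "{x. \<alpha> x \<noteq> (\<Sum>b\<in>I. ratmap (p b) (q b) b x)} \<subseteq> (\<Union>b\<in>I. {x. F b x \<noteq> ratfun (p b) (q b) x})"
  proof
    fix x assume x: "x \<in> {x. \<alpha> x \<noteq> (\<Sum>b\<in>I. ratmap (p b) (q b) b x)}"
    show "x \<in> (\<Union>b\<in>I. {x. F b x \<noteq> ratfun (p b) (q b) x})"
    proof (rule ccontr)
      assume "x \<notin> (\<Union>b\<in>I. {x. F b x \<noteq> ratfun (p b) (q b) x})"
      hence "\<alpha> x = (\<Sum>b\<in>I. ratmap (p b) (q b) b x)"
        unfolding sumF[of x] ratmap_def by (intro sum.cong) simp_all
      with x show False by simp
    qed
  qed
  moreover have "finite (\<Union>b\<in>I. {x. F b x \<noteq> ratfun (p b) (q b) x})"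
    using finI pq(3) by blast
  ultimately have "finite {x. \<alpha> x \<noteq> (\<Sum>b\<in>I. ratmap (p b) (q b) b x)}"
    by (rule finite_subset)
  thus ?thesis using finI pq(1,2) by (intro exI[of _ I] exI[of _ p] exI[of _ q]) simp
qed

lemma regular_map_cong:
  assumes "z \<noteq> P" "regular_map \<beta> z" "\<forall>\<^sub>F w in nhds (u z). \<beta> (pt w) = \<alpha> (pt w)"
  shows "regular_map \<alpha> z"
proof -
  have "\<forall>\<^sub>F t in nhds 0. \<beta> (pt (u (chart z t))) = \<alpha> (pt (u (chart z t)))"
    by (rule eventually_nhds_compose_analytic[OF _ u_chart_analytic[OF assms(1)]]) (use assms(3) in simp)
  with eventually_chart_neq_P[OF assms(1)]
  have ev: "\<forall>\<^sub>F t in nhds 0. \<beta> (chart z t) = \<alpha> (chart z t)"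
    by eventually_elim simp
  obtain n f e where *: "\<forall>k<n. f k analytic_on {0}" "\<forall>\<^sub>F t in nhds 0. \<beta> (chart z t) = (\<Sum>k<n::nat. f k t *\<^sub>C e k)"
    using assms(2) by (auto simp: regular_map_def analytic_expansion_def)
  from ev *(2) have "\<forall>\<^sub>F t in nhds 0. \<alpha> (chart z t) = (\<Sum>k<n. f k t *\<^sub>C e k)"
    by eventually_elim simp
  with *(1) show ?thesis unfolding regular_map_def analytic_expansion_def by blast
qed

lemma regular_map_sum:
  assumes "\<And>i. i \<in> I \<Longrightarrow> regular_map (\<alpha> i) z"
  shows "regular_map (\<lambda>p. \<Sum>i\<in>I. \<alpha> i p) z"
proof -
  have "regular_map (\<lambda>_. 0 :: 'b) z"
    unfolding regular_map_def analytic_expansion_def by (intro exI[of _ 0]) simp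
  with assms show ?thesis
    by (induction I rule: infinite_finite_induct) (auto intro: regular_map_add)
qed

text \<open>Regularity can fail only at a zero of one of finitely many denominators or where the
  representing function differs from the rational sum. This lets words and relations follow a moving
  point.\<close>

lemma gminus_eventually_regular:
  assumes \<alpha>: "\<alpha> \<in> gminus P S" and S: "finite S" "P \<notin> S"
  shows "\<forall>\<^sub>F w in at a. \<alpha> \<in> gminus P (insert (pt w) S)"
proof -
  obtain I p q where I: "finite I" "\<And>b. b \<in> I \<Longrightarrow> degree (p b) < degree (q b)"
    and fin: "finite {x. \<alpha> x \<noteq> (\<Sum>b\<in>I. ratmap (p b) (q b) b x)}"
    using gminus_rational[OF assms] by blast
  \<comment> \<open>The first set is needed because regularity at a point includes the correct value
    there.\<close>
  define N where "N = {w. pt w \<in> {x. \<alpha> x \<noteq> (\<Sum>b\<in>I. ratmap (p b) (q b) b x)}} \<union> (\<Union>b\<in>I. {w. poly (q b) w = 0})"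
  have "q b \<noteq> 0" if "b \<in> I" for b using I(2)[OF that] by auto
  hence finN: "finite N"
    using finite_pt_vimage[OF fin] I(1) by (auto simp: N_def poly_roots_finite)
  hence "\<forall>\<^sub>F w in at a. w \<notin> N" using islimpt_iff_eventually islimpt_finite by blast
  thus ?thesis
  proof eventually_elim
    case (elim w)
    have "open (- N)" using finN finite_imp_closed by blast
    hence "\<forall>\<^sub>F w' in nhds w. w' \<in> - N" using elim by (intro eventually_nhds_in_open) auto
    hence ev: "\<forall>\<^sub>F w' in nhds (u (pt w)). (\<Sum>b\<in>I. ratmap (p b) (q b) b (pt w')) = \<alpha> (pt w')"
      by (auto simp: N_def elim: eventually_mono)
    have "regular_map (\<lambda>x. \<Sum>b\<in>I. ratmap (p b) (q b) b x) (pt w)"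
      by (rule regular_map_sum, rule regular_ratmap) (use elim in \<open>auto simp: N_def\<close>)
    from regular_map_cong[OF pt_neq_P this ev] have "regular_map \<alpha> (pt w)" .
    thus ?case using \<alpha> by (simp add: gminus_def)
  qed
qed

section \<open>Locally uniform convergence of simple poles\<close>

text \<open>Supplies the lower bound on denominators for the uniform estimate. The point
  \<open>P\<close> is exempt, as the value of \<open>u\<close> there is unspecified.\<close>

lemma u_bounded_away:
  assumes "p \<noteq> z" "z \<noteq> P"
  shows "\<exists>r>0. \<exists>\<delta>>0. \<forall>x\<in>chart p ` ball 0 r. x = P \<or> \<delta> \<le> norm (u x - u z)"
proof (cases "p = P")
  case True
  \<comment> \<open>Within this radius \<open>norm (residue_u / t)\<close> exceeds
    \<open>norm (u_antipode - u z) + 1\<close>, which yields the lower bound 1.\<close>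
  define r where "r = norm residue_u / (norm (u_antipode - u z) + 1)"
  have den: "norm (u_antipode - u z) + 1 > 0" by (simp add: add_nonneg_pos)
  have "r > 0" using residue_u_nonzero den by (simp add: r_def)
  have "1 \<le> norm (u (chart P t) - u z)" if t: "norm t < r" "t \<noteq> 0" for t
  proof -
    have "norm t * (norm (u_antipode - u z) + 1) < norm residue_u"
      using t(1) den by (simp add: r_def pos_less_divide_eq)
    hence "norm (u_antipode - u z) + 1 < norm (residue_u / t)"
      using t(2) by (simp add: norm_divide pos_less_divide_eq mult.commute)
    moreover have "norm (residue_u / t) \<le> norm (residue_u / t + (u_antipode - u z)) + norm (u_antipode - u z)"
      using norm_triangle_ineq4[of "residue_u / t + (u_antipode - u z)" "u_antipode - u z"] by simp
    ultimately show ?thesis using t(2) by (simp add: u_chart_P algebra_simps)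
  qed
  hence "\<forall>x\<in>chart p ` ball 0 r. x = P \<or> 1 \<le> norm (u x - u z)"
    by (auto simp: True dist_norm) (metis chart_0)
  with \<open>r > 0\<close> zero_less_one show ?thesis by blast
next
  case False
  define \<delta> where "\<delta> = norm (u p - u z) / 2"
  have "\<delta> > 0" using assms False u_eq_iff by (simp add: \<delta>_def)
  have "((\<lambda>t. u (chart p t)) \<longlongrightarrow> u (chart p 0)) (nhds 0)"
    using analytic_at_imp_isCont[OF u_chart_analytic[OF False]]
      tendsto_at_iff_tendsto_nhds[of "\<lambda>t. u (chart p t)" 0] by (simp add: isCont_def)
  hence "((\<lambda>t. norm (u (chart p t) - u z)) \<longlongrightarrow> norm (u p - u z)) (nhds 0)"
    by (auto intro!: tendsto_intros)
  hence "\<forall>\<^sub>F t in nhds 0. \<delta> < norm (u (chart p t) - u z)"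
    by (rule order_tendstoD(1)) (use \<open>\<delta> > 0\<close> in \<open>simp add: \<delta>_def\<close>)
  then obtain r where r: "r > 0" "\<And>t. norm t < r \<Longrightarrow> \<delta> < norm (u (chart p t) - u z)"
    by (auto simp: eventually_nhds_metric dist_norm)
  hence "\<forall>x\<in>chart p ` ball 0 r. x = P \<or> \<delta> \<le> norm (u x - u z)"
    using r(2) by (auto intro: less_imp_le)
  with \<open>r > 0\<close> \<open>\<delta> > 0\<close> show ?thesis by blast
qed

lemma tendsto_at_point: "z \<noteq> P \<Longrightarrow> (c \<longlongrightarrow> d) (at (u z)) \<Longrightarrow> ((\<lambda>x. c (u x)) \<longlongrightarrow> d) (at_point z)"
  by (simp add: at_point_eq filterlim_filtermap)

lemma locally_uniform_limit_pole:
  assumes z: "z \<noteq> P"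
  shows "locally_uniform_limit (- {z}) (\<lambda>x p. if p = P then 0 else 1 / (u p - u x))
           (\<lambda>p. if p = P then 0 else 1 / (u p - u z)) (at_point z)"
  unfolding locally_uniform_limit_def
proof
  fix p assume "p \<in> - {z}"
  hence "p \<noteq> z" by simp
  then obtain r \<delta> where r: "r > 0" and \<delta>: "\<delta> > 0"
    and away: "\<forall>x\<in>chart p ` ball 0 r. x = P \<or> \<delta> \<le> norm (u x - u z)"
    using u_bounded_away[OF _ z, of p] by blast
  have "uniform_limit (chart p ` ball 0 r) (\<lambda>x p. if p = P then 0 else 1 / (u p - u x))
           (\<lambda>p. if p = P then 0 else 1 / (u p - u z)) (at_point z)"
  proof (rule uniform_limitI)
    fix e :: real assume "e > 0"
    \<comment> \<open>The bound \<open>\<delta> / 2\<close> keeps the moving denominator at least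
      \<open>\<delta> / 2\<close>; the other one makes the difference of the reciprocals smaller
      than \<open>e\<close>.\<close>
    define m where "m = min (\<delta> / 2) (e * \<delta>\<^sup>2 / 2)"
    have "m > 0" using \<delta> \<open>e > 0\<close> by (simp add: m_def)
    have "\<forall>\<^sub>F w in at (u z). dist w (u z) < m"
      using \<open>m > 0\<close> eventually_at by blast
    hence "\<forall>\<^sub>F x in at_point z. norm (u x - u z) < m"
      using z by (simp add: eventually_at_point dist_norm)
    thus "\<forall>\<^sub>F x in at_point z. \<forall>q\<in>chart p ` ball 0 r.
      dist (if q = P then 0 else 1 / (u q - u x)) (if q = P then 0 else 1 / (u q - u z)) < e"
    proof eventually_elim
      case (elim x)
      show ?case
      proof
        fix q assume q: "q \<in> chart p ` ball 0 r"
        show "dist (if q = P then 0 else 1 / (u q - u x)) (if q = P then 0 else 1 / (u q - u z)) < e"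
        proof (cases "q = P")
          case False
          define a where "a = u q - u z"
          define b where "b = u q - u x"
          have a: "\<delta> \<le> norm a" using bspec[OF away q] False by (simp add: a_def)
          have ab: "norm (a - b) < m" using elim by (simp add: a_def b_def)
          have b: "\<delta> / 2 \<le> norm b"
            using norm_triangle_ineq2[of a "a - b"] a ab by (simp add: m_def)
          have nz: "a \<noteq> 0" "b \<noteq> 0" using a b \<delta> by auto
          have "norm (1 / b - 1 / a) = norm (a - b) / (norm b * norm a)"
            using nz by (simp add: norm_divide[symmetric] norm_mult[symmetric] diff_divide_distrib)
          also have "\<dots> \<le> norm (a - b) / (\<delta> / 2 * \<delta>)"
            using a b \<delta> by (intro divide_left_mono mult_mono mult_pos_pos) auto
          also have "\<dots> < (e * \<delta>\<^sup>2 / 2) / (\<delta> / 2 * \<delta>)"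
            using ab \<delta> by (intro divide_strict_right_mono) (auto simp: m_def)
          also have "\<dots> = e" using \<delta> by (simp add: power2_eq_square)
          finally show ?thesis using False by (simp add: a_def b_def dist_norm)
        qed (use \<open>e > 0\<close> in simp)
      qed
    qed
  qed
  thus "\<exists>r>0. uniform_limit (chart p ` ball 0 r) (\<lambda>x p. if p = P then 0 else 1 / (u p - u x))
           (\<lambda>p. if p = P then 0 else 1 / (u p - u z)) (at_point z)"
    using r by blast
qed

end

subsection \<open>Words and relations\<close>

lemmas mult_scaleC_simps = mult_scaleC_left mult_scaleC_right

definition linear_extension :: "('l list \<Rightarrow> 'u::complex_vector) \<Rightarrow> ('l list \<Rightarrow>\<^sub>0 complex) \<Rightarrow> 'u" where
  "linear_extension h a = (\<Sum>w\<in>Poly_Mapping.keys a. Poly_Mapping.lookup a w *\<^sub>C h w)"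

lemma linear_extension_superset:
  "finite A \<Longrightarrow> Poly_Mapping.keys a \<subseteq> A \<Longrightarrow> linear_extension h a = (\<Sum>w\<in>A. Poly_Mapping.lookup a w *\<^sub>C h w)"
  unfolding linear_extension_def by (rule sum.mono_neutral_left) (auto simp: in_keys_iff)

lemma linear_extension_0 [simp]: "linear_extension h 0 = 0"
  by (simp add: linear_extension_def)

lemma linear_extension_add: "linear_extension h (a + b) = linear_extension h a + linear_extension h b"
  using linear_extension_superset[of "Poly_Mapping.keys a \<union> Poly_Mapping.keys b" _ h]
    Poly_Mapping.keys_add[of a b]
  by (simp add: lookup_add scaleC_add_left sum.distrib)

lemma linear_extension_diff: "linear_extension h (a - b) = linear_extension h a - linear_extension h b"
  using linear_extension_add[of h "a - b" b] by simp

lemma linear_extension_single [simp]: "linear_extension h (Poly_Mapping.single w c) = c *\<^sub>C h w"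
  by (cases "c = 0") (auto simp: linear_extension_def)

lemma linear_extension_sum: "linear_extension h (sum f A) = (\<Sum>i\<in>A. linear_extension h (f i))"
  by (induction A rule: infinite_finite_induct) (auto simp: linear_extension_add)

lemma linear_extension_add_fun:
  "linear_extension (\<lambda>w. h w + h' w) a = linear_extension h a + linear_extension h' a"
  by (simp add: linear_extension_def scaleC_add_right sum.distrib)

lemma linear_extension_mult: "linear_extension (\<lambda>w. y * h w) a = y * linear_extension h a"
  for y :: "'u::complex_algebra_1"
  by (simp add: linear_extension_def sum_distrib_left mult_scaleC_simps)

lemma linear_extension_scale: "linear_extension (\<lambda>w. c *\<^sub>C h w) a = c *\<^sub>C linear_extension h a"
  by (simp add: linear_extension_def cvec.scale_sum_right scaleC_scaleC mult.commute)

lemma linear_extension_diff_fun: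
  "linear_extension (\<lambda>w. h w - h' w) a = linear_extension h a - linear_extension h' a"
  by (simp add: linear_extension_def cvec.scale_right_diff_distrib sum_subtractf)

text \<open>With the identity as \<open>g\<close> this represents a scalar multiple, with
  \<open>(#) \<alpha>\<close> the left multiplication by a letter.\<close>

definition relabel :: "('l list \<Rightarrow> 'l list) \<Rightarrow> complex \<Rightarrow> ('l list \<Rightarrow>\<^sub>0 complex) \<Rightarrow> ('l list \<Rightarrow>\<^sub>0 complex)" where
  "relabel g c a = (\<Sum>w\<in>Poly_Mapping.keys a. Poly_Mapping.single (g w) (c * Poly_Mapping.lookup a w))"

lemma keys_relabel: "Poly_Mapping.keys (relabel g c a) \<subseteq> g ` Poly_Mapping.keys a"
  unfolding relabel_def
  by (rule order_trans[OF Poly_Mapping.keys_sum]) (auto split: if_splits)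

lemma linear_extension_relabel:
  "linear_extension h (relabel g c a) = c *\<^sub>C linear_extension (\<lambda>w. h (g w)) a"
  unfolding relabel_def linear_extension_sum
  by (simp add: linear_extension_def[of "\<lambda>w. h (g w)"] cvec.scale_sum_right scaleC_scaleC)

locale currents = line_coordinate P u
  for P :: proj_line and u :: "proj_line \<Rightarrow> complex" +
  fixes B :: "'g::complex_lie_algebra \<Rightarrow> 'g \<Rightarrow> complex"
    and \<eta> :: "(proj_line \<Rightarrow> 'g) \<Rightarrow> 'u::complex_algebra_1"
  assumes form: "nondegenerate_invariant_form B"
    and enveloping: "is_enveloping_algebra (gminus P {}) \<eta>"
begin

section \<open>The enveloping algebra and its subalgebras\<close>

abbreviation L :: "proj_line set \<Rightarrow> (proj_line \<Rightarrow> 'g) set" where "L S \<equiv> gminus P S"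
abbreviation U :: "proj_line set \<Rightarrow> 'u set" where "U S \<equiv> Usub P \<eta> S"
abbreviation \<epsilon> :: "proj_line \<Rightarrow> 'g \<Rightarrow> 'u" where "\<epsilon> z v \<equiv> eps P u \<eta> z v"
abbreviation word :: "(proj_line \<Rightarrow> 'g) list \<Rightarrow> 'u" where "word w \<equiv> prod_list (map \<eta> w)"

lemma free_eval_eq: "free_eval \<eta> a = linear_extension word a"
  by (simp add: free_eval_def linear_extension_def)

lemma free_eval_eq_0_iff:
  "Poly_Mapping.keys a \<subseteq> lists (L {}) \<Longrightarrow> linear_extension word a = 0 \<longleftrightarrow> a \<in> enveloping_ideal (L {})"
  using enveloping by (simp add: is_enveloping_algebra_def free_eval_eq)

lemma U_iff: "x \<in> U S \<longleftrightarrow> (\<exists>a. Poly_Mapping.keys a \<subseteq> lists (L S) \<and> x = linear_extension word a)"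
  by (auto simp: Usub_def generated_subalgebra_def free_eval_eq)

lemma U_I: "Poly_Mapping.keys a \<subseteq> lists (L S) \<Longrightarrow> linear_extension word a \<in> U S"
  by (auto simp: U_iff)

lemma word_in_U: "w \<in> lists (L S) \<Longrightarrow> word w \<in> U S"
  using U_I[of "Poly_Mapping.single w 1" S] by (simp add: scaleC_one)

lemma one_in_U: "1 \<in> U S"
  using word_in_U[of "[]"] by simp

lemma add_in_U:
  assumes "x \<in> U S" "y \<in> U S" shows "x + y \<in> U S"
proof -
  obtain a b where ab: "Poly_Mapping.keys a \<subseteq> lists (L S)" "x = linear_extension word a"
    "Poly_Mapping.keys b \<subseteq> lists (L S)" "y = linear_extension word b"
    using assms unfolding U_iff by blast
  have "Poly_Mapping.keys (a + b) \<subseteq> lists (L S)"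
    using Poly_Mapping.keys_add[of a b] ab(1,3) by blast
  from U_I[OF this] show ?thesis by (simp add: linear_extension_add ab)
qed

lemma scale_in_U:
  assumes "x \<in> U S" shows "c *\<^sub>C x \<in> U S"
proof -
  obtain a where a: "Poly_Mapping.keys a \<subseteq> lists (L S)" "x = linear_extension word a"
    using assms by (auto simp: U_iff)
  have "Poly_Mapping.keys (relabel (\<lambda>w. w) c a) \<subseteq> lists (L S)"
    using keys_relabel[of "\<lambda>w. w" c a] a(1) by auto
  from U_I[OF this] show ?thesis by (simp add: linear_extension_relabel a(2))
qed

lemma zero_in_U: "0 \<in> U S"
  using scale_in_U[OF one_in_U, of 0] by simp

lemma uminus_in_U: "x \<in> U S \<Longrightarrow> - x \<in> U S"
  using scale_in_U[of x S "-1"] by (simp add: cvec.scale_minus_left scaleC_one)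

lemma diff_in_U: "x \<in> U S \<Longrightarrow> y \<in> U S \<Longrightarrow> x - y \<in> U S"
  using add_in_U[of x S "- y"] by (simp add: uminus_in_U)

lemma letter_mult_in_U:
  assumes "\<alpha> \<in> L S" "x \<in> U S" shows "\<eta> \<alpha> * x \<in> U S"
proof -
  obtain a where a: "Poly_Mapping.keys a \<subseteq> lists (L S)" "x = linear_extension word a"
    using assms by (auto simp: U_iff)
  have "\<alpha> # w \<in> lists (L S)" if "w \<in> Poly_Mapping.keys a" for w
  proof -
    have "w \<in> lists (L S)" using that a(1) by blast
    thus ?thesis using assms(1) by simp
  qed
  hence "Poly_Mapping.keys (relabel ((#) \<alpha>) 1 a) \<subseteq> lists (L S)"
    by (intro order_trans[OF keys_relabel]) blast
  moreover have "linear_extension word (relabel ((#) \<alpha>) 1 a) = \<eta> \<alpha> * x"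
    unfolding linear_extension_relabel a(2) unfolding linear_extension_def
    by (simp add: scaleC_one sum_distrib_left mult_scaleC_right)
  ultimately show ?thesis using U_I by metis
qed

lemma U_mono: "S \<subseteq> S' \<Longrightarrow> U S' \<subseteq> U S"
  using gminus_mono[of S S' P] lists_mono unfolding U_iff subset_iff by (metis (full_types) subset_iff)

lemma letter_in_U: "\<alpha> \<in> L S \<Longrightarrow> \<eta> \<alpha> \<in> U S"
  using letter_mult_in_U[OF _ one_in_U] by simp

text \<open>Each case also supplies membership, because the laws of the operators hold only on
  \<open>U S\<close>.\<close>

lemma U_induct [consumes 1, case_names one letter add scale]:
  assumes x: "x \<in> U S"
    and one: "Q 1"
    and letter: "\<And>\<alpha> x. \<alpha> \<in> L S \<Longrightarrow> x \<in> U S \<Longrightarrow> Q x \<Longrightarrow> Q (\<eta> \<alpha> * x)"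
    and add: "\<And>x y. x \<in> U S \<Longrightarrow> y \<in> U S \<Longrightarrow> Q x \<Longrightarrow> Q y \<Longrightarrow> Q (x + y)"
    and scale: "\<And>c x. x \<in> U S \<Longrightarrow> Q x \<Longrightarrow> Q (c *\<^sub>C x)"
  shows "Q x"
proof -
  obtain a where a: "Poly_Mapping.keys a \<subseteq> lists (L S)" "x = linear_extension word a"
    using x by (auto simp: U_iff)
  have word: "Q (word w)" if "w \<in> lists (L S)" for w
    using that
  proof (induction w)
    case (Cons \<alpha> w) thus ?case using letter word_in_U by simp
  qed (simp add: one)
  have "Q (\<Sum>w\<in>A. Poly_Mapping.lookup a w *\<^sub>C word w) \<and> (\<Sum>w\<in>A. Poly_Mapping.lookup a w *\<^sub>C word w) \<in> U S"
    if "finite A" "A \<subseteq> lists (L S)" for A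
    using that
  proof (induction A)
    case empty
    show ?case using scale[OF one_in_U one, of 0] zero_in_U by simp
  next
    case (insert w A)
    thus ?case using word word_in_U by (auto intro!: add scale add_in_U scale_in_U)
  qed
  from this[OF finite_keys a(1)] show ?thesis by (simp add: a(2) linear_extension_def)
qed

lemma eta_linear:
  assumes "\<alpha> \<in> L {}" "\<beta> \<in> L {}" "\<gamma> \<in> L {}" "finite {p. \<gamma> p \<noteq> a *\<^sub>C \<alpha> p + b *\<^sub>C \<beta> p}"
  shows "\<eta> \<gamma> = a *\<^sub>C \<eta> \<alpha> + b *\<^sub>C \<eta> \<beta>"
proof -
  define x where "x = Poly_Mapping.single [\<gamma>] 1 - Poly_Mapping.single [\<alpha>] a - Poly_Mapping.single [\<beta>] b"
  have "x \<in> enveloping_ideal (L {})"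
    using enveloping_ideal.linear[of "[]" "L {}" "[]" \<alpha> \<beta> \<gamma> a b 1] assms by (simp add: x_def)
  moreover have "Poly_Mapping.keys x \<subseteq> {[\<gamma>], [\<alpha>], [\<beta>]}"
    unfolding x_def by (intro order_trans[OF Poly_Mapping.keys_diff] Un_least) auto
  hence "Poly_Mapping.keys x \<subseteq> lists (L {})" using assms by auto
  ultimately have "linear_extension word x = 0" using free_eval_eq_0_iff by blast
  hence "\<eta> \<gamma> - a *\<^sub>C \<eta> \<alpha> - b *\<^sub>C \<eta> \<beta> = 0"
    by (simp add: x_def linear_extension_diff scaleC_one)
  thus ?thesis by (simp add: diff_eq_eq add.commute)
qed

lemma eta_bracket:
  assumes "\<alpha> \<in> L {}" "\<beta> \<in> L {}" "\<gamma> \<in> L {}" "finite {p. \<gamma> p \<noteq> lie (\<alpha> p) (\<beta> p)}"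
  shows "\<eta> \<alpha> * \<eta> \<beta> - \<eta> \<beta> * \<eta> \<alpha> = \<eta> \<gamma>"
proof -
  define x where "x = Poly_Mapping.single [\<alpha>, \<beta>] 1 - Poly_Mapping.single [\<beta>, \<alpha>] 1 - Poly_Mapping.single [\<gamma>] (1::complex)"
  have "x \<in> enveloping_ideal (L {})"
    using enveloping_ideal.bracket[of "[]" "L {}" "[]" \<alpha> \<beta> \<gamma> 1] assms by (simp add: x_def)
  moreover have "Poly_Mapping.keys x \<subseteq> {[\<alpha>, \<beta>], [\<beta>, \<alpha>], [\<gamma>]}"
    unfolding x_def by (intro order_trans[OF Poly_Mapping.keys_diff] Un_least) auto
  hence "Poly_Mapping.keys x \<subseteq> lists (L {})" using assms by auto
  ultimately have "linear_extension word x = 0" using free_eval_eq_0_iff by blast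
  hence "\<eta> \<alpha> * \<eta> \<beta> - \<eta> \<beta> * \<eta> \<alpha> - \<eta> \<gamma> = 0"
    by (simp add: x_def linear_extension_diff scaleC_one)
  thus ?thesis by simp
qed

lemma L_subset: "L S \<subseteq> L {}"
  by (rule gminus_mono) simp

lemma eta_zero: "\<eta> (\<lambda>_. 0) = 0"
  using eta_linear[OF zero_in_gminus zero_in_gminus zero_in_gminus, of 0 0] by simp

lemma eta_sum:
  assumes "\<And>i. i \<in> I \<Longrightarrow> \<alpha> i \<in> L {}" "\<gamma> \<in> L {}" "finite {p. \<gamma> p \<noteq> (\<Sum>i\<in>I. \<alpha> i p)}"
  shows "\<eta> \<gamma> = (\<Sum>i\<in>I. \<eta> (\<alpha> i))"
proof -
  have sum_eq: "\<eta> (\<lambda>p. \<Sum>i\<in>I. \<alpha> i p) = (\<Sum>i\<in>I. \<eta> (\<alpha> i))"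
    using assms(1)
  proof (induction I rule: infinite_finite_induct)
    case (insert i I)
    have "\<eta> (\<lambda>p. \<Sum>i\<in>insert i I. \<alpha> i p) = 1 *\<^sub>C \<eta> (\<alpha> i) + 1 *\<^sub>C \<eta> (\<lambda>p. \<Sum>i\<in>I. \<alpha> i p)"
      by (rule eta_linear) (use insert in \<open>auto intro!: sum_in_gminus add_in_gminus simp: scaleC_one\<close>)
    thus ?case using insert by (simp add: scaleC_one)
  qed (simp_all add: eta_zero)
  have "\<eta> \<gamma> = 1 *\<^sub>C \<eta> (\<lambda>p. \<Sum>i\<in>I. \<alpha> i p) + 0 *\<^sub>C \<eta> (\<lambda>p. \<Sum>i\<in>I. \<alpha> i p)"
    by (rule eta_linear) (use assms in \<open>auto intro!: sum_in_gminus simp: scaleC_one\<close>)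
  thus ?thesis by (simp add: sum_eq scaleC_one)
qed

lemma eps_eq: "\<epsilon> z v = \<eta> (ratmap 1 [:- u z, 1:] v)"
  unfolding eps_def by (rule arg_cong[of _ _ \<eta>]) (auto simp: ratmap_def ratfun_def fun_eq_iff)

lemma eps_letter: "P \<notin> S \<Longrightarrow> z \<notin> S \<Longrightarrow> z \<noteq> P \<Longrightarrow> ratmap 1 [:- u z, 1:] v \<in> L S"
  by (rule ratmap_in_gminus) (auto dest: u_eq_iff[THEN iffD1, rotated 2])

lemma eps_letter0: "ratmap 1 [:- w, 1:] v \<in> L {}"
  by (rule ratmap_in_gminus) auto

lemma eps_add: "\<epsilon> z (v + v') = \<epsilon> z v + \<epsilon> z v'"
proof -
  have "\<epsilon> z (v + v') = 1 *\<^sub>C \<epsilon> z v + 1 *\<^sub>C \<epsilon> z v'"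
    unfolding eps_eq
    by (rule eta_linear[OF eps_letter0 eps_letter0 eps_letter0]) (simp add: ratmap_def scaleC_one scaleC_add_right)
  thus ?thesis by (simp add: scaleC_one)
qed

lemma eps_scale: "\<epsilon> z (c *\<^sub>C v) = c *\<^sub>C \<epsilon> z v"
proof -
  have "\<epsilon> z (c *\<^sub>C v) = c *\<^sub>C \<epsilon> z v + 0 *\<^sub>C \<epsilon> z v"
    unfolding eps_eq
    by (rule eta_linear[OF eps_letter0 eps_letter0 eps_letter0]) (simp add: ratmap_def scaleC_scaleC mult.commute)
  thus ?thesis by simp
qed

lemma form_add_left: "B (x + y) z = B x z + B y z"
  and form_scale_left: "B (a *\<^sub>C x) y = a * B x y"
  and form_commute: "B x y = B y x"
  and form_invariant: "B (lie x y) z = B x (lie y z)"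
  using form by (auto simp: nondegenerate_invariant_form_def)

lemma form_add_right: "B z (x + y) = B z x + B z y"
  by (metis form_add_left form_commute)

lemma form_scale_right: "B y (a *\<^sub>C x) = a * B y x"
  by (metis form_scale_left form_commute)

lemma clinear_form: "clinear (B v)"
  by (simp add: clinear_def form_add_right form_scale_right)

section \<open>The recursion on words\<close>

text \<open>The defining relation of \<open>iota\<close>, solved for a word with its first letter
  split off. It is a function of the word; that it depends only on the element represented is proved
  later.\<close>

primrec iota_word :: "(proj_line \<Rightarrow> 'g) list \<Rightarrow> proj_line \<Rightarrow> 'g \<Rightarrow> 'u" where
  "iota_word [] z v = 0"
| "iota_word (\<alpha> # w) z v = \<eta> \<alpha> * iota_word w z v
     - (\<epsilon> z v * \<eta> \<alpha> - \<eta> \<alpha> * \<epsilon> z v) * word w - B v (deriv_wrt u \<alpha> z) *\<^sub>C word w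
     + iota_word w z (lie v (\<alpha> z)) + \<epsilon> z (lie v (\<alpha> z)) * word w"

definition current_word :: "(proj_line \<Rightarrow> 'g) list \<Rightarrow> proj_line \<Rightarrow> 'g \<Rightarrow> 'u" where
  "current_word w z v = iota_word w z v + \<epsilon> z v * word w"

text \<open>Adding \<open>\<epsilon>\<close> absorbs the commutator and the term with label
  \<open>lie v (\<alpha> z)\<close>. What remains sees a letter only through \<open>\<eta>\<close>
  and through its value and derivative at \<open>z\<close>, so relations can be checked
  directly.\<close>

lemma current_word_Cons: "current_word (\<alpha> # w) z v =
   \<eta> \<alpha> * current_word w z v + current_word w z (lie v (\<alpha> z)) - B v (deriv_wrt u \<alpha> z) *\<^sub>C word w"
  by (simp add: current_word_def algebra_simps)

lemma iota_word_add: "iota_word w z (v + v') = iota_word w z v + iota_word w z v'"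
  by (induction w arbitrary: v v')
     (simp_all add: eps_add lie_add_left form_add_left scaleC_add_left algebra_simps)

lemma iota_word_scale: "iota_word w z (c *\<^sub>C v) = c *\<^sub>C iota_word w z v"
  by (induction w arbitrary: v)
     (simp_all add: eps_scale lie_scaleC_left form_scale_left mult_scaleC_simps scaleC_scaleC
       scaleC_add_right cvec.scale_right_diff_distrib left_diff_distrib)

lemma current_word_add: "current_word w z (v + v') = current_word w z v + current_word w z v'"
  by (simp add: current_word_def iota_word_add eps_add distrib_right)

lemma current_word_scale: "current_word w z (c *\<^sub>C v) = c *\<^sub>C current_word w z v"
  by (simp add: current_word_def iota_word_scale eps_scale scaleC_add_right mult_scaleC_simps)

lemma letter_regular: "\<alpha> \<in> L S \<Longrightarrow> z \<in> S \<Longrightarrow> regular_map \<alpha> z"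
  by (simp add: gminus_def)

lemma letter_family: "\<alpha> \<in> L S \<Longrightarrow> z \<in> S \<Longrightarrow> z \<noteq> P \<Longrightarrow> analytic_family (u z) UNIV (\<lambda>w. \<alpha> (pt w))"
  using letter_regular regular_map_imp_analytic_family by blast

lemma eventually_at_pt_notin: "finite A \<Longrightarrow> \<forall>\<^sub>F w in at a. pt w \<notin> A"
  using islimpt_iff_eventually[of a "{w. pt w \<in> A}"] islimpt_finite[OF finite_pt_vimage] by auto

text \<open>Relations between letters hold off a finite set only. Regularity extends them to a
  neighbourhood of \<open>z\<close>, where they can be evaluated and differentiated.\<close>

lemma linear_at_point:
  assumes "z \<noteq> P" "\<alpha> \<in> L {z}" "\<beta> \<in> L {z}" "\<gamma> \<in> L {z}" "finite {p. \<gamma> p \<noteq> a *\<^sub>C \<alpha> p + b *\<^sub>C \<beta> p}"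
  shows "\<gamma> z = a *\<^sub>C \<alpha> z + b *\<^sub>C \<beta> z"
    and "deriv_wrt u \<gamma> z = a *\<^sub>C deriv_wrt u \<alpha> z + b *\<^sub>C deriv_wrt u \<beta> z"
proof -
  have fam: "analytic_family (u z) UNIV (\<lambda>w. a *\<^sub>C \<alpha> (pt w) + b *\<^sub>C \<beta> (pt w))"
    by (intro analytic_family.add analytic_family_mult letter_family[of _ "{z}"]) (use assms in auto)
  have "\<forall>\<^sub>F w in nhds (u z). \<gamma> (pt w) = a *\<^sub>C \<alpha> (pt w) + b *\<^sub>C \<beta> (pt w)"
    using eventually_at_pt_notin[OF assms(5)]
    by (intro analytic_family_identity_nhds[OF letter_family[OF assms(4)] fam]) (use assms in simp_all)
  hence ev: "\<forall>\<^sub>F w in nhds (u z). a *\<^sub>C \<alpha> (pt w) + b *\<^sub>C \<beta> (pt w) = \<gamma> (pt w)"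
    by (simp add: eq_commute)
  from eventually_nhds_x_imp_x[OF ev] assms(1) show "\<gamma> z = a *\<^sub>C \<alpha> z + b *\<^sub>C \<beta> z" by simp
  have "has_weak_deriv (\<lambda>w. a *\<^sub>C \<alpha> (pt w) + b *\<^sub>C \<beta> (pt w)) (a *\<^sub>C deriv_wrt u \<alpha> z + b *\<^sub>C deriv_wrt u \<beta> z) (u z)"
    by (intro has_weak_deriv_add has_weak_deriv_linear[where L = "\<lambda>x. a *\<^sub>C x"]
        has_weak_deriv_linear[where L = "\<lambda>x. b *\<^sub>C x"] deriv_wrt letter_regular[of _ "{z}"])
       (use assms in \<open>auto simp: scaleC_add_right scaleC_scaleC mult.commute\<close>)
  from has_weak_deriv_cong[OF this ev]
  show "deriv_wrt u \<gamma> z = a *\<^sub>C deriv_wrt u \<alpha> z + b *\<^sub>C deriv_wrt u \<beta> z"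
    using has_weak_deriv_unique[OF deriv_wrt[OF assms(1) letter_regular[OF assms(4)]]] by simp
qed

lemma bracket_at_point:
  assumes "z \<noteq> P" "\<alpha> \<in> L {z}" "\<beta> \<in> L {z}" "\<gamma> \<in> L {z}" "finite {p. \<gamma> p \<noteq> lie (\<alpha> p) (\<beta> p)}"
  shows "\<gamma> z = lie (\<alpha> z) (\<beta> z)"
    and "deriv_wrt u \<gamma> z = lie (deriv_wrt u \<alpha> z) (\<beta> z) + lie (\<alpha> z) (deriv_wrt u \<beta> z)"
proof -
  have fam: "analytic_family (u z) UNIV (\<lambda>w. lie (\<alpha> (pt w)) (\<beta> (pt w)))"
    by (intro analytic_family_lie letter_family[of _ "{z}"]) (use assms in auto)
  have "\<forall>\<^sub>F w in nhds (u z). \<gamma> (pt w) = lie (\<alpha> (pt w)) (\<beta> (pt w))"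
    using eventually_at_pt_notin[OF assms(5)]
    by (intro analytic_family_identity_nhds[OF letter_family[OF assms(4)] fam]) (use assms in simp_all)
  hence ev: "\<forall>\<^sub>F w in nhds (u z). lie (\<alpha> (pt w)) (\<beta> (pt w)) = \<gamma> (pt w)"
    by (simp add: eq_commute)
  from eventually_nhds_x_imp_x[OF ev] assms(1) show "\<gamma> z = lie (\<alpha> z) (\<beta> z)" by simp
  have "has_weak_deriv (\<lambda>w. lie (\<alpha> (pt w)) (\<beta> (pt w)))
      (lie (deriv_wrt u \<alpha> z) (\<beta> (pt (u z))) + lie (\<alpha> (pt (u z))) (deriv_wrt u \<beta> z)) (u z)"
    by (intro has_weak_deriv_lie[OF letter_family[of _ "{z}"]] deriv_wrt letter_regular[of _ "{z}"])
       (use assms in auto)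
  from has_weak_deriv_cong[OF this ev]
  show "deriv_wrt u \<gamma> z = lie (deriv_wrt u \<alpha> z) (\<beta> z) + lie (\<alpha> z) (deriv_wrt u \<beta> z)"
    using has_weak_deriv_unique[OF deriv_wrt[OF assms(1) letter_regular[OF assms(4)]]] assms(1) by simp
qed

lemma current_word_linear:
  assumes "z \<noteq> P" "\<alpha> \<in> L {z}" "\<beta> \<in> L {z}" "\<gamma> \<in> L {z}" "finite {p. \<gamma> p \<noteq> a *\<^sub>C \<alpha> p + b *\<^sub>C \<beta> p}"
  shows "current_word (w @ \<gamma> # w') z v = a *\<^sub>C current_word (w @ \<alpha> # w') z v + b *\<^sub>C current_word (w @ \<beta> # w') z v"
proof -
  have \<eta>: "\<eta> \<gamma> = a *\<^sub>C \<eta> \<alpha> + b *\<^sub>C \<eta> \<beta>"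
    by (rule eta_linear) (use assms L_subset in auto)
  note pt = linear_at_point[OF assms]
  show ?thesis
  proof (induction w arbitrary: v)
    case Nil
    show ?case
      by (simp add: current_word_Cons \<eta> pt lie_add_right lie_scaleC_right form_add_right form_scale_right
          current_word_add current_word_scale algebra_simps scaleC_add_right scaleC_add_left
          cvec.scale_right_diff_distrib mult_scaleC_simps scaleC_scaleC)
  next
    case (Cons \<delta> w)
    have "word (w @ \<gamma> # w') = a *\<^sub>C word (w @ \<alpha> # w') + b *\<^sub>C word (w @ \<beta> # w')"
      by (simp add: \<eta> algebra_simps mult_scaleC_simps)
    with Cons show ?case
      by (simp add: current_word_Cons algebra_simps scaleC_add_right
          cvec.scale_right_diff_distrib mult_scaleC_simps scaleC_scaleC)
  qed
qed

text \<open>In the difference of the two orders the terms containing a single bracket or a remaining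
  letter cancel. The labels are left with the Jacobi identity, the scalars with the cocycle identity
  that follows from the Leibniz rule and the invariance of \<open>B\<close>. The common prefix
  \<open>w\<close> acts alike on all the words.\<close>

lemma current_word_bracket:
  assumes "z \<noteq> P" "\<alpha> \<in> L {z}" "\<beta> \<in> L {z}" "\<gamma> \<in> L {z}" "finite {p. \<gamma> p \<noteq> lie (\<alpha> p) (\<beta> p)}"
  shows "current_word (w @ \<alpha> # \<beta> # w') z v - current_word (w @ \<beta> # \<alpha> # w') z v = current_word (w @ \<gamma> # w') z v"
proof -
  have \<eta>: "\<eta> \<gamma> = \<eta> \<alpha> * \<eta> \<beta> - \<eta> \<beta> * \<eta> \<alpha>"
    by (rule eta_bracket[symmetric]) (use assms L_subset in auto)
  note pt = bracket_at_point[OF assms]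
  show ?thesis
  proof (induction w arbitrary: v)
    case Nil
    have "lie v (lie (\<alpha> z) (\<beta> z)) + lie (lie v (\<beta> z)) (\<alpha> z) = lie (lie v (\<alpha> z)) (\<beta> z)"
      using jacobi[of v "\<alpha> z" "\<beta> z"] lie_minus_commute[of "\<alpha> z" "lie (\<beta> z) v"]
        lie_minus_commute[of "\<beta> z" "lie v (\<alpha> z)"] lie_minus_commute[of "\<beta> z" v]
      by (simp add: lie_minus_left algebra_simps)
    hence J: "current_word w' z (lie (lie v (\<alpha> z)) (\<beta> z)) =
        current_word w' z (lie v (\<gamma> z)) + current_word w' z (lie (lie v (\<beta> z)) (\<alpha> z))"
      unfolding pt(1) current_word_add[symmetric] by simp
    have "B v (lie (deriv_wrt u \<alpha> z) (\<beta> z)) = - B (lie v (\<beta> z)) (deriv_wrt u \<alpha> z)"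
      using form_scale_right[of v "-1" "lie (\<beta> z) (deriv_wrt u \<alpha> z)"] lie_minus_commute[of "deriv_wrt u \<alpha> z" "\<beta> z"]
      by (simp add: form_invariant cvec.scale_minus_left scaleC_one)
    hence D: "B v (deriv_wrt u \<gamma> z) = B (lie v (\<alpha> z)) (deriv_wrt u \<beta> z) - B (lie v (\<beta> z)) (deriv_wrt u \<alpha> z)"
      by (simp add: pt(2) form_add_right form_invariant)
    show ?case
      by (simp add: current_word_Cons J D \<eta> algebra_simps mult_scaleC_simps cvec.scale_left_diff_distrib)
  next
    case (Cons \<delta> w)
    have W: "word (w @ \<gamma> # w') = word (w @ \<alpha> # \<beta> # w') - word (w @ \<beta> # \<alpha> # w')"
      by (simp add: \<eta> algebra_simps)
    show ?case
      unfolding append_Cons current_word_Cons W Cons.IH[symmetric]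
      by (simp add: algebra_simps cvec.scale_right_diff_distrib)
  qed
qed

lemma current_word_ideal:
  assumes "z \<noteq> P" "a \<in> enveloping_ideal (L {z})"
  shows "linear_extension (\<lambda>w. current_word w z v) a = 0"
  using assms(2)
proof induction
  case (linear w w' \<alpha> \<beta> \<gamma> a b c)
  thus ?case using current_word_linear[OF assms(1), of \<alpha> \<beta> \<gamma> a b w w' v]
    by (simp add: linear_extension_diff scaleC_add_right scaleC_scaleC)
next
  case (bracket w w' \<alpha> \<beta> \<gamma> c)
  thus ?case using current_word_bracket[OF assms(1), of \<alpha> \<beta> \<gamma> w w' v, symmetric]
    by (simp add: linear_extension_diff cvec.scale_right_diff_distrib)
qed (simp_all add: linear_extension_add)

subsection \<open>Analytic dependence on the point\<close>

lemma mult_in_U: "x \<in> U S \<Longrightarrow> y \<in> U S \<Longrightarrow> x * y \<in> U S"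
proof (induction rule: U_induct)
  case (letter \<alpha> x) thus ?case by (simp add: mult.assoc letter_mult_in_U)
qed (auto simp: distrib_right mult_scaleC_simps intro: add_in_U scale_in_U)

lemma lists_eventually_regular:
  assumes "w \<in> lists (L S)" "finite S" "P \<notin> S"
  shows "\<forall>\<^sub>F x in at b. w \<in> lists (L (insert (pt x) S))"
  using assms(1)
proof (induction w)
  case (Cons \<alpha> w)
  from gminus_eventually_regular[OF Cons.hyps(1) assms(2,3), of b] Cons.IH
  show ?case by eventually_elim simp
qed simp

text \<open>Induction over the derivation: all its letters, also those that cancel in the end, are
  finite in number, so a nearby point avoids their poles at once.\<close>

lemma ideal_eventually_regular:
  assumes "a \<in> enveloping_ideal (L {})"
  shows "\<forall>\<^sub>F w in at b. a \<in> enveloping_ideal (L {pt w})"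
proof -
  have letter: "\<forall>\<^sub>F w in at b. \<alpha> \<in> L {pt w}" if "\<alpha> \<in> L {}" for \<alpha>
    using gminus_eventually_regular[OF that] by simp
  have lists: "\<forall>\<^sub>F x in at b. w \<in> lists (L {pt x})" if "w \<in> lists (L {})" for w
    using lists_eventually_regular[OF that] by simp
  show ?thesis
    using assms
  proof induction
    case zero show ?case by (simp add: enveloping_ideal.zero)
  next
    case (add x y)
    from add.IH show ?case by eventually_elim (rule enveloping_ideal.add)
  next
    case (linear w w' \<alpha> \<beta> \<gamma> a b c)
    from lists[OF linear(1)] lists[OF linear(2)] letter[OF linear(3)] letter[OF linear(4)] letter[OF linear(5)]
    show ?case by eventually_elim (rule enveloping_ideal.linear, use linear(6) in auto)
  next
    case (bracket w w' \<alpha> \<beta> \<gamma> c)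
    from lists[OF bracket(1)] lists[OF bracket(2)] letter[OF bracket(3)] letter[OF bracket(4)] letter[OF bracket(5)]
    show ?case by eventually_elim (rule enveloping_ideal.bracket, use bracket(6) in auto)
  qed
qed

lemma eps_pt: "\<epsilon> (pt w) v = \<eta> (ratmap 1 [:- w, 1:] v)"
  by (simp add: eps_eq)

lemma eta_ratmap_add:
  assumes "degree p < degree q" "degree p' < degree q"
  shows "\<eta> (ratmap (p + p') q v) = \<eta> (ratmap p q v) + \<eta> (ratmap p' q v)"
proof -
  have "\<eta> (ratmap (p + p') q v) = 1 *\<^sub>C \<eta> (ratmap p q v) + 1 *\<^sub>C \<eta> (ratmap p' q v)"
    by (rule eta_linear)
       (use assms in \<open>auto intro!: ratmap_in_gminus degree_add_less
          simp: ratmap_def ratfun_def scaleC_one add_divide_distrib scaleC_add_left\<close>)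
  thus ?thesis by (simp add: scaleC_one)
qed

lemma eta_ratmap_smult:
  assumes "degree p < degree q"
  shows "\<eta> (ratmap (smult c p) q v) = c *\<^sub>C \<eta> (ratmap p q v)"
proof -
  have "\<eta> (ratmap (smult c p) q v) = c *\<^sub>C \<eta> (ratmap p q v) + 0 *\<^sub>C \<eta> (ratmap p q v)"
    by (rule eta_linear)
       (use assms in \<open>auto intro!: ratmap_in_gminus simp: ratmap_def ratfun_def scaleC_scaleC\<close>)
  thus ?thesis by simp
qed

text \<open>For a fixed denominator, a numerator that varies with the point affects only scalar
  coefficients; the vectors stay fixed, as a family demands.\<close>

lemma eta_ratmap_monoms:
  assumes "degree p < degree q"
  shows "\<eta> (ratmap p q v) = (\<Sum>i<degree q. coeff p i *\<^sub>C \<eta> (ratmap (monom 1 i) q v))"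
proof -
  have *: "degree (\<Sum>i<m. monom (coeff p i) i) < degree q \<and>
      \<eta> (ratmap (\<Sum>i<m. monom (coeff p i) i) q v) = (\<Sum>i<m. coeff p i *\<^sub>C \<eta> (ratmap (monom 1 i) q v))"
    if "m \<le> degree q" for m
    using that
  proof (induction m)
    case 0
    have "\<eta> (ratmap (smult 0 0) q v) = 0 *\<^sub>C \<eta> (ratmap 0 q v)"
      using assms by (intro eta_ratmap_smult) auto
    thus ?case using assms by simp
  next
    case (Suc m)
    have deg: "degree (monom c m :: complex poly) < degree q" for c
      using Suc.prems degree_monom_le[of c m] by simp
    have "\<eta> (ratmap (monom (coeff p m) m) q v) = coeff p m *\<^sub>C \<eta> (ratmap (monom 1 m) q v)"
      using eta_ratmap_smult[OF deg, of "coeff p m" 1 v] by (simp add: smult_monom)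
    thus ?case using Suc deg by (auto simp: eta_ratmap_add intro!: degree_add_less)
  qed
  have "p = (\<Sum>i<degree q. monom (coeff p i) i)"
    using assms by (intro poly_eqI) (auto simp: coeff_sum coeff_monom coeff_eq_0)
  thus ?thesis using *[of "degree q"] by simp
qed

text \<open>For \<open>\<alpha> = p(u) / q(u)\<close> the difference quotient
  \<open>(\<alpha> - \<alpha>(w)) / (u - w)\<close> is a combination of the maps
  \<open>u\<^sup>i / q(u)\<close>, \<open>i < deg q\<close>, with coefficients analytic in \<open>w\<close>.\<close>

lemma eps_ratmap_commutator:
  assumes deg: "degree p < degree q" and qw: "poly q w \<noteq> 0"
  shows "\<epsilon> (pt w) (lie v ((poly p w / poly q w) *\<^sub>C y)) -
      (\<epsilon> (pt w) v * \<eta> (ratmap p q y) - \<eta> (ratmap p q y) * \<epsilon> (pt w) v) =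
    \<eta> (ratmap (smult (poly p w / poly q w) (synthetic_div q w) - synthetic_div p w) q (lie v y))"
proof -
  define f where "f = poly p w / poly q w"
  define r where "r = smult f (synthetic_div q w) - synthetic_div p w"
  have "q \<noteq> 0" using qw by auto
  have degr: "degree r < degree q"
    unfolding r_def using deg degree_synthetic_div[of q w] degree_synthetic_div[of p w]
    by (intro degree_diff_less) (auto intro: order_le_less_trans[OF degree_smult_le])
  have deg': "degree p < degree (q * [:- w, 1:])"
    using deg \<open>q \<noteq> 0\<close> by (subst degree_mult_eq) auto
  \<comment> \<open>Dividing by \<open>x - w\<close> leaves the remainders \<open>poly q w\<close>
    and \<open>poly p w\<close>, and \<open>f\<close> is chosen so that they cancel in the
    combination.\<close>
  have r: "poly r x * (x - w) = f * poly q x - poly p x" for x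
  proof -
    have 1: "poly s x = (x - w) * poly (synthetic_div s w) x + poly s w" for s
      using arg_cong[OF synthetic_div_correct'[of w s], of "\<lambda>p. poly p x"] by (simp add: algebra_simps)
    have "f * poly q x - poly p x = f * ((x - w) * poly (synthetic_div q w) x) - (x - w) * poly (synthetic_div p w) x
        + (f * poly q w - poly p w)"
      unfolding 1[of q] 1[of p] by (simp add: algebra_simps)
    also have "f * poly q w - poly p w = 0" using qw by (simp add: f_def)
    finally show ?thesis by (simp add: r_def algebra_simps)
  qed
  have br: "\<epsilon> (pt w) v * \<eta> (ratmap p q y) - \<eta> (ratmap p q y) * \<epsilon> (pt w) v =
      \<eta> (ratmap p (q * [:- w, 1:]) (lie v y))"
    unfolding eps_pt
    by (rule eta_bracket)
       (use deg deg' in \<open>auto intro!: ratmap_in_gminus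
          simp: ratmap_def ratfun_def lie_scaleC_left lie_scaleC_right scaleC_scaleC algebra_simps\<close>)
  have "finite {x. ratmap r q (lie v y) x \<noteq> f *\<^sub>C ratmap 1 [:- w, 1:] (lie v y) x
      + (- 1) *\<^sub>C ratmap p (q * [:- w, 1:]) (lie v y) x}"
  proof (rule finite_subset)
    show "finite {x. u x \<in> {x. poly (q * [:- w, 1:]) x = 0}}"
      using \<open>q \<noteq> 0\<close> by (intro finite_u_vimage poly_roots_finite) (simp del: mult_pCons_right)
    have frac: "poly r x / poly q x = f * (poly 1 x / poly [:- w, 1:] x) + (- 1) * (poly p x / poly (q * [:- w, 1:]) x)"
      if "poly (q * [:- w, 1:]) x \<noteq> 0" for x
    proof -
      define D where "D = x - w"
      have D: "poly [:- w, 1:] x = D" "D \<noteq> 0" "poly q x \<noteq> 0"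
        using that by (auto simp: D_def)
      hence "poly r x = (f * poly q x - poly p x) / D"
        using r[of x] by (simp add: D_def[symmetric] eq_divide_eq)
      thus ?thesis unfolding poly_mult D(1) using D(2,3) by (simp add: field_simps)
    qed
    have "ratmap r q (lie v y) x = f *\<^sub>C ratmap 1 [:- w, 1:] (lie v y) x
        + (- 1) *\<^sub>C ratmap p (q * [:- w, 1:]) (lie v y) x"
      if "poly (q * [:- w, 1:]) (u x) \<noteq> 0" for x
    proof (cases "x = P")
      case False
      thus ?thesis
        by (simp only: ratmap_def ratfun_def if_False scaleC_scaleC scaleC_add_left[symmetric] frac[OF that])
    qed (simp add: ratmap_def ratfun_def)
    thus "{x. ratmap r q (lie v y) x \<noteq> f *\<^sub>C ratmap 1 [:- w, 1:] (lie v y) x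
      + (- 1) *\<^sub>C ratmap p (q * [:- w, 1:]) (lie v y) x} \<subseteq> {x. u x \<in> {x. poly (q * [:- w, 1:]) x = 0}}"
      by blast
  qed
  from eta_linear[OF eps_letter0 ratmap_in_gminus[OF deg'] ratmap_in_gminus[OF degr] this]
  have "\<eta> (ratmap r q (lie v y)) = f *\<^sub>C \<eta> (ratmap 1 [:- w, 1:] (lie v y)) +
      (- 1) *\<^sub>C \<eta> (ratmap p (q * [:- w, 1:]) (lie v y))"
    by blast
  thus ?thesis
    unfolding br unfolding lie_scaleC_right eps_scale eps_pt f_def[symmetric] r_def[symmetric]
    by (simp add: cvec.scale_minus_left scaleC_one)
qed

lemma eps_lie_sum: "\<epsilon> z (lie v (\<Sum>i\<in>I. f i)) = (\<Sum>i\<in>I. \<epsilon> z (lie v (f i)))"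
proof (induction I rule: infinite_finite_induct)
  case (insert i I)
  thus ?case by (simp add: lie_add_right eps_add)
qed (use eps_scale[of z 0 0] in auto)

text \<open>Each of the two terms has a pole at the moving point; together they give
  \<open>\<eta>\<close> of a difference quotient, which has none. The denominators do not vanish on
  \<open>S\<close>, so the fixed vectors lie in \<open>U S\<close>.\<close>

lemma eps_commutator_family:
  assumes \<alpha>: "\<alpha> \<in> L S" and S: "finite S" "P \<notin> S" and z: "z \<in> S"
  shows "analytic_family (u z) (U S)
    (\<lambda>w. \<epsilon> (pt w) (lie v (\<alpha> (pt w))) - (\<epsilon> (pt w) v * \<eta> \<alpha> - \<eta> \<alpha> * \<epsilon> (pt w) v))"
proof -
  have "z \<noteq> P" using z S by auto
  obtain I p q where I: "finite I" "\<And>b. b \<in> I \<Longrightarrow> degree (p b) < degree (q b)"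
    "\<And>b s. b \<in> I \<Longrightarrow> s \<in> S \<Longrightarrow> poly (q b) (u s) \<noteq> 0"
    and fin: "finite {x. \<alpha> x \<noteq> (\<Sum>b\<in>I. ratmap (p b) (q b) b x)}"
    using gminus_rational[OF \<alpha> S] by blast
  define R where "R = (\<lambda>b. ratmap (p b) (q b) b)"
  have RS: "R b \<in> L S" if "b \<in> I" for b
    unfolding R_def by (rule ratmap_in_gminus) (use I that S in auto)
  have \<eta>: "\<eta> \<alpha> = (\<Sum>b\<in>I. \<eta> (R b))"
    by (rule eta_sum) (use RS L_subset \<alpha> fin in \<open>auto simp: R_def\<close>)
  have at: "\<forall>\<^sub>F w in nhds (u z). \<alpha> (pt w) = (\<Sum>b\<in>I. R b (pt w))"
  proof (rule regular_maps_agree[OF \<open>z \<noteq> P\<close>])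
    show "regular_map \<alpha> z" using \<alpha> z letter_regular by blast
    show "regular_map (\<lambda>x. \<Sum>b\<in>I. R b x) z"
      using RS z letter_regular by (intro regular_map_sum) blast
  qed (use fin in \<open>simp add: R_def\<close>)
  define r where "r = (\<lambda>b w. smult (poly (p b) w / poly (q b) w) (synthetic_div (q b) w) - synthetic_div (p b) w)"
  have degr: "degree (r b w) < degree (q b)" if "b \<in> I" for b w
    unfolding r_def using I(2)[OF that] degree_synthetic_div[of "q b" w] degree_synthetic_div[of "p b" w]
    by (intro degree_diff_less) (auto intro: order_le_less_trans[OF degree_smult_le])
  have fam: "analytic_family (u z) (U S) (\<lambda>w. \<eta> (ratmap (r b w) (q b) (lie v b)))" if "b \<in> I" for b
  proof -
    have "analytic_family (u z) (U S) (\<lambda>w. \<Sum>i<degree (q b). coeff (r b w) i *\<^sub>C \<eta> (ratmap (monom 1 i) (q b) (lie v b)))"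
    proof (intro analytic_family_sum analytic_family.scale)
      fix i assume "i \<in> {..<degree (q b)}"
      have "(\<lambda>w. poly (p b) w / poly (q b) w * coeff (synthetic_div (q b) w) i - coeff (synthetic_div (p b) w) i) analytic_on {u z}"
        using I(3)[OF that z]
        by (intro analytic_intros coeff_synthetic_div_analytic analytic_at_poly_compose) auto
      thus "(\<lambda>w. coeff (r b w) i) analytic_on {u z}" by (simp add: r_def)
      have "degree (monom 1 i :: complex poly) < degree (q b)"
        using \<open>i \<in> _\<close> by (simp add: degree_monom_eq)
      thus "\<eta> (ratmap (monom 1 i) (q b) (lie v b)) \<in> U S"
        by (intro letter_in_U ratmap_in_gminus) (use I(3)[OF that] S in auto)
    qed
    thus ?thesis by (simp add: eta_ratmap_monoms[OF degr[OF that]])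
  qed
  have nz: "\<forall>\<^sub>F w in nhds (u z). \<forall>b\<in>I. poly (q b) w \<noteq> 0"
  proof (rule eventually_ball_finite[OF I(1)], rule ballI)
    fix b assume "b \<in> I"
    show "\<forall>\<^sub>F w in nhds (u z). poly (q b) w \<noteq> 0"
      by (rule eventually_nhds_compose_analytic[where g = "poly (q b)"])
         (use I(3)[OF \<open>b \<in> I\<close> z] in \<open>auto intro!: t1_space_nhds analytic_at_poly_compose[of "\<lambda>x. x"] analytic_intros\<close>)
  qed
  have "\<forall>\<^sub>F w in nhds (u z). (\<Sum>b\<in>I. \<eta> (ratmap (r b w) (q b) (lie v b))) =
     \<epsilon> (pt w) (lie v (\<alpha> (pt w))) - (\<epsilon> (pt w) v * \<eta> \<alpha> - \<eta> \<alpha> * \<epsilon> (pt w) v)"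
    using at nz
  proof eventually_elim
    case (elim w)
    have "\<eta> (ratmap (r b w) (q b) (lie v b)) =
        \<epsilon> (pt w) (lie v (R b (pt w))) - (\<epsilon> (pt w) v * \<eta> (R b) - \<eta> (R b) * \<epsilon> (pt w) v)" if "b \<in> I" for b
      using eps_ratmap_commutator[OF I(2)[OF that], of w v b] elim(2) that
      by (simp add: r_def R_def ratmap_def[of "p b" "q b" b "pt w"] ratfun_def)
    thus ?case
      by (simp add: elim(1) eps_lie_sum \<eta> sum_subtractf sum_distrib_left sum_distrib_right)
  qed
  thus ?thesis
    by (rule analytic_family.cong[rotated]) (intro analytic_family_sum fam)
qed

text \<open>Near \<open>z\<close> the value of \<open>deriv_wrt\<close> is identified with the weak
  derivative of the family, which requires \<open>\<alpha>\<close> to be regular at the nearby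
  points as well.\<close>

lemma form_deriv_analytic:
  assumes \<alpha>: "\<alpha> \<in> L S" and S: "finite S" "P \<notin> S" and z: "z \<in> S"
  shows "(\<lambda>w. B v (deriv_wrt u \<alpha> (pt w))) analytic_on {u z}"
proof -
  have "z \<noteq> P" using z S by auto
  obtain d where d: "analytic_family (u z) UNIV d" "\<forall>\<^sub>F w in nhds (u z). has_weak_deriv (\<lambda>w. \<alpha> (pt w)) (d w) w"
    using analytic_family_has_weak_deriv[OF letter_family[OF \<alpha> z \<open>z \<noteq> P\<close>]] by blast
  have "\<forall>\<^sub>F w in nhds (u z). regular_map \<alpha> (pt w)"
  proof -
    have "\<forall>\<^sub>F w in nhds (u z). w \<noteq> u z \<longrightarrow> \<alpha> \<in> L (insert (pt w) S)"
      using gminus_eventually_regular[OF \<alpha> S, of "u z"] by (simp add: eventually_at_filter)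
    thus ?thesis
    proof eventually_elim
      case (elim w)
      thus ?case using letter_regular[OF \<alpha> z] \<open>z \<noteq> P\<close> letter_regular[of \<alpha> "insert (pt w) S" "pt w"]
        by (cases "w = u z") auto
    qed
  qed
  with d(2) have "\<forall>\<^sub>F w in nhds (u z). B v (d w) = B v (deriv_wrt u \<alpha> (pt w))"
  proof eventually_elim
    case (elim w)
    from deriv_wrt[OF pt_neq_P elim(2)] elim(1) show ?case
      using has_weak_deriv_unique by fastforce
  qed
  from analytic_at_cong[OF this refl] show ?thesis
    using analytic_family_functional[OF d(1) clinear_form] by simp
qed

text \<open>The set \<open>S\<close> may contain points besides \<open>z\<close>. Keeping the
  vectors in \<open>U S\<close> rather than in \<open>U {z}\<close> is what later permits a second
  current to follow.\<close>

lemma iota_word_family: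
  assumes S: "finite S" "P \<notin> S" and z: "z \<in> S" and w: "w \<in> lists (L S)"
  shows "analytic_family (u z) (U S) (\<lambda>x. iota_word w (pt x) v)"
  using w
proof (induction w arbitrary: v)
  case Nil thus ?case by (simp add: analytic_family.zero)
next
  case (Cons \<alpha> w)
  hence \<alpha>: "\<alpha> \<in> L S" and w: "w \<in> lists (L S)" by auto
  have "z \<noteq> P" using z S by auto
  have word_U: "word w \<in> U S" by (rule word_in_U[OF w])
  have 1: "analytic_family (u z) (U S) (\<lambda>x. \<eta> \<alpha> * iota_word w (pt x) v)"
    by (rule analytic_family_linear_image[OF Cons.IH])
       (auto simp: distrib_left mult_scaleC_simps intro: letter_mult_in_U \<alpha>)
  \<comment> \<open>These two terms are grouped because only together are they analytic in the
    point.\<close>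
  have 2: "analytic_family (u z) (U S)
    (\<lambda>x. (\<epsilon> (pt x) (lie v (\<alpha> (pt x))) - (\<epsilon> (pt x) v * \<eta> \<alpha> - \<eta> \<alpha> * \<epsilon> (pt x) v)) * word w)"
    by (rule analytic_family_linear_image[OF eps_commutator_family[OF \<alpha> S z]])
       (auto simp: distrib_right mult_scaleC_simps intro!: mult_in_U word_U)
  have 3: "analytic_family (u z) (U S) (\<lambda>x. B v (deriv_wrt u \<alpha> (pt x)) *\<^sub>C word w)"
    by (rule analytic_family.scale[OF form_deriv_analytic[OF \<alpha> S z] word_U])
  have lv: "analytic_family (u z) UNIV (\<lambda>x. lie v (\<alpha> (pt x)))"
    by (rule analytic_family_linear_image[OF letter_family[OF \<alpha> z \<open>z \<noteq> P\<close>]])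
       (auto simp: lie_add_right lie_scaleC_right)
  have 4: "analytic_family (u z) (U S) (\<lambda>x. iota_word w (pt x) (lie v (\<alpha> (pt x))))"
    by (rule analytic_family_apply[OF lv, where G = "\<lambda>x. iota_word w (pt x)"])
       (auto simp: Cons.IH iota_word_add iota_word_scale)
  from analytic_family_diff[OF analytic_family.add[OF 1 analytic_family.add[OF 2 4]] 3]
  show ?case by (simp add: algebra_simps)
qed

subsection \<open>The operators\<close>

lemma iota_word_zero:
  assumes z: "z \<noteq> P" and a: "Poly_Mapping.keys a \<subseteq> lists (L {z})" "linear_extension word a = 0"
  shows "linear_extension (\<lambda>w. iota_word w z v) a = 0"
proof -
  have "Poly_Mapping.keys a \<subseteq> lists (L {})"
    using a(1) lists_mono[OF L_subset[of "{z}"]] by blast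
  hence "a \<in> enveloping_ideal (L {})" using free_eval_eq_0_iff a(2) by blast
  hence "\<forall>\<^sub>F w in at (u z). a \<in> enveloping_ideal (L {pt w})"
    by (rule ideal_eventually_regular)
  hence ev: "\<forall>\<^sub>F x in at (u z). linear_extension (\<lambda>w. iota_word w (pt x) v) a = 0"
  proof eventually_elim
    case (elim x)
    \<comment> \<open>The extensions of \<open>current_word\<close> and \<open>iota_word\<close>
      differ by a left multiple of the value of \<open>a\<close> in the algebra, which is 0.\<close>
    from current_word_ideal[OF pt_neq_P elim, of v]
    show ?case by (simp add: current_word_def linear_extension_add_fun linear_extension_mult a(2))
  qed
  have "analytic_family (u z) (U {z}) (\<lambda>x. linear_extension (\<lambda>w. iota_word w (pt x) v) a)"
    unfolding linear_extension_def
    by (intro analytic_family_sum analytic_family_mult iota_word_family) (use z a in auto)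
  from analytic_family_identity[OF this analytic_family.zero ev] z show ?thesis by simp
qed

text \<open>Any representing combination of words will do: \<open>iota_word_zero\<close>, applied to
  the difference of two of them, makes the choice immaterial.\<close>

definition iota_op :: "proj_line \<Rightarrow> 'g \<Rightarrow> 'u \<Rightarrow> 'u" where
  "iota_op z v x = (if x \<in> U {z} then linear_extension (\<lambda>w. iota_word w z v)
     (SOME a. Poly_Mapping.keys a \<subseteq> lists (L {z}) \<and> x = linear_extension word a) else 0)"

lemma iota_op_eval:
  assumes z: "z \<noteq> P" and a: "Poly_Mapping.keys a \<subseteq> lists (L {z})"
  shows "iota_op z v (linear_extension word a) = linear_extension (\<lambda>w. iota_word w z v) a"
proof -
  define a' where "a' = (SOME a'. Poly_Mapping.keys a' \<subseteq> lists (L {z}) \<and> linear_extension word a = linear_extension word a')"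
  have a': "Poly_Mapping.keys a' \<subseteq> lists (L {z})" "linear_extension word a = linear_extension word a'"
    using someI_ex[of "\<lambda>a'. Poly_Mapping.keys a' \<subseteq> lists (L {z}) \<and> linear_extension word a = linear_extension word a'"] a
    unfolding a'_def by blast+
  have "linear_extension (\<lambda>w. iota_word w z v) (a' - a) = 0"
  proof (rule iota_word_zero[OF z])
    show "Poly_Mapping.keys (a' - a) \<subseteq> lists (L {z})"
      using Poly_Mapping.keys_diff[of a' a] a a'(1) by blast
  qed (simp add: linear_extension_diff a'(2))
  thus ?thesis
    using U_I[OF a] by (simp add: iota_op_def a'_def[symmetric] linear_extension_diff)
qed

text \<open>The terms of the recursion with \<open>\<epsilon> z\<close> need not be regular at
  \<open>z\<close> one by one. The whole is the value at \<open>u z\<close> of a family in the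
  subspace \<open>U S\<close>, and so lies in it.\<close>

lemma iota_word_in_U:
  assumes "finite S" "P \<notin> S" "z \<in> S" "w \<in> lists (L S)"
  shows "iota_word w z v \<in> U S"
proof -
  have "z \<noteq> P" using assms by auto
  thus ?thesis
    using analytic_family_in_span[OF iota_word_family[OF assms] zero_in_U add_in_U scale_in_U, of v] by simp
qed

lemma sum_in_U: "(\<And>i. i \<in> I \<Longrightarrow> f i \<in> U S) \<Longrightarrow> sum f I \<in> U S"
  by (induction I rule: infinite_finite_induct) (auto intro: zero_in_U add_in_U)

lemma iota_op_in_U:
  assumes S: "finite S" "P \<notin> S" "z \<in> S" and x: "x \<in> U S"
  shows "iota_op z v x \<in> U S"
proof -
  obtain a where a: "Poly_Mapping.keys a \<subseteq> lists (L S)" "x = linear_extension word a"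
    using x by (auto simp: U_iff)
  have "L S \<subseteq> L {z}" using S by (intro gminus_mono) auto
  hence az: "Poly_Mapping.keys a \<subseteq> lists (L {z})" using a(1) lists_mono by blast
  have "z \<noteq> P" using S by auto
  have "linear_extension (\<lambda>w. iota_word w z v) a \<in> U S"
    unfolding linear_extension_def
    by (intro sum_in_U scale_in_U iota_word_in_U) (use S a in auto)
  thus ?thesis using iota_op_eval[OF \<open>z \<noteq> P\<close> az] a(2) by simp
qed

lemma is_iota_iota_op:
  assumes z: "z \<noteq> P"
  shows "is_iota B P u \<eta> z (iota_op z)"
  unfolding is_iota_def
proof (intro conjI allI ballI impI)
  fix v x assume "x \<in> U {z}"
  thus "iota_op z v x \<in> U {z}" using z by (intro iota_op_in_U) auto
next
  fix v x y assume "x \<in> U {z}" "y \<in> U {z}"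
  then obtain a b where ab: "Poly_Mapping.keys a \<subseteq> lists (L {z})" "x = linear_extension word a"
    "Poly_Mapping.keys b \<subseteq> lists (L {z})" "y = linear_extension word b"
    unfolding U_iff by blast
  have "Poly_Mapping.keys (a + b) \<subseteq> lists (L {z})"
    using Poly_Mapping.keys_add[of a b] ab(1,3) by blast
  from iota_op_eval[OF z this, of v] show "iota_op z v (x + y) = iota_op z v x + iota_op z v y"
    using iota_op_eval[OF z ab(1), of v] iota_op_eval[OF z ab(3), of v]
    by (simp add: linear_extension_add ab)
next
  fix v c x assume "x \<in> U {z}"
  then obtain a where a: "Poly_Mapping.keys a \<subseteq> lists (L {z})" "x = linear_extension word a"
    unfolding U_iff by blast
  have "Poly_Mapping.keys (relabel (\<lambda>w. w) c a) \<subseteq> lists (L {z})"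
    using keys_relabel[of "\<lambda>w. w" c a] a(1) by auto
  from iota_op_eval[OF z this, of v] show "iota_op z v (c *\<^sub>C x) = c *\<^sub>C iota_op z v x"
    using iota_op_eval[OF z a(1), of v] by (simp add: linear_extension_relabel a)
next
  fix v x assume "x \<notin> U {z}"
  thus "iota_op z v x = 0" by (simp add: iota_op_def)
next
  fix v
  show "iota_op z v 1 = 0"
    using iota_op_eval[OF z, of "Poly_Mapping.single [] 1" v] by (simp add: scaleC_one)
next
  fix v \<alpha> x assume \<alpha>: "\<alpha> \<in> L {z}" and x: "x \<in> U {z}"
  then obtain a where a: "Poly_Mapping.keys a \<subseteq> lists (L {z})" "x = linear_extension word a"
    unfolding U_iff by blast
  have "\<alpha> # w \<in> lists (L {z})" if "w \<in> Poly_Mapping.keys a" for w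
  proof -
    have "w \<in> lists (L {z})" using that a(1) by blast
    thus ?thesis using \<alpha> by simp
  qed
  hence "Poly_Mapping.keys (relabel ((#) \<alpha>) 1 a) \<subseteq> lists (L {z})"
    by (intro order_trans[OF keys_relabel]) blast
  from iota_op_eval[OF z this, of v]
  have "iota_op z v (\<eta> \<alpha> * x) = linear_extension (\<lambda>w. iota_word (\<alpha> # w) z v) a"
    by (simp only: linear_extension_relabel a(2) scaleC_one list.map prod_list.Cons linear_extension_mult)
  thus "iota_op z v (\<eta> \<alpha> * x) - \<eta> \<alpha> * iota_op z v x =
      - ((\<epsilon> z v * \<eta> \<alpha> - \<eta> \<alpha> * \<epsilon> z v) * x) - B v (deriv_wrt u \<alpha> z) *\<^sub>C x
      + iota_op z (lie v (\<alpha> z)) x + \<epsilon> z (lie v (\<alpha> z)) * x"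
    by (simp add: a(2) iota_op_eval[OF z a(1)] linear_extension_add_fun linear_extension_diff_fun
        linear_extension_mult linear_extension_scale algebra_simps)
qed

text \<open>All labels are treated at once, since the relation passes from \<open>v\<close> to
  \<open>lie v (\<alpha> z)\<close>.\<close>

lemma is_iota_unique:
  assumes "is_iota B P u \<eta> z I" "is_iota B P u \<eta> z J"
  shows "I = J"
proof (intro ext)
  fix v x
  show "I v x = J v x"
  proof (cases "x \<in> U {z}")
    case False
    thus ?thesis using assms by (simp add: is_iota_def)
  next
    case True
    have "\<forall>v. I v x = J v x"
      using True
    proof (induction rule: U_induct)
      case one thus ?case using assms by (simp add: is_iota_def)
    next
      case (letter \<alpha> x)
      have *: "K v (\<eta> \<alpha> * x) = \<eta> \<alpha> * K v x - (\<epsilon> z v * \<eta> \<alpha> - \<eta> \<alpha> * \<epsilon> z v) * x - B v (deriv_wrt u \<alpha> z) *\<^sub>C x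
          + K (lie v (\<alpha> z)) x + \<epsilon> z (lie v (\<alpha> z)) * x" if "is_iota B P u \<eta> z K" for K v
      proof -
        have "K v (\<eta> \<alpha> * x) - \<eta> \<alpha> * K v x = - ((\<epsilon> z v * \<eta> \<alpha> - \<eta> \<alpha> * \<epsilon> z v) * x)
            - B v (deriv_wrt u \<alpha> z) *\<^sub>C x + K (lie v (\<alpha> z)) x + \<epsilon> z (lie v (\<alpha> z)) * x"
          using that letter(1,2) unfolding is_iota_def by blast
        thus ?thesis by (simp add: algebra_simps)
      qed
      show ?case using *[OF assms(1)] *[OF assms(2)] letter.IH by simp
    next
      case (add x y) thus ?case using assms by (simp add: is_iota_def)
    next
      case (scale c x) thus ?case using assms by (simp add: is_iota_def)
    qed
    thus ?thesis by blast
  qed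
qed

abbreviation \<iota> :: "proj_line \<Rightarrow> 'g \<Rightarrow> 'u \<Rightarrow> 'u" where "\<iota> z v x \<equiv> iota B P u \<eta> z v x"
abbreviation \<j> :: "proj_line \<Rightarrow> 'g \<Rightarrow> 'u \<Rightarrow> 'u" where "\<j> z v x \<equiv> current B P u \<eta> z v x"

lemma iota_eq: "z \<noteq> P \<Longrightarrow> iota B P u \<eta> z = iota_op z"
  unfolding iota_def by (rule the_equality) (auto intro: is_iota_iota_op is_iota_unique)

lemma is_iota: "z \<noteq> P \<Longrightarrow> is_iota B P u \<eta> z (iota B P u \<eta> z)"
  by (simp add: iota_eq is_iota_iota_op)

lemma iota_in_U: "finite S \<Longrightarrow> P \<notin> S \<Longrightarrow> z \<in> S \<Longrightarrow> x \<in> U S \<Longrightarrow> \<iota> z v x \<in> U S"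
  using iota_op_in_U iota_eq by metis

text \<open>Linearity in the label is not among the clauses of \<open>is_iota\<close>; it is
  inherited from the recursion on words.\<close>

lemma iota_scale_label:
  assumes "z \<noteq> P" "x \<in> U {z}"
  shows "\<iota> z (c *\<^sub>C v) x = c *\<^sub>C \<iota> z v x"
proof -
  obtain a where a: "Poly_Mapping.keys a \<subseteq> lists (L {z})" "x = linear_extension word a"
    using assms(2) unfolding U_iff by blast
  show ?thesis
    by (simp add: iota_eq assms(1) a(2) iota_op_eval[OF assms(1) a(1)] iota_word_scale linear_extension_scale)
qed

lemma U_eventually_regular:
  assumes "x \<in> U S" "finite S" "P \<notin> S"
  shows "\<forall>\<^sub>F w in at b. x \<in> U (insert (pt w) S)"
proof -
  obtain a where a: "Poly_Mapping.keys a \<subseteq> lists (L S)" "x = linear_extension word a"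
    using assms(1) unfolding U_iff by blast
  have "\<forall>\<^sub>F x in at b. \<forall>w\<in>Poly_Mapping.keys a. w \<in> lists (L (insert (pt x) S))"
    using a(1) assms(2,3) by (intro eventually_ball_finite ballI lists_eventually_regular) auto
  thus ?thesis by eventually_elim (auto simp: a(2) intro!: U_I)
qed

text \<open>One combination of words represents \<open>x\<close> for all nearby points
  simultaneously, because its letters are regular at all of them.\<close>

lemma iota_family:
  assumes "z \<noteq> P" "x \<in> U {z}"
  shows "analytic_family (u z) (U {z}) (\<lambda>w. \<iota> (pt w) v x)"
proof -
  obtain a where a: "Poly_Mapping.keys a \<subseteq> lists (L {z})" "x = linear_extension word a"
    using assms(2) unfolding U_iff by blast
  have "\<forall>\<^sub>F x in at (u z). \<forall>w\<in>Poly_Mapping.keys a. w \<in> lists (L (insert (pt x) {z}))"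
    using a(1) assms(1) by (intro eventually_ball_finite ballI lists_eventually_regular) auto
  hence "\<forall>\<^sub>F x in at (u z). Poly_Mapping.keys a \<subseteq> lists (L {pt x})"
  proof eventually_elim
    case (elim x)
    have "L {pt x, z} \<subseteq> L {pt x}" by (rule gminus_mono) auto
    thus ?case using elim lists_mono by blast
  qed
  hence "\<forall>\<^sub>F x in nhds (u z). Poly_Mapping.keys a \<subseteq> lists (L {pt x})"
    unfolding eventually_at_filter by eventually_elim (use a(1) assms(1) in auto)
  hence ev: "\<forall>\<^sub>F w in nhds (u z). linear_extension (\<lambda>l. iota_word l (pt w) v) a = \<iota> (pt w) v x"
    by eventually_elim (simp add: a(2) iota_eq iota_op_eval)
  have "analytic_family (u z) (U {z}) (\<lambda>x. linear_extension (\<lambda>w. iota_word w (pt x) v) a)"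
    unfolding linear_extension_def
    by (intro analytic_family_sum analytic_family_mult iota_word_family) (use assms a in auto)
  thus ?thesis by (rule analytic_family.cong) (rule ev)
qed

section \<open>Currents at two points\<close>

lemma current_add: "z \<noteq> P \<Longrightarrow> x \<in> U {z} \<Longrightarrow> y \<in> U {z} \<Longrightarrow> \<j> z v (x + y) = \<j> z v x + \<j> z v y"
  using is_iota[of z] by (simp add: current_def is_iota_def distrib_left)

lemma current_scale: "z \<noteq> P \<Longrightarrow> x \<in> U {z} \<Longrightarrow> \<j> z v (c *\<^sub>C x) = c *\<^sub>C \<j> z v x"
  using is_iota[of z] by (simp add: current_def is_iota_def scaleC_add_right mult_scaleC_simps)

lemma current_diff: "z \<noteq> P \<Longrightarrow> x \<in> U {z} \<Longrightarrow> y \<in> U {z} \<Longrightarrow> \<j> z v (x - y) = \<j> z v x - \<j> z v y"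
  using current_add[of z "x - y" y v] by (simp add: diff_in_U)

lemma current_one: "z \<noteq> P \<Longrightarrow> \<j> z v 1 = \<epsilon> z v"
  using is_iota[of z] by (simp add: current_def is_iota_def)

lemma current_scale_label: "z \<noteq> P \<Longrightarrow> x \<in> U {z} \<Longrightarrow> \<j> z (c *\<^sub>C v) x = c *\<^sub>C \<j> z v x"
  by (simp add: current_def iota_scale_label eps_scale mult_scaleC_simps scaleC_add_right)

lemma current_letter:
  assumes "z \<noteq> P" "\<alpha> \<in> L {z}" "x \<in> U {z}"
  shows "\<j> z v (\<eta> \<alpha> * x) = \<eta> \<alpha> * \<j> z v x + \<j> z (lie v (\<alpha> z)) x - B v (deriv_wrt u \<alpha> z) *\<^sub>C x"
proof -
  have "\<iota> z v (\<eta> \<alpha> * x) - \<eta> \<alpha> * \<iota> z v x = - ((\<epsilon> z v * \<eta> \<alpha> - \<eta> \<alpha> * \<epsilon> z v) * x)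
      - B v (deriv_wrt u \<alpha> z) *\<^sub>C x + \<iota> z (lie v (\<alpha> z)) x + \<epsilon> z (lie v (\<alpha> z)) * x"
    using is_iota[OF assms(1)] assms(2,3) unfolding is_iota_def by blast
  thus ?thesis by (simp add: current_def algebra_simps)
qed

text \<open>Partial fractions for the product of two simple poles, obtained as the difference
  quotient of \<open>1 / (u - u z)\<close>.\<close>

lemma eps_commutator:
  assumes "z \<noteq> P" "z' \<noteq> P" "z' \<noteq> z"
  shows "\<epsilon> z' v' * \<epsilon> z v - \<epsilon> z v * \<epsilon> z' v' =
    (1 / (u z' - u z)) *\<^sub>C (\<epsilon> z' (lie v' v) - \<epsilon> z (lie v' v))"
proof -
  have neq: "u z' - u z \<noteq> 0" using assms u_eq_iff by simp
  have sd: "synthetic_div [:- u z, 1:] (u z') = 1" "synthetic_div 1 (u z') = 0"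
    by (simp_all add: one_pCons)
  have "\<epsilon> z' (lie v' ((1 / (u z' - u z)) *\<^sub>C v)) - (\<epsilon> z' v' * \<epsilon> z v - \<epsilon> z v * \<epsilon> z' v') =
      \<eta> (ratmap (smult (1 / (u z' - u z)) 1) [:- u z, 1:] (lie v' v))"
    using eps_ratmap_commutator[of 1 "[:- u z, 1:]" "u z'" v' v] neq assms
    by (simp add: sd eps_eq[of z])
  also have "\<dots> = (1 / (u z' - u z)) *\<^sub>C \<epsilon> z (lie v' v)"
    by (subst eta_ratmap_smult) (simp_all add: eps_eq)
  finally show ?thesis
    by (simp add: lie_scaleC_right eps_scale cvec.scale_right_diff_distrib algebra_simps)
qed

text \<open>The pole \<open>v / (u - u z)\<close> is itself a letter regular at \<open>z'\<close>.
  Its value there produces the simple pole of the operator product, its derivative the double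
  pole.\<close>

lemma current_eps:
  assumes "z \<noteq> P" "z' \<noteq> P" "z' \<noteq> z" "x \<in> U {z'}"
  shows "\<j> z' v' (\<epsilon> z v * x) = \<epsilon> z v * \<j> z' v' x + (1 / (u z' - u z)) *\<^sub>C \<j> z' (lie v' v) x
    + (B v' v / (u z' - u z)\<^sup>2) *\<^sub>C x"
proof -
  define \<alpha> where "\<alpha> = ratmap 1 [:- u z, 1:] v"
  have neq: "u z' - u z \<noteq> 0" using assms u_eq_iff by simp
  have \<alpha>: "\<alpha> \<in> L {z'}" unfolding \<alpha>_def by (rule eps_letter) (use assms in auto)
  have val: "\<alpha> z' = (1 / (u z' - u z)) *\<^sub>C v"
    using assms by (simp add: \<alpha>_def ratmap_def ratfun_def)
  \<comment> \<open>This minus sign meets the one in \<open>current_letter\<close>, so the double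
    pole enters with a plus sign and has to be subtracted later.\<close>
  have "((\<lambda>w. 1 / (w - u z)) has_field_derivative - 1 / (u z' - u z)\<^sup>2) (at (u z'))"
    using neq by (auto intro!: derivative_eq_intros simp: power2_eq_square)
  from has_weak_deriv_scale[OF this, of v]
  have "has_weak_deriv (\<lambda>w. \<alpha> (pt w)) ((- 1 / (u z' - u z)\<^sup>2) *\<^sub>C v) (u z')"
    by (simp add: \<alpha>_def ratmap_def ratfun_def)
  hence d: "deriv_wrt u \<alpha> z' = (- 1 / (u z' - u z)\<^sup>2) *\<^sub>C v"
    using has_weak_deriv_unique deriv_wrt[OF assms(2) letter_regular[OF \<alpha>]] by blast
  have b: "B v' (deriv_wrt u \<alpha> z') = - (B v' v / (u z' - u z)\<^sup>2)"
    unfolding d form_scale_right by simp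
  have "\<epsilon> z v = \<eta> \<alpha>" by (simp add: eps_eq \<alpha>_def)
  thus ?thesis
    using current_letter[OF assms(2) \<alpha> assms(4), of v'] assms
    by (simp add: val b lie_scaleC_right current_scale_label cvec.scale_minus_left)
qed

text \<open>A current at \<open>z\<close> may create a pole at \<open>z\<close> but none at
  \<open>z'\<close>, so a current at \<open>z'\<close> can be applied next.\<close>

lemma current_in_U:
  assumes "z \<noteq> P" "z' \<noteq> P" "z \<noteq> z'" "x \<in> U {z, z'}"
  shows "\<j> z v x \<in> U {z'}"
proof -
  have sub: "U {z, z'} \<subseteq> U {z'}" by (rule U_mono) auto
  have "\<epsilon> z v * x \<in> U {z'}"
    unfolding eps_eq by (intro letter_mult_in_U eps_letter) (use assms sub in auto)
  moreover have "\<iota> z v x \<in> U {z, z'}" by (rule iota_in_U) (use assms in auto)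
  ultimately show ?thesis unfolding current_def using sub by (intro add_in_U) auto
qed

text \<open>Moving a letter out of either current changes labels and scalars at that point alone, so
  both orders produce the same terms by induction over all labels. On 1 the claim reduces to the
  commutator of two simple poles.\<close>

lemma currents_commute:
  assumes z: "z \<noteq> P" "z' \<noteq> P" "z \<noteq> z'" and x: "x \<in> U {z, z'}"
  shows "\<j> z' v' (\<j> z v x) = \<j> z v (\<j> z' v' x)"
  using x
proof (induction arbitrary: v v' rule: U_induct)
  case one
  have neq: "u z' - u z \<noteq> 0" using z u_eq_iff by simp
  define c where "c = 1 / (u z' - u z)"
  have c: "1 / (u z - u z') = - c" using neq by (simp add: c_def field_simps)
  have l: "\<epsilon> z (lie v v') = - \<epsilon> z (lie v' v)"
    using eps_scale[of z "-1" "lie v' v"] lie_minus_commute[of v v']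
    by (simp add: cvec.scale_minus_left scaleC_one)
  have 1: "\<j> z' v' (\<j> z v 1) = \<epsilon> z v * \<epsilon> z' v' + c *\<^sub>C \<epsilon> z' (lie v' v) + (B v' v / (u z' - u z)\<^sup>2) *\<^sub>C 1"
    using current_eps[of z z' 1 v' v] z by (simp add: current_one one_in_U c_def)
  \<comment> \<open>Exchanging the points reverses the sign of \<open>c\<close> and of the bracket,
    so both orders carry \<open>c\<close> with the same sign.\<close>
  have 2: "\<j> z v (\<j> z' v' 1) = \<epsilon> z' v' * \<epsilon> z v + c *\<^sub>C \<epsilon> z (lie v' v) + (B v' v / (u z' - u z)\<^sup>2) *\<^sub>C 1"
    using current_eps[of z' z 1 v v'] z
    by (simp add: current_one one_in_U c l form_commute[of v v'] power2_commute[of "u z"]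
        cvec.scale_minus_left cvec.scale_minus_right)
  show ?case
    unfolding 1 2 using eps_commutator[of z z' v' v] z
    by (simp add: c_def[symmetric] cvec.scale_right_diff_distrib algebra_simps)
next
  case (letter \<alpha> x)
  have sub: "L {z, z'} \<subseteq> L {z}" "L {z, z'} \<subseteq> L {z'}" by (rule gminus_mono; simp)+
  have subU: "U {z, z'} \<subseteq> U {z}" "U {z, z'} \<subseteq> U {z'}" by (rule U_mono; simp)+
  have in1: "\<j> z w x \<in> U {z'}" for w by (rule current_in_U) (use z letter in auto)
  have in2: "\<j> z' w x \<in> U {z}" for w
    by (rule current_in_U) (use z letter in \<open>auto simp: insert_commute\<close>)
  have m: "\<alpha> \<in> L {z}" "\<alpha> \<in> L {z'}" "x \<in> U {z}" "x \<in> U {z'}" using letter sub subU by auto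
  note lin = current_letter current_add current_diff current_scale letter_mult_in_U add_in_U diff_in_U scale_in_U
  show ?case
    using z m in1 in2 letter.IH by (simp add: lin algebra_simps)
next
  case (add x y)
  have subU: "U {z, z'} \<subseteq> U {z}" "U {z, z'} \<subseteq> U {z'}" by (rule U_mono; simp)+
  have "\<j> z v x \<in> U {z'}" "\<j> z v y \<in> U {z'}" "\<j> z' v' x \<in> U {z}" "\<j> z' v' y \<in> U {z}"
    using z add by (auto intro!: current_in_U simp: insert_commute)
  thus ?case using z add subU by (simp add: current_add subset_iff)
next
  case (scale c x)
  have subU: "U {z, z'} \<subseteq> U {z}" "U {z, z'} \<subseteq> U {z'}" by (rule U_mono; simp)+
  have "\<j> z v x \<in> U {z'}" "\<j> z' v' x \<in> U {z}"
    using z scale by (auto intro!: current_in_U simp: insert_commute)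
  thus ?case using z scale subU by (simp add: current_scale subset_iff)
qed

subsection \<open>The operator product\<close>

text \<open>The only place where functions converge: the moving pole runs into \<open>z\<close>,
  hence the exceptional set \<open>{z}\<close>.\<close>

lemma eps_tendsto:
  assumes z: "z \<noteq> P"
  shows "U_tendsto P \<eta> (\<lambda>x. \<epsilon> x v) (\<epsilon> z v) (at_point z)"
proof -
  have eq: "ratmap 1 [:- u x, 1:] v = (\<lambda>p. (if p = P then 0 else 1 / (u p - u x)) *\<^sub>C v)" for x
    by (simp add: ratmap_def ratfun_def fun_eq_iff)
  show ?thesis
    unfolding eps_eq eq
    by (rule U_tendsto.generator[OF _ _ locally_uniform_limit_pole[OF z]])
       (use z eps_letter0 in \<open>auto simp: eq[symmetric]\<close>)
qed

text \<open>The vectors are fixed, so limits of the scalar coefficients suffice.\<close>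

lemma analytic_family_U_tendsto:
  assumes z: "z \<noteq> P" and X: "analytic_family (u z) Y X"
  shows "U_tendsto P \<eta> (\<lambda>x. X (u x)) (X (u z)) (at_point z)"
  using X
proof induction
  case zero show ?case by (rule U_tendsto.const)
next
  case (scale c y)
  have "(c \<longlongrightarrow> c (u z)) (at (u z))"
    using analytic_at_imp_isCont[OF scale(1)] by (simp add: isCont_def)
  from U_tendsto.scale[OF tendsto_at_point[OF z this] U_tendsto.const] show ?case .
next
  case (add X X') thus ?case by (intro U_tendsto.add)
next
  case (cong X X')
  have "\<forall>\<^sub>F x in at_point z. X (u x) = X' (u x)"
    using cong.hyps(2) z by (auto simp: eventually_at_point eventually_at_filter elim: eventually_mono)
  from U_tendsto.cong[OF cong.IH this] show ?case
    using eventually_nhds_x_imp_x[OF cong.hyps(2)] by simp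
qed

lemma analytic_family_U_derivative:
  assumes z: "z \<noteq> P" and X: "analytic_family (u z) Y X"
  shows "\<exists>d. U_has_derivative P u \<eta> (\<lambda>x. X (u x)) d z"
  unfolding U_has_derivative_def using X
proof induction
  case zero
  have "U_tendsto P \<eta> (\<lambda>_. 0) 0 (at_point z)" by (rule U_tendsto.const)
  thus ?case by auto
next
  case (scale c y)
  have "((\<lambda>w. (c w - c (u z)) / (w - u z)) \<longlongrightarrow> deriv c (u z)) (at (u z))"
    using analytic_at_has_derivative[OF scale(1)] by (simp add: has_field_derivative_iff)
  from U_tendsto.scale[OF tendsto_at_point[OF z this] U_tendsto.const]
  show ?case by (auto simp: cvec.scale_left_diff_distrib[symmetric] scaleC_scaleC)
next
  case (add X X')
  then obtain d d' where
    "U_tendsto P \<eta> (\<lambda>x. (1 / (u x - u z)) *\<^sub>C (X (u x) - X (u z))) d (at_point z)"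
    "U_tendsto P \<eta> (\<lambda>x. (1 / (u x - u z)) *\<^sub>C (X' (u x) - X' (u z))) d' (at_point z)"
    by blast
  from U_tendsto.add[OF this]
  have "U_tendsto P \<eta> (\<lambda>x. (1 / (u x - u z)) *\<^sub>C (X (u x) + X' (u x) - (X (u z) + X' (u z)))) (d + d') (at_point z)"
    by (simp add: scaleC_add_right[symmetric] algebra_simps del: scaleC_add_right)
  thus ?case by blast
next
  case (cong X X')
  then obtain d where
    d: "U_tendsto P \<eta> (\<lambda>x. (1 / (u x - u z)) *\<^sub>C (X (u x) - X (u z))) d (at_point z)"
    by blast
  have "\<forall>\<^sub>F x in at_point z. X (u x) = X' (u x)"
    using cong.hyps(2) z by (auto simp: eventually_at_point eventually_at_filter elim: eventually_mono)
  hence "\<forall>\<^sub>F x in at_point z. (1 / (u x - u z)) *\<^sub>C (X (u x) - X (u z)) = (1 / (u x - u z)) *\<^sub>C (X' (u x) - X' (u z))"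
    by eventually_elim (use eventually_nhds_x_imp_x[OF cong.hyps(2)] in simp)
  from U_tendsto.cong[OF d this] show ?case by blast
qed

lemma eventually_at_point_pt: "z \<noteq> P \<Longrightarrow> \<forall>\<^sub>F x in at_point z. pt (u x) = x"
  by (simp add: eventually_at_point)

lemma iota_tendsto:
  assumes z: "z \<noteq> P" and x: "x \<in> U {z}"
  shows "U_tendsto P \<eta> (\<lambda>y. \<iota> y v x) (\<iota> z v x) (at_point z)"
proof -
  have "\<forall>\<^sub>F y in at_point z. \<iota> (pt (u y)) v x = \<iota> y v x"
    using eventually_at_point_pt[OF z] by eventually_elim simp
  from U_tendsto.cong[OF analytic_family_U_tendsto[OF z iota_family[OF z x]] this]
  show ?thesis using z by simp
qed

lemma iota_U_derivative:
  assumes z: "z \<noteq> P" and x: "x \<in> U {z}"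
  shows "\<exists>d. U_has_derivative P u \<eta> (\<lambda>y. \<iota> y v x) d z"
proof -
  obtain d where d: "U_has_derivative P u \<eta> (\<lambda>y. \<iota> (pt (u y)) v x) d z"
    using analytic_family_U_derivative[OF z iota_family[OF z x]] by blast
  have "\<forall>\<^sub>F y in at_point z. (1 / (u y - u z)) *\<^sub>C (\<iota> (pt (u y)) v x - \<iota> (pt (u z)) v x) =
      (1 / (u y - u z)) *\<^sub>C (\<iota> y v x - \<iota> z v x)"
    using eventually_at_point_pt[OF z] by eventually_elim (simp add: z)
  from U_tendsto.cong[OF d[unfolded U_has_derivative_def] this]
  show ?thesis unfolding U_has_derivative_def by blast
qed

lemma U_eventually_at_point:
  assumes "z \<noteq> P" "x \<in> U {z}"
  shows "\<forall>\<^sub>F y in at_point z. x \<in> U {z, y}"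
  using U_eventually_regular[OF assms(2), of "u z"] assms(1)
  by (simp add: eventually_at_point insert_commute)

text \<open>An exact identity at distinct points, arranged so that every term on the right has a
  limit. Reordering the two poles releases simple-pole terms; with those of
  \<open>current_eps\<close> and the subtracted current they cancel down to the difference quotient
  of \<open>iota\<close>.\<close>

lemma current_product_regularised:
  assumes z: "z \<noteq> P" "y \<noteq> P" "y \<noteq> z" and x: "x \<in> U {z, y}"
  shows "\<j> y v' (\<j> z v x) - (B v v' / (u z - u y)\<^sup>2) *\<^sub>C x - (1 / (u y - u z)) *\<^sub>C \<j> z (lie v' v) x =
    \<iota> y v' (\<iota> z v x) + \<epsilon> y v' * (\<epsilon> z v * x) + \<epsilon> y v' * \<iota> z v x + \<epsilon> z v * \<iota> y v' x
    + (1 / (u y - u z)) *\<^sub>C (\<iota> y (lie v' v) x - \<iota> z (lie v' v) x)"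
proof -
  define c where "c = 1 / (u y - u z)"
  have xy: "x \<in> U {y}" using x U_mono[of "{y}" "{z, y}"] by auto
  have \<iota>y: "\<iota> z v x \<in> U {y}"
    using iota_in_U[of "{z, y}" z x v] z x U_mono[of "{y}" "{z, y}"] by auto
  have \<epsilon>y: "\<epsilon> z v * x \<in> U {y}"
    unfolding eps_eq by (intro letter_mult_in_U eps_letter) (use z xy in auto)
  have "\<j> y v' (\<j> z v x) = \<j> y v' (\<epsilon> z v * x) + \<j> y v' (\<iota> z v x)"
    using current_add[OF z(2) \<epsilon>y \<iota>y] by (simp add: current_def[of _ _ _ _ z])
  also have "\<j> y v' (\<epsilon> z v * x) = \<epsilon> z v * \<j> y v' x + c *\<^sub>C \<j> y (lie v' v) x + (B v v' / (u z - u y)\<^sup>2) *\<^sub>C x"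
    using current_eps[of z y x v' v] z xy
    by (simp add: c_def form_commute[of v v'] power2_commute[of "u z"])
  also have "\<epsilon> z v * \<j> y v' x = (\<epsilon> y v' * \<epsilon> z v - c *\<^sub>C (\<epsilon> y (lie v' v) - \<epsilon> z (lie v' v))) * x + \<epsilon> z v * \<iota> y v' x"
    using eps_commutator[of z y v' v] z by (simp add: c_def[symmetric] current_def algebra_simps)
  finally show ?thesis
    unfolding c_def[symmetric]
    by (simp add: current_def algebra_simps mult_scaleC_simps scaleC_add_right cvec.scale_right_diff_distrib)
qed

text \<open>The difference quotient in the regularised identity tends to \<open>d\<close>, and the
  other terms converge factor by factor. The identity applies because near \<open>z\<close> the
  point \<open>y\<close> avoids \<open>P\<close> and \<open>z\<close>, and \<open>x\<close> is
  regular at \<open>y\<close>.\<close>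

lemma current_product_tendsto:
  assumes z: "z \<noteq> P" and x: "x \<in> U {z}"
    and d: "U_has_derivative P u \<eta> (\<lambda>y. \<iota> y (lie v' v) x) d z"
  shows "U_tendsto P \<eta>
    (\<lambda>y. \<j> y v' (\<j> z v x) - (B v v' / (u z - u y)\<^sup>2) *\<^sub>C x - (1 / (u y - u z)) *\<^sub>C \<j> z (lie v' v) x)
    (\<iota> z v' (\<iota> z v x) + \<epsilon> z v' * (\<epsilon> z v * x) + \<epsilon> z v' * \<iota> z v x + \<epsilon> z v * \<iota> z v' x + d)
    (at_point z)"
proof (rule U_tendsto.cong)
  have "\<iota> z v x \<in> U {z}" using z x by (intro iota_in_U) auto
  thus "U_tendsto P \<eta>
    (\<lambda>y. \<iota> y v' (\<iota> z v x) + \<epsilon> y v' * (\<epsilon> z v * x) + \<epsilon> y v' * \<iota> z v x + \<epsilon> z v * \<iota> y v' x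
      + (1 / (u y - u z)) *\<^sub>C (\<iota> y (lie v' v) x - \<iota> z (lie v' v) x))
    (\<iota> z v' (\<iota> z v x) + \<epsilon> z v' * (\<epsilon> z v * x) + \<epsilon> z v' * \<iota> z v x + \<epsilon> z v * \<iota> z v' x + d)
    (at_point z)"
    using d unfolding U_has_derivative_def
    by (intro U_tendsto.add U_tendsto.mult U_tendsto.const eps_tendsto iota_tendsto z x)
  have "\<forall>\<^sub>F w in at (u z). w \<noteq> u z" by (simp add: eventually_at_filter)
  hence "\<forall>\<^sub>F y in at_point z. y \<noteq> P \<and> y \<noteq> z"
    using z by (auto simp: eventually_at_point pt_eq_iff_u)
  with U_eventually_at_point[OF z x]
  show "\<forall>\<^sub>F y in at_point z. \<iota> y v' (\<iota> z v x) + \<epsilon> y v' * (\<epsilon> z v * x) + \<epsilon> y v' * \<iota> z v x + \<epsilon> z v * \<iota> y v' x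
      + (1 / (u y - u z)) *\<^sub>C (\<iota> y (lie v' v) x - \<iota> z (lie v' v) x) =
    \<j> y v' (\<j> z v x) - (B v v' / (u z - u y)\<^sup>2) *\<^sub>C x - (1 / (u y - u z)) *\<^sub>C \<j> z (lie v' v) x"
    by eventually_elim (rule current_product_regularised[symmetric], use z in auto)
qed

end

theorem proposition11p3:
  fixes B :: "'g::complex_lie_algebra \<Rightarrow> 'g \<Rightarrow> complex"
    and P z1 z2 :: proj_line
    and u :: "proj_line \<Rightarrow> complex"
    and \<eta> :: "(proj_line \<Rightarrow> 'g) \<Rightarrow> 'u::complex_algebra_1"
    and v1 v2 :: 'g
  assumes "nondegenerate_invariant_form B"
    and "coordinate_with_pole u P"
    and "is_enveloping_algebra (gminus P {}) \<eta>"
    and "z1 \<noteq> P" and "z2 \<noteq> P" and "z1 \<noteq> z2"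
  shows "(\<forall>x\<in>Usub P \<eta> {z1, z2}.
            current B P u \<eta> z1 v1 x \<in> Usub P \<eta> {z2} \<and>
            current B P u \<eta> z2 v2 x \<in> Usub P \<eta> {z1} \<and>
            current B P u \<eta> z2 v2 (current B P u \<eta> z1 v1 x) =
            current B P u \<eta> z1 v1 (current B P u \<eta> z2 v2 x))
       \<and> (\<forall>x\<in>Usub P \<eta> {z1}. \<forall>\<^sub>F z in at_point z1. x \<in> Usub P \<eta> {z1, z})
       \<and> (\<exists>D. \<forall>x\<in>Usub P \<eta> {z1}.
            U_has_derivative P u \<eta> (\<lambda>z. iota B P u \<eta> z (lie v2 v1) x) (D x) z1 \<and>
            U_tendsto P \<eta>
              (\<lambda>z. current B P u \<eta> z v2 (current B P u \<eta> z1 v1 x)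
                   - (B v1 v2 / (u z1 - u z)\<^sup>2) *\<^sub>C x
                   - (1 / (u z - u z1)) *\<^sub>C current B P u \<eta> z1 (lie v2 v1) x)
              (iota B P u \<eta> z1 v2 (iota B P u \<eta> z1 v1 x)
               + eps P u \<eta> z1 v2 * (eps P u \<eta> z1 v1 * x)
               + eps P u \<eta> z1 v2 * iota B P u \<eta> z1 v1 x
               + eps P u \<eta> z1 v1 * iota B P u \<eta> z1 v2 x
               + D x)
              (at_point z1))"
proof -
  interpret currents P u B \<eta>
    by unfold_locales (rule assms)+
  \<comment> \<open>The derivatives at the individual vectors are collected into one operator by
    choice.\<close>
  have "\<exists>D. \<forall>x\<in>U {z1}. U_has_derivative P u \<eta> (\<lambda>z. \<iota> z (lie v2 v1) x) (D x) z1"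
    using iota_U_derivative[OF assms(4)] by (intro bchoice) blast
  then obtain D where D: "\<And>x. x \<in> U {z1} \<Longrightarrow> U_has_derivative P u \<eta> (\<lambda>z. \<iota> z (lie v2 v1) x) (D x) z1"
    by blast
  have comm: "\<j> z1 v1 x \<in> U {z2} \<and> \<j> z2 v2 x \<in> U {z1} \<and> \<j> z2 v2 (\<j> z1 v1 x) = \<j> z1 v1 (\<j> z2 v2 x)"
    if "x \<in> U {z1, z2}" for x
    using current_in_U[of z1 z2 x v1] current_in_U[of z2 z1 x v2] currents_commute[of z1 z2 x v2 v1] that assms(4-6)
    by (simp add: insert_commute)
  show ?thesis
    using comm U_eventually_at_point[OF assms(4)] D current_product_tendsto[OF assms(4) _ D]
    by (intro conjI ballI exI[of _ D]) simp_all
qed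

end
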